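(* For every $n\geq 1$, the odd-dimensional sphere $\mathbb{S}^{2n+1}$ does not admit any anti-quasi-Sasakian structure.
   Context: An almost contact metric structure $(\varphi,\xi,\eta,g)$ on a smooth manifold $M$ of odd dimension consists of a $(1,1)$-tensor field $\varphi$, a vector field $\xi$, a $1$-form $\eta$ and a Riemannian metric $g$ (arbitrary, not necessarily the round metric when $M$ is a sphere) with $\varphi^2=-I+\eta\otimes\xi$, $\eta(\xi)=1$, and $g(\varphi X,\varphi Y)=g(X,Y)-\eta(X)\eta(Y)$ for all vector fields $X,Y$. Its fundamental $2$-form is $\Phi(X,Y)=g(X,\varphi Y)$. Put $N_\varphi=[\varphi,\varphi]+d\eta\otimes\xi$, where $[\varphi,\varphi](X,Y)=[\varphi X,\varphi Y]+\varphi^2[X,Y]-\varphi[X,\varphi Y]-\varphi[\varphi X,Y]$ and $d\eta(X,Y)=X\eta(Y)-Y\eta(X)-\eta([X,Y])$. The structure is called anti-quasi-Sasakian if $d\Phi=0$ and $N_\varphi=2\,d\eta\otimes\xi$. No assumption on the rank of $\eta$ is made. *)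

theory Defs
  imports "HOL-Analysis.Analysis"
begin

text \<open>
  Differential geometry on a smooth embedded submanifold \<open>M\<close> (without boundary) of a Euclidean
  space. Smoothness always means \<open>C\<^sup>\<infinity>\<close>. Vector fields and tensor fields are represented by
  functions on the ambient type, of which only the values at points of \<open>M\<close> (and, for tensors,
  at vectors tangent to \<open>M\<close>) are relevant.
\<close>

primrec higher_differentiable_on ::
    "'a::real_normed_vector set \<Rightarrow> ('a \<Rightarrow> 'b::real_normed_vector) \<Rightarrow> nat \<Rightarrow> bool" where
  "higher_differentiable_on U f 0 \<longleftrightarrow> continuous_on U f"
| "higher_differentiable_on U f (Suc k) \<longleftrightarrow>
     (\<forall>x\<in>U. f differentiable (at x)) \<and>
     (\<forall>v. higher_differentiable_on U (\<lambda>x. frechet_derivative f (at x) v) k)"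

text \<open>To be used for open \<open>U\<close> only.\<close>

definition smooth_on ::
    "'a::real_normed_vector set \<Rightarrow> ('a \<Rightarrow> 'b::real_normed_vector) \<Rightarrow> bool" where
  "smooth_on U f \<longleftrightarrow> (\<forall>k. higher_differentiable_on U f k)"

text \<open>Smoothness of a map defined on a submanifold: local smooth extendability.\<close>

definition smooth_map_on ::
    "'a::euclidean_space set \<Rightarrow> ('a \<Rightarrow> 'b::real_normed_vector) \<Rightarrow> bool" where
  "smooth_map_on M f \<longleftrightarrow>
     (\<forall>p\<in>M. \<exists>U F. open U \<and> p \<in> U \<and> smooth_on U F \<and> (\<forall>x\<in>U \<inter> M. F x = f x))"

text \<open>Tangent vectors are the velocities of smooth curves in \<open>M\<close>.\<close>

definition tangent_space :: "'a::euclidean_space set \<Rightarrow> 'a \<Rightarrow> 'a set" where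
  "tangent_space M p =
     {v. \<exists>\<gamma> e. 0 < e \<and> smooth_on {-e<..<e} \<gamma> \<and> \<gamma> ` {-e<..<e} \<subseteq> M \<and> \<gamma> (0::real) = p \<and>
            (\<gamma> has_vector_derivative v) (at 0)}"

definition vector_field :: "'a::euclidean_space set \<Rightarrow> ('a \<Rightarrow> 'a) \<Rightarrow> bool" where
  "vector_field M X \<longleftrightarrow> (\<forall>p\<in>M. X p \<in> tangent_space M p) \<and> smooth_map_on M X"

text \<open>
  The derivative \<open>X f\<close> of a (vector-valued) function \<open>f\<close> on \<open>M\<close>. A Frechet derivative within
  \<open>M\<close> is not unique as a linear map on the ambient space, but its values at tangent vectors
  are, see \<open>deriv_along_curve\<close> below.
\<close>

definition deriv_along ::
    "'a::euclidean_space set \<Rightarrow> ('a \<Rightarrow> 'a) \<Rightarrow> ('a \<Rightarrow> 'b::real_normed_vector) \<Rightarrow> 'a \<Rightarrow> 'b" where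
  "deriv_along M X f p = frechet_derivative f (at p within M) (X p)"

lemma smooth_map_on_differentiable:
  assumes "smooth_map_on M f" and "p \<in> M"
  shows "f differentiable (at p within M)"
proof -
  obtain U F where U: "open U" "p \<in> U" "smooth_on U F" "\<forall>x\<in>U \<inter> M. F x = f x"
    using assms unfolding smooth_map_on_def by blast
  have "higher_differentiable_on U F (Suc 0)"
    using U(3) unfolding smooth_on_def by blast
  then have "F differentiable (at p)"
    using U(2) by simp
  then have "F differentiable (at p within M)"
    by (rule differentiable_at_withinI)
  then obtain F' where F': "(F has_derivative F') (at p within M)"
    unfolding differentiable_def ..
  obtain d where d: "0 < d" "ball p d \<subseteq> U"
    using U(1,2) openE by blast
  have "(f has_derivative F') (at p within M)"
    by (rule has_derivative_transform_within[OF F' d(1) assms(2)])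
      (use d(2) U(4) in \<open>auto simp: subset_iff dist_commute\<close>)
  then show ?thesis
    unfolding differentiable_def by blast
qed

lemma deriv_along_curve:
  assumes "smooth_map_on M f" and "0 < e" and "\<gamma> ` {-e<..<e} \<subseteq> M" and "\<gamma> (0::real) = p"
    and "(\<gamma> has_vector_derivative X p) (at 0)"
  shows "((\<lambda>t. f (\<gamma> t)) has_vector_derivative deriv_along M X f p) (at 0)"
proof -
  have at: "at 0 within {-e<..<e} = at (0::real)"
    using assms(2) by (intro at_within_open) auto
  have "\<gamma> 0 \<in> \<gamma> ` {-e<..<e}"
    using assms(2) by (intro imageI) simp
  then have "p \<in> M"
    using assms(3,4) by blast
  then have "(f has_derivative frechet_derivative f (at p within M)) (at p within M)"
    using smooth_map_on_differentiable[OF assms(1)] by (simp add: frechet_derivative_works)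
  then have "(f has_derivative frechet_derivative f (at p within M))
      (at (\<gamma> 0) within \<gamma> ` {-e<..<e})"
    unfolding assms(4) using assms(3) by (rule has_derivative_subset)
  from vector_derivative_diff_chain_within[OF _ this, unfolded at, OF assms(5)] show ?thesis
    by (simp add: o_def deriv_along_def)
qed

text \<open>
  The Lie bracket, with the convention \<open>[X,Y] f = X (Y f) - Y (X f)\<close>. The formula below is this
  identity for \<open>f\<close> ranging over the coordinate functions of the ambient space, whose
  derivatives determine a tangent vector.
\<close>

definition lie_bracket ::
    "'a::euclidean_space set \<Rightarrow> ('a \<Rightarrow> 'a) \<Rightarrow> ('a \<Rightarrow> 'a) \<Rightarrow> ('a \<Rightarrow> 'a)" where
  "lie_bracket M X Y p = deriv_along M X Y p - deriv_along M Y X p"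

definition linear_map_on :: "'a::real_vector set \<Rightarrow> ('a \<Rightarrow> 'b::real_vector) \<Rightarrow> bool" where
  "linear_map_on V f \<longleftrightarrow>
     (\<forall>v\<in>V. \<forall>w\<in>V. f (v + w) = f v + f w) \<and> (\<forall>c. \<forall>v\<in>V. f (c *\<^sub>R v) = c *\<^sub>R f v)"

definition endo_apply :: "('a \<Rightarrow> 'a \<Rightarrow> 'a) \<Rightarrow> ('a \<Rightarrow> 'a) \<Rightarrow> ('a \<Rightarrow> 'a)" where
  "endo_apply \<phi> X = (\<lambda>p. \<phi> p (X p))"

definition form1_apply :: "('a \<Rightarrow> 'a \<Rightarrow> real) \<Rightarrow> ('a \<Rightarrow> 'a) \<Rightarrow> ('a \<Rightarrow> real)" where
  "form1_apply \<eta> X = (\<lambda>p. \<eta> p (X p))"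

definition form2_apply ::
    "('a \<Rightarrow> 'a \<Rightarrow> 'a \<Rightarrow> real) \<Rightarrow> ('a \<Rightarrow> 'a) \<Rightarrow> ('a \<Rightarrow> 'a) \<Rightarrow> ('a \<Rightarrow> real)" where
  "form2_apply \<omega> X Y = (\<lambda>p. \<omega> p (X p) (Y p))"

text \<open>A tensor field is smooth if it yields smooth objects when applied to smooth vector fields.\<close>

definition tensor_field_1_1 :: "'a::euclidean_space set \<Rightarrow> ('a \<Rightarrow> 'a \<Rightarrow> 'a) \<Rightarrow> bool" where
  "tensor_field_1_1 M \<phi> \<longleftrightarrow>
     (\<forall>p\<in>M. linear_map_on (tangent_space M p) (\<phi> p) \<and>
            \<phi> p ` tangent_space M p \<subseteq> tangent_space M p) \<and>
     (\<forall>X. vector_field M X \<longrightarrow> vector_field M (endo_apply \<phi> X))"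

definition one_form :: "'a::euclidean_space set \<Rightarrow> ('a \<Rightarrow> 'a \<Rightarrow> real) \<Rightarrow> bool" where
  "one_form M \<eta> \<longleftrightarrow>
     (\<forall>p\<in>M. linear_map_on (tangent_space M p) (\<eta> p)) \<and>
     (\<forall>X. vector_field M X \<longrightarrow> smooth_map_on M (form1_apply \<eta> X))"

definition riemannian_metric :: "'a::euclidean_space set \<Rightarrow> ('a \<Rightarrow> 'a \<Rightarrow> 'a \<Rightarrow> real) \<Rightarrow> bool" where
  "riemannian_metric M g \<longleftrightarrow>
     (\<forall>p\<in>M. (\<forall>v\<in>tangent_space M p. linear_map_on (tangent_space M p) (g p v)) \<and>
            (\<forall>v\<in>tangent_space M p. \<forall>w\<in>tangent_space M p. g p v w = g p w v) \<and>
            (\<forall>v\<in>tangent_space M p. v \<noteq> 0 \<longrightarrow> 0 < g p v v)) \<and>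
     (\<forall>X Y. vector_field M X \<longrightarrow> vector_field M Y \<longrightarrow> smooth_map_on M (form2_apply g X Y))"

definition almost_contact_metric_structure ::
    "'a::euclidean_space set \<Rightarrow> ('a \<Rightarrow> 'a \<Rightarrow> 'a) \<Rightarrow> ('a \<Rightarrow> 'a) \<Rightarrow> ('a \<Rightarrow> 'a \<Rightarrow> real) \<Rightarrow>
     ('a \<Rightarrow> 'a \<Rightarrow> 'a \<Rightarrow> real) \<Rightarrow> bool" where
  "almost_contact_metric_structure M \<phi> \<xi> \<eta> g \<longleftrightarrow>
     tensor_field_1_1 M \<phi> \<and> vector_field M \<xi> \<and> one_form M \<eta> \<and> riemannian_metric M g \<and>
     (\<forall>p\<in>M. \<forall>v\<in>tangent_space M p. \<phi> p (\<phi> p v) = - v + \<eta> p v *\<^sub>R \<xi> p) \<and>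
     (\<forall>p\<in>M. \<eta> p (\<xi> p) = 1) \<and>
     (\<forall>X Y. vector_field M X \<longrightarrow> vector_field M Y \<longrightarrow>
        (\<forall>p\<in>M. form2_apply g (endo_apply \<phi> X) (endo_apply \<phi> Y) p =
               form2_apply g X Y p - form1_apply \<eta> X p * form1_apply \<eta> Y p))"

definition fundamental_form ::
    "('a \<Rightarrow> 'a \<Rightarrow> 'a \<Rightarrow> real) \<Rightarrow> ('a \<Rightarrow> 'a \<Rightarrow> 'a) \<Rightarrow> ('a \<Rightarrow> 'a \<Rightarrow> 'a \<Rightarrow> real)" where
  "fundamental_form g \<phi> = (\<lambda>p v w. g p v (\<phi> p w))"

definition ext_deriv1 ::
    "'a::euclidean_space set \<Rightarrow> ('a \<Rightarrow> 'a \<Rightarrow> real) \<Rightarrow> ('a \<Rightarrow> 'a) \<Rightarrow> ('a \<Rightarrow> 'a) \<Rightarrow> ('a \<Rightarrow> real)" where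
  "ext_deriv1 M \<eta> X Y p =
     deriv_along M X (form1_apply \<eta> Y) p - deriv_along M Y (form1_apply \<eta> X) p
     - form1_apply \<eta> (lie_bracket M X Y) p"

definition ext_deriv2 ::
    "'a::euclidean_space set \<Rightarrow> ('a \<Rightarrow> 'a \<Rightarrow> 'a \<Rightarrow> real) \<Rightarrow>
     ('a \<Rightarrow> 'a) \<Rightarrow> ('a \<Rightarrow> 'a) \<Rightarrow> ('a \<Rightarrow> 'a) \<Rightarrow> ('a \<Rightarrow> real)" where
  "ext_deriv2 M \<omega> X Y Z p =
     deriv_along M X (form2_apply \<omega> Y Z) p
     + deriv_along M Y (form2_apply \<omega> Z X) p
     + deriv_along M Z (form2_apply \<omega> X Y) p
     - form2_apply \<omega> (lie_bracket M X Y) Z p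
     - form2_apply \<omega> (lie_bracket M Y Z) X p
     - form2_apply \<omega> (lie_bracket M Z X) Y p"

definition nijenhuis_torsion ::
    "'a::euclidean_space set \<Rightarrow> ('a \<Rightarrow> 'a \<Rightarrow> 'a) \<Rightarrow> ('a \<Rightarrow> 'a) \<Rightarrow> ('a \<Rightarrow> 'a) \<Rightarrow> ('a \<Rightarrow> 'a)" where
  "nijenhuis_torsion M \<phi> X Y p =
     lie_bracket M (endo_apply \<phi> X) (endo_apply \<phi> Y) p
     + endo_apply \<phi> (endo_apply \<phi> (lie_bracket M X Y)) p
     - endo_apply \<phi> (lie_bracket M X (endo_apply \<phi> Y)) p
     - endo_apply \<phi> (lie_bracket M (endo_apply \<phi> X) Y) p"

definition N_tensor ::
    "'a::euclidean_space set \<Rightarrow> ('a \<Rightarrow> 'a \<Rightarrow> 'a) \<Rightarrow> ('a \<Rightarrow> 'a) \<Rightarrow> ('a \<Rightarrow> 'a \<Rightarrow> real) \<Rightarrow>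
     ('a \<Rightarrow> 'a) \<Rightarrow> ('a \<Rightarrow> 'a) \<Rightarrow> ('a \<Rightarrow> 'a)" where
  "N_tensor M \<phi> \<xi> \<eta> X Y p =
     nijenhuis_torsion M \<phi> X Y p + ext_deriv1 M \<eta> X Y p *\<^sub>R \<xi> p"

definition anti_quasi_Sasakian ::
    "'a::euclidean_space set \<Rightarrow> ('a \<Rightarrow> 'a \<Rightarrow> 'a) \<Rightarrow> ('a \<Rightarrow> 'a) \<Rightarrow> ('a \<Rightarrow> 'a \<Rightarrow> real) \<Rightarrow>
     ('a \<Rightarrow> 'a \<Rightarrow> 'a \<Rightarrow> real) \<Rightarrow> bool" where
  "anti_quasi_Sasakian M \<phi> \<xi> \<eta> g \<longleftrightarrow>
     almost_contact_metric_structure M \<phi> \<xi> \<eta> g \<and>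
     (\<forall>X Y Z. vector_field M X \<longrightarrow> vector_field M Y \<longrightarrow> vector_field M Z \<longrightarrow>
        (\<forall>p\<in>M. ext_deriv2 M (fundamental_form g \<phi>) X Y Z p = 0)) \<and>
     (\<forall>X Y. vector_field M X \<longrightarrow> vector_field M Y \<longrightarrow>
        (\<forall>p\<in>M. N_tensor M \<phi> \<xi> \<eta> X Y p = (2 * ext_deriv1 M \<eta> X Y p) *\<^sub>R \<xi> p))"

end

theory Submission
  imports Defs
begin

text \<open>
  Let \<open>m = 2n + 1\<close>. The \<open>\<xi>\<close>-component of the condition on \<open>N_\<phi>\<close> makes \<open>d\<eta>\<close> anti-invariant under \<open>\<phi>\<close>,
  hence \<open>d\<eta>\<close> annihilates \<open>\<xi>\<close> and is trace-free against \<open>\<Phi>\<close>, that is \<open>d\<eta> \<and> \<Phi>^(n-1) = 0\<close>. As \<open>m \<ge> 3\<close>,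
  the closed form \<open>\<Phi>\<close> should be exact, \<open>\<Phi> = d\<beta>\<close>, and then the volume form \<open>\<eta> \<and> \<Phi>^n\<close> is, up to sign,
  the differential of \<open>\<eta> \<and> \<beta> \<and> \<Phi>^(n-1)\<close>, so that the volume of the sphere would vanish.

  This is carried out in a single stereographic chart, where \<open>\<beta>\<close> comes from the radial Poincare
  homotopy. Let \<open>P\<close> be the bivector inverse to \<open>\<Phi>\<close> on the kernel of \<open>\<eta>\<close> and \<open>\<rho>\<close> the square root of
  the determinant of \<open>\<Phi> + \<eta> \<otimes> \<eta>\<close>. The two properties of \<open>d\<eta>\<close> together with \<open>d\<Phi> = 0\<close> say that \<open>\<rho> P\<close> is
  divergence-free, so the field \<open>\<rho> P \<beta>\<close> has divergence \<open>- (m - 1) \<rho> / 2\<close>. Since all tensors extend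
  over the pole, it is of size \<open>|x|^(3 - 2m)\<close>, and its flux through the faces of a cube of side
  \<open>R\<close> is of order \<open>R^(2 - m)\<close>, which tends to zero.
\<close>

subsection \<open>Functions with continuous partial derivatives\<close>

text \<open>Exterior powers are avoided. Up to a constant, \<open>\<rho> P \<beta>\<close> is the
  vector field that corresponds to \<open>\<eta> \<and> \<beta> \<and> \<Phi>^(n-1)\<close> under
  the volume form, because \<open>\<rho>\<close> is the absolute value of a Pfaffian, the
  coefficient of \<open>\<eta> \<and> \<Phi>^n / n!\<close>. Inverse matrices and logarithmic
  derivatives of determinants thus treat all \<open>n\<close> at once. The rate
  \<open>(m - 1) / 2\<close> is half the trace of the projection \<open>P \<Phi>\<close> along
  \<open>\<xi>\<close>.

  The obstacle is the pole: a one-form that extends over it has components of size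
  \<open>|x|^(-2)\<close>, whereas the radial primitive \<open>\<beta>\<close> is only known to be
  of size \<open>|x|^(-1)\<close>. Stokes' theorem on the closed sphere is therefore replaced by a
  count of powers. The coordinate fields have length of order \<open>|x|^(-2)\<close>, so
  \<open>\<Phi>\<close> is of size \<open>|x|^(-4)\<close>, \<open>P\<close> of size
  \<open>|x|^4\<close> and \<open>\<rho>\<close> of size \<open>|x|^(-2m)\<close>. Even with the
  weaker \<open>\<beta>\<close> the field decays fast enough against the area \<open>R^(m-1)\<close>
  of a face once \<open>m >= 3\<close>.\<close>

definition has_pders :: "(real^'n \<Rightarrow> real) \<Rightarrow> ('n \<Rightarrow> real^'n \<Rightarrow> real) \<Rightarrow> bool" where
  "has_pders f f' \<longleftrightarrow> continuous_on UNIV f \<and> (\<forall>k. continuous_on UNIV (f' k) \<and>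
     (\<forall>x. ((\<lambda>s. f (x + s *\<^sub>R axis k 1)) has_real_derivative f' k x) (at 0)))"

lemma has_pdersI:
  assumes "continuous_on UNIV f" "\<And>k. continuous_on UNIV (f' k)"
    "\<And>k x. ((\<lambda>s. f (x + s *\<^sub>R axis k 1)) has_real_derivative f' k x) (at 0)"
  shows "has_pders f f'"
  using assms by (simp add: has_pders_def)

lemma has_pdersD:
  assumes "has_pders f f'"
  shows has_pders_continuous: "continuous_on UNIV f"
    and has_pders_continuous': "continuous_on UNIV (f' k)"
    and has_pders_deriv: "((\<lambda>s. f (x + s *\<^sub>R axis k 1)) has_real_derivative f' k x) (at 0)"
  using assms by (auto simp: has_pders_def)

lemma has_pders_deriv_at:
  assumes "has_pders f f'"
  shows "((\<lambda>s. f (x + s *\<^sub>R axis k 1)) has_real_derivative f' k (x + s *\<^sub>R axis k 1)) (at s)"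
  using has_pders_deriv[OF assms, of "x + s *\<^sub>R axis k 1" k]
    DERIV_shift[of "\<lambda>s. f (x + s *\<^sub>R axis k 1)" _ 0 s]
  by (simp add: algebra_simps)

lemma has_pders_unique:
  assumes "has_pders f f'" "has_pders f f''"
  shows "f' k x = f'' k x"
  using has_pders_deriv[OF assms(1)] has_pders_deriv[OF assms(2)] DERIV_unique by blast

lemma has_pders_cong:
  assumes "has_pders f f'" "\<And>x. f x = g x" "\<And>k x. f' k x = g' k x"
  shows "has_pders g g'"
proof -
  have "f = g" "f' = g'" using assms by (auto intro!: ext)
  then show ?thesis using assms by simp
qed

lemma has_pders_const: "has_pders (\<lambda>x. c) (\<lambda>k x. 0)"
  by (auto simp: has_pders_def)

lemma has_pders_add:
  assumes "has_pders f f'" "has_pders g g'"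
  shows "has_pders (\<lambda>x. f x + g x) (\<lambda>k x. f' k x + g' k x)"
  using assms by (auto simp: has_pders_def intro!: continuous_intros DERIV_add)

lemma has_pders_minus:
  assumes "has_pders f f'"
  shows "has_pders (\<lambda>x. - f x) (\<lambda>k x. - f' k x)"
  using assms by (auto simp: has_pders_def intro!: continuous_intros DERIV_minus)

lemma has_pders_diff:
  assumes "has_pders f f'" "has_pders g g'"
  shows "has_pders (\<lambda>x. f x - g x) (\<lambda>k x. f' k x - g' k x)"
  using assms by (auto simp: has_pders_def intro!: continuous_intros DERIV_diff)

lemma has_pders_mult:
  assumes "has_pders f f'" "has_pders g g'"
  shows "has_pders (\<lambda>x. f x * g x) (\<lambda>k x. f' k x * g x + f x * g' k x)"
proof (rule has_pdersI)
  fix k x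
  show "((\<lambda>s. f (x + s *\<^sub>R axis k 1) * g (x + s *\<^sub>R axis k 1)) has_real_derivative
      f' k x * g x + f x * g' k x) (at 0)"
    using DERIV_mult[OF has_pders_deriv[OF assms(1)] has_pders_deriv[OF assms(2)], of x k]
    by (simp add: algebra_simps)
qed (use assms in \<open>auto simp: has_pders_def intro!: continuous_intros\<close>)

lemma has_pders_sum:
  assumes "\<And>i. i \<in> I \<Longrightarrow> has_pders (f i) (f' i)"
  shows "has_pders (\<lambda>x. \<Sum>i\<in>I. f i x) (\<lambda>k x. \<Sum>i\<in>I. f' i k x)"
proof (rule has_pdersI)
  fix k x
  show "((\<lambda>s. \<Sum>i\<in>I. f i (x + s *\<^sub>R axis k 1)) has_real_derivative (\<Sum>i\<in>I. f' i k x)) (at 0)"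
    by (rule DERIV_sum) (use assms has_pders_deriv in blast)
qed (use assms in \<open>auto simp: has_pders_def intro!: continuous_intros\<close>)

text \<open>Partial derivatives are the working notion because the inverse matrix, the determinant
  and the radial integral are differentiated along one coordinate line at a time, and the flux
  through the faces of a cube asks for no more. The components of the structure enter here.\<close>

lemma has_pders_has_derivative:
  fixes f :: "real^'n \<Rightarrow> real"
  assumes "\<And>x. (f has_derivative (\<lambda>v. \<Sum>k\<in>UNIV. v $ k * f' k x)) (at x)"
    and "\<And>k. continuous_on UNIV (f' k)"
  shows "has_pders f f'"
proof (rule has_pdersI)
  show "continuous_on UNIV f"
    by (intro continuous_at_imp_continuous_on ballI has_derivative_continuous[OF assms(1)])
  fix k and x :: "real^'n"
  have "((\<lambda>s. x + s *\<^sub>R axis k 1) has_derivative (\<lambda>s. s *\<^sub>R axis k 1)) (at (0::real))"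
    by (auto intro!: derivative_eq_intros)
  from diff_chain_at[OF this, of f "\<lambda>v. \<Sum>j\<in>UNIV. v $ j * f' j x"] assms(1)[of x]
  have "((\<lambda>s. f (x + s *\<^sub>R axis k 1)) has_derivative
      (\<lambda>s. \<Sum>j\<in>UNIV. (s *\<^sub>R axis k 1 :: real^'n) $ j * f' j x)) (at 0)"
    by (simp add: o_def)
  moreover have "(\<Sum>j\<in>UNIV. (s *\<^sub>R axis k 1 :: real^'n) $ j * f' j x) = f' k x * s" for s
    by (simp add: axis_def if_distrib if_distribR cong: if_cong)
  ultimately show "((\<lambda>s. f (x + s *\<^sub>R axis k 1)) has_real_derivative f' k x) (at 0)"
    by (simp add: has_field_derivative_def)
qed (use assms in auto)

text \<open>
  Translating the cube in direction \<open>k\<close> changes the integral of \<open>f\<close> only by the contributions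
  of two thin slabs at the faces, while its rate of change is the integral of \<open>f' k\<close>.
\<close>

lemma integral_pder_cube_bound:
  fixes f :: "real^'n \<Rightarrow> real"
  assumes f: "has_pders f f'" and R: "0 < R"
    and bound: "\<And>x. R / 2 \<le> norm x \<Longrightarrow> \<bar>f x\<bar> \<le> K"
  shows "\<bar>integral (cbox (\<chi> i. - R) (\<chi> i. R)) (f' k)\<bar> \<le> 2 * K * (2 * R) ^ (CARD('n) - 1)"
proof -
  define e :: "real^'n" where "e = axis k 1"
  define a b :: "real^'n" where "a = (\<chi> i. - R)" and "b = (\<chi> i. R)"
  define G where "G = (\<lambda>s. integral (cbox a b) (\<lambda>x. f (x + s *\<^sub>R e)))"
  define L where "L = 2 * K * (2 * R) ^ (CARD('n) - 1)"
  have cf: "continuous_on S f" for S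
    using has_pders_continuous[OF f] continuous_on_subset by blast
  have int: "f integrable_on (cbox u v)" for u v
    by (rule integrable_continuous[OF cf])
  have K: "0 \<le> K"
  proof -
    have "R / 2 \<le> norm (R *\<^sub>R e)" using R by (simp add: e_def)
    from bound[OF this] show ?thesis by linarith
  qed
  have comp: "\<bar>x $ k\<bar> \<le> norm x" for x :: "real^'n"
    by (rule component_le_norm_cart)
  have G': "(G has_real_derivative integral (cbox a b) (f' k)) (at 0)"
  proof -
    have "((\<lambda>s. integral (cbox a b) (\<lambda>x. f (x + s *\<^sub>R e))) has_field_derivative
        integral (cbox a b) (\<lambda>x. f' k (x + 0 *\<^sub>R e))) (at 0 within UNIV)"
    proof (rule leibniz_rule_field_derivative)
      show "((\<lambda>s. f (x + s *\<^sub>R e)) has_real_derivative f' k (x + s *\<^sub>R e)) (at s within UNIV)" for s x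
        using has_pders_deriv_at[OF f] by (simp add: e_def)
      show "(\<lambda>x. f (x + s *\<^sub>R e)) integrable_on cbox a b" for s
        by (intro integrable_continuous continuous_on_compose2[OF has_pders_continuous[OF f]]
            continuous_intros) auto
      show "continuous_on (UNIV \<times> cbox a b) (\<lambda>(s, x). f' k (x + s *\<^sub>R e))"
        unfolding split_def
        by (intro continuous_on_compose2[OF has_pders_continuous'[OF f]] continuous_intros) auto
    qed auto
    then show ?thesis by (simp add: G_def)
  qed
  \<comment> \<open>The restriction \<open>s < R / 2\<close> keeps the trailing slab, where
    \<open>x $ k \<le> - R + s\<close>, at distance at least \<open>R / 2\<close> from the origin,
    so that \<open>bound\<close> applies there.\<close>
  have diff: "\<bar>G s - G 0\<bar> \<le> L * s" if s: "0 < s" "s < R / 2" for s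
  proof -
    have Gs: "G s = integral (cbox (a + s *\<^sub>R e) (b + s *\<^sub>R e)) f"
      using integral_shift_cbox_plus[of a b f "s *\<^sub>R e"]
      by (simp add: G_def o_def add.commute)
    have G0: "G 0 = integral (cbox a b) f" by (simp add: G_def)
    define b' where "b' = (\<chi> i. if i = k then - R + s else R)"
    define a' where "a' = (\<chi> i. if i = k then R else - R)"
    have ek: "e \<in> Basis" by (simp add: e_def axis_in_Basis_iff)
    have ie: "x \<bullet> e = x $ k" for x by (simp add: e_def inner_axis)
    have mem: "x \<in> cbox u v \<longleftrightarrow> (\<forall>i. u $ i \<le> x $ i \<and> x $ i \<le> v $ i)" for x u v :: "real^'n"
      by (simp add: mem_box_cart)
    have bs: "(b + s *\<^sub>R e) $ i = (if i = k then R + s else R)"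
      "(a + s *\<^sub>R e) $ i = (if i = k then - R + s else - R)" "a $ i = - R" "b $ i = R"
      "a' $ i = (if i = k then R else - R)" "b' $ i = (if i = k then - R + s else R)" for i
      by (auto simp: a_def b_def a'_def b'_def e_def axis_def)
    have all_split: "(\<forall>i. Q i) \<longleftrightarrow> Q k \<and> (\<forall>i. i \<noteq> k \<longrightarrow> Q i)" for Q :: "'n \<Rightarrow> bool"
      by metis
    have mem': "x \<in> cbox u v \<longleftrightarrow> (u $ k \<le> x $ k \<and> x $ k \<le> v $ k) \<and>
        (\<forall>i. i \<noteq> k \<longrightarrow> u $ i \<le> x $ i \<and> x $ i \<le> v $ i)" for x u v :: "real^'n"
      unfolding mem by (rule all_split)
    \<comment> \<open>The elongated box \<open>cbox a (b + s *\<^sub>R e)\<close> contains both the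
      cube and its translate. Cut at \<open>R\<close> it is the cube and the leading slab, cut at
      \<open>- R + s\<close> it is the trailing slab and the translate; comparing the two leaves
      only slabs in \<open>G s - G 0\<close>.\<close>
    have s1: "cbox a (b + s *\<^sub>R e) \<inter> {x. x \<bullet> e \<le> R} = cbox a b"
      by (rule set_eqI) (use s R in \<open>simp only: Int_iff mem_Collect_eq mem' ie bs if_True if_False cong: conj_cong imp_cong; auto\<close>)
    have s2: "cbox a (b + s *\<^sub>R e) \<inter> {x. x \<bullet> e \<ge> R} = cbox a' (b + s *\<^sub>R e)"
      by (rule set_eqI) (use s R in \<open>simp only: Int_iff mem_Collect_eq mem' ie bs if_True if_False cong: conj_cong imp_cong; auto\<close>)
    have s3: "cbox a (b + s *\<^sub>R e) \<inter> {x. x \<bullet> e \<ge> - R + s} = cbox (a + s *\<^sub>R e) (b + s *\<^sub>R e)"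
      by (rule set_eqI) (use s R in \<open>simp only: Int_iff mem_Collect_eq mem' ie bs if_True if_False cong: conj_cong imp_cong; auto\<close>)
    have s4: "cbox a (b + s *\<^sub>R e) \<inter> {x. x \<bullet> e \<le> - R + s} = cbox a b'"
      by (rule set_eqI) (use s R in \<open>simp only: Int_iff mem_Collect_eq mem' ie bs if_True if_False cong: conj_cong imp_cong; auto\<close>)
    have sp: "G 0 + integral (cbox a' (b + s *\<^sub>R e)) f = integral (cbox a b') f + G s"
      using integral_split[OF int ek, of a "b + s *\<^sub>R e" R]
        integral_split[OF int ek, of a "b + s *\<^sub>R e" "- R + s"]
      unfolding s1 s2 s3 s4 Gs G0 by linarith
    have prod: "(\<Prod>i\<in>UNIV. if i = k then s else 2 * R) = s * (2 * R) ^ (CARD('n) - 1)"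
    proof -
      have "(\<Prod>i\<in>UNIV. if i = k then s else 2 * R) = s * (\<Prod>i\<in>UNIV - {k}. if i = k then s else 2 * R)"
        by (subst prod.remove[of _ k]) auto
      also have "(\<Prod>i\<in>UNIV - {k}. if i = k then s else 2 * R) = (\<Prod>i\<in>UNIV - {k}. 2 * R)"
        by (rule prod.cong) auto
      finally show ?thesis by (simp add: card_Diff_singleton)
    qed
    have "measure lborel (cbox a' (b + s *\<^sub>R e)) = (\<Prod>i\<in>UNIV. (b + s *\<^sub>R e) $ i - a' $ i)"
      by (rule content_cbox_cart) (use s R in \<open>auto simp: interval_eq_empty_cart a'_def b_def e_def axis_def\<close>)
    also have "\<dots> = (\<Prod>i\<in>UNIV. if i = k then s else 2 * R)"
      by (rule prod.cong) (auto simp: a'_def b_def e_def axis_def)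
    finally have m1: "measure lborel (cbox a' (b + s *\<^sub>R e)) = s * (2 * R) ^ (CARD('n) - 1)"
      by (simp add: prod)
    have "measure lborel (cbox a b') = (\<Prod>i\<in>UNIV. b' $ i - a $ i)"
      by (rule content_cbox_cart) (use s R in \<open>auto simp: interval_eq_empty_cart a_def b'_def split: if_splits\<close>)
    also have "\<dots> = (\<Prod>i\<in>UNIV. if i = k then s else 2 * R)"
      by (rule prod.cong) (auto simp: b'_def a_def)
    finally have m2: "measure lborel (cbox a b') = s * (2 * R) ^ (CARD('n) - 1)"
      by (simp add: prod)
    have i1: "\<bar>integral (cbox a' (b + s *\<^sub>R e)) f\<bar> \<le> K * (s * (2 * R) ^ (CARD('n) - 1))"
    proof -
      have "norm (f x) \<le> K" if "x \<in> cbox a' (b + s *\<^sub>R e)" for x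
      proof -
        have "R \<le> x $ k" using that unfolding mem a'_def by (auto dest: spec[of _ k])
        then show ?thesis using bound[of x] comp[of x] by auto
      qed
      from has_integral_bound[OF K integrable_integral[OF int[of a' "b + s *\<^sub>R e"]] this]
      show ?thesis unfolding m1 by (simp only: real_norm_def)
    qed
    have i2: "\<bar>integral (cbox a b') f\<bar> \<le> K * (s * (2 * R) ^ (CARD('n) - 1))"
    proof -
      have "norm (f x) \<le> K" if "x \<in> cbox a b'" for x
      proof -
        have "x $ k \<le> - R + s" using that unfolding mem b'_def by (auto dest: spec[of _ k])
        then show ?thesis using bound[of x] comp[of x] s by auto
      qed
      from has_integral_bound[OF K integrable_integral[OF int[of a b']] this]
      show ?thesis unfolding m2 by (simp only: real_norm_def)
    qed
    show ?thesis using i1 i2 sp unfolding L_def by (simp add: abs_if algebra_simps split: if_splits)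
  qed
  \<comment> \<open>The slabs were estimated for positive \<open>s\<close>; since the derivative
    \<open>G'\<close> is two-sided, the right-hand difference quotients have the same limit.\<close>
  have "((\<lambda>s. (G s - G 0) / s) \<longlongrightarrow> integral (cbox a b) (f' k)) (at_right 0)"
    using G' unfolding has_field_derivative_iff
    by (simp add: filterlim_at_split)
  then have "((\<lambda>s. \<bar>(G s - G 0) / s\<bar>) \<longlongrightarrow> \<bar>integral (cbox a b) (f' k)\<bar>) (at_right 0)"
    by (rule tendsto_rabs)
  moreover have "\<forall>\<^sub>F s in at_right 0. \<bar>(G s - G 0) / s\<bar> \<le> L"
    unfolding eventually_at_right_field
    by (rule exI[of _ "R / 2"]) (use R diff in \<open>auto simp: abs_divide divide_le_eq\<close>)
  ultimately have "\<bar>integral (cbox a b) (f' k)\<bar> \<le> L"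
    by (rule tendsto_upperbound) simp
  then show ?thesis by (simp add: L_def a_def b_def)
qed

subsection \<open>Determinants and inverses of matrix-valued functions\<close>

lemma DERIV_det:
  fixes m :: "'n::finite \<Rightarrow> 'n \<Rightarrow> real \<Rightarrow> real"
  assumes "\<And>i j. (m i j has_real_derivative m' i j) (at t)"
  shows "((\<lambda>s. det (\<chi> i j. m i j s)) has_real_derivative
    (\<Sum>i\<in>UNIV. det (\<chi> l j. if l = i then m' i j else m l j t))) (at t)"
proof -
  have prod: "(\<Prod>l\<in>UNIV. if l = i then m' i (p l) else m l (p l) t) =
      m' i (p i) * (\<Prod>l\<in>UNIV - {i}. m l (p l) t)" for i and p :: "'n \<Rightarrow> 'n"
    by (subst prod.remove[of _ i]) (auto intro!: prod.cong)
  have "((\<lambda>s. \<Sum>p | p permutes UNIV. of_int (sign p) * (\<Prod>i\<in>UNIV. m i (p i) s)) has_real_derivative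
      (\<Sum>p | p permutes UNIV. of_int (sign p) *
        (\<Sum>i\<in>UNIV. m' i (p i) * (\<Prod>l\<in>UNIV - {i}. m l (p l) t)))) (at t)"
    by (intro DERIV_sum DERIV_cmult has_field_derivative_prod assms)
  also have "(\<Sum>p | p permutes UNIV. of_int (sign p) *
        (\<Sum>i\<in>UNIV. m' i (p i) * (\<Prod>l\<in>UNIV - {i}. m l (p l) t))) =
      (\<Sum>i\<in>UNIV. det (\<chi> l j. if l = i then m' i j else m l j t))"
    unfolding det_def sum_distrib_left
    by (subst sum.swap) (simp add: prod)
  finally show ?thesis by (simp add: det_def)
qed

text \<open>Jacobi's formula. As \<open>w\<close> is a left inverse of \<open>m\<close>, the
  differentiated row \<open>m' i\<close> is a combination of the rows of \<open>m\<close> with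
  coefficients from row \<open>i\<close> of \<open>m' w\<close>. Putting it in place of row
  \<open>i\<close> multiplies the determinant by the diagonal coefficient.\<close>

lemma DERIV_det_inverse:
  fixes m w :: "'n::finite \<Rightarrow> 'n \<Rightarrow> real \<Rightarrow> real"
  assumes "\<And>i j. (m i j has_real_derivative m' i j) (at t)"
    and wm: "\<And>i j. (\<Sum>a\<in>UNIV. w i a t * m a j t) = (if i = j then 1 else 0)"
  shows "((\<lambda>s. det (\<chi> i j. m i j s)) has_real_derivative
    det (\<chi> i j. m i j t) * (\<Sum>i\<in>UNIV. \<Sum>a\<in>UNIV. m' i a * w a i t)) (at t)"
proof -
  have "det (\<chi> l j. if l = i then m' i j else m l j t) =
      (\<Sum>a\<in>UNIV. m' i a * w a i t) * det (\<chi> i j. m i j t)" for i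
  proof -
    define A :: "real^'n^'n" where "A = (\<chi> i j. m i j t)"
    define v :: "real^'n" where "v = (\<chi> b. \<Sum>a\<in>UNIV. m' i a * w a b t)"
    have "(\<Sum>b\<in>UNIV. (\<Sum>a\<in>UNIV. m' i a * w a b t) * m b j t) = m' i j" for j
    proof -
      have "(\<Sum>b\<in>UNIV. (\<Sum>a\<in>UNIV. m' i a * w a b t) * m b j t) =
          (\<Sum>a\<in>UNIV. m' i a * (\<Sum>b\<in>UNIV. w a b t * m b j t))"
        unfolding sum_distrib_left sum_distrib_right by (subst sum.swap) (simp add: mult.assoc)
      then show ?thesis by (simp add: wm if_distrib cong: if_cong)
    qed
    then have "(\<Sum>b\<in>UNIV. v $ b *s row b A) = (\<chi> j. m' i j)"
      by (simp add: vec_eq_iff v_def A_def row_def)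
    then have "(\<chi> l. if l = i then \<Sum>b\<in>UNIV. v $ b *s row b A else row l A) =
        (\<chi> l j. if l = i then m' i j else m l j t)"
      by (auto simp: vec_eq_iff A_def row_def)
    with cramer_lemma_transpose[of i v A] show ?thesis
      by (simp add: v_def A_def)
  qed
  with DERIV_det[of m m' t, OF assms(1)] show ?thesis
    by (simp add: sum_distrib_left mult.commute)
qed

lemma has_pders_sqrt_abs_det:
  fixes M W :: "'n::finite \<Rightarrow> 'n \<Rightarrow> real^'n \<Rightarrow> real"
  assumes M: "\<And>i j. has_pders (M i j) (M' i j)" and W: "\<And>i j. continuous_on UNIV (W i j)"
    and WM: "\<And>i j x. (\<Sum>a\<in>UNIV. W i a x * M a j x) = (if i = j then 1 else 0)"
  shows det_nonzero: "det (\<chi> i j. M i j x) \<noteq> 0"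
    and "has_pders (\<lambda>x. sqrt \<bar>det (\<chi> i j. M i j x)\<bar>)
      (\<lambda>k x. sqrt \<bar>det (\<chi> i j. M i j x)\<bar> * ((\<Sum>i\<in>UNIV. \<Sum>a\<in>UNIV. M' i a k x * W a i x) / 2))"
proof -
  define u where "u = (\<lambda>x. det (\<chi> i j. M i j x))"
  define c where "c = (\<lambda>k x. \<Sum>i\<in>UNIV. \<Sum>a\<in>UNIV. M' i a k x * W a i x)"
  have u0: "u x \<noteq> 0" for x
  proof -
    have "(\<chi> i j. W i j x) ** (\<chi> i j. M i j x) = mat 1"
      by (simp add: matrix_matrix_mult_def mat_def vec_eq_iff WM)
    then have "det (\<chi> i j. W i j x) * u x = 1"
      unfolding u_def by (metis det_I det_mul)
    then show ?thesis by auto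
  qed
  then show "det (\<chi> i j. M i j x) \<noteq> 0" by (simp add: u_def)
  have cM: "continuous_on UNIV (M i j)" and cM': "continuous_on UNIV (M' i j k)" for i j k
    using has_pdersD[OF M] by auto
  have cu: "continuous_on UNIV u"
    unfolding u_def det_def by (simp, intro continuous_intros cM)
  have cc: "continuous_on UNIV (c k)" for k
    unfolding c_def by (intro continuous_intros cM' W)
  have du: "((\<lambda>s. u (x + s *\<^sub>R axis k 1)) has_real_derivative u x * c k x) (at 0)" for k x
    using DERIV_det_inverse[of "\<lambda>i j s. M i j (x + s *\<^sub>R axis k 1)" _ 0 "\<lambda>i j s. W i j (x + s *\<^sub>R axis k 1)",
        OF has_pders_deriv[OF M]] WM
    by (simp add: u_def c_def)
  have "has_pders (\<lambda>x. sqrt \<bar>u x\<bar>) (\<lambda>k x. sqrt \<bar>u x\<bar> * (c k x / 2))"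
  proof (rule has_pdersI)
    fix k x
    let ?u = "\<lambda>s. u (x + s *\<^sub>R axis k 1)"
    \<comment> \<open>\<open>sqrt \<bar>u\<bar>\<close> is treated as the fourth root of
      \<open>u^2\<close>, which is differentiable wherever \<open>u\<close> is nonzero, whatever its
      sign.\<close>
    have 1: "((\<lambda>s. (?u s)\<^sup>2) has_real_derivative of_nat 2 * (u x * c k x * (?u 0) ^ (2 - Suc 0))) (at 0)"
      by (rule DERIV_power[OF du])
    have 2: "((\<lambda>s. sqrt ((?u s)\<^sup>2)) has_real_derivative inverse (sqrt ((?u 0)\<^sup>2)) / 2 *
         (of_nat 2 * (u x * c k x * (?u 0) ^ (2 - Suc 0)))) (at 0)"
      by (rule DERIV_chain2[OF DERIV_real_sqrt 1]) (use u0[of x] in auto)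
    have 3: "((\<lambda>s. sqrt (sqrt ((?u s)\<^sup>2))) has_real_derivative
       inverse (sqrt (sqrt ((?u 0)\<^sup>2))) / 2 * (inverse (sqrt ((?u 0)\<^sup>2)) / 2 *
         (of_nat 2 * (u x * c k x * (?u 0) ^ (2 - Suc 0))))) (at 0)"
      by (rule DERIV_chain2[OF DERIV_real_sqrt 2]) (use u0[of x] in auto)
    have "inverse (sqrt (sqrt ((?u 0)\<^sup>2))) / 2 * (inverse (sqrt ((?u 0)\<^sup>2)) / 2 *
         (of_nat 2 * (u x * c k x * (?u 0) ^ (2 - Suc 0)))) = sqrt \<bar>u x\<bar> * (c k x / 2)"
    proof -
      define r where "r = sqrt \<bar>u x\<bar>"
      have r: "r * r = \<bar>u x\<bar>" "r \<noteq> 0" using u0 by (auto simp: r_def)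
      have "u x * u x = r * r * (r * r)" by (simp add: r abs_mult_self_eq)
      then have "inverse r / 2 * (inverse (r * r) / 2 * (2 * (u x * c k x * u x))) = r * (c k x / 2)"
        using r(2) by (simp add: field_simps)
      then show ?thesis unfolding r by (simp add: r_def)
    qed
    from DERIV_cong[OF 3 this]
    show "((\<lambda>s. sqrt \<bar>?u s\<bar>) has_real_derivative sqrt \<bar>u x\<bar> * (c k x / 2)) (at 0)"
      by (simp only: real_sqrt_abs)
  qed (intro continuous_intros cu cc | simp)+
  then show "has_pders (\<lambda>x. sqrt \<bar>det (\<chi> i j. M i j x)\<bar>)
      (\<lambda>k x. sqrt \<bar>det (\<chi> i j. M i j x)\<bar> * ((\<Sum>i\<in>UNIV. \<Sum>a\<in>UNIV. M' i a k x * W a i x) / 2))"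
    by (simp add: u_def c_def)
qed

text \<open>The identity \<open>W y - W x = - W y (M y - M x) W x\<close> is used twice: with the
  locally bounded \<open>B\<close> it makes \<open>W\<close> continuous, and divided by the
  increment it then yields the derivative. In the application \<open>B\<close> comes from
  coercivity.\<close>

lemma has_pders_matrix_inverse:
  fixes M W :: "'n::finite \<Rightarrow> 'n \<Rightarrow> real^'n \<Rightarrow> real"
  assumes M: "\<And>i j. has_pders (M i j) (M' i j)"
    and WM: "\<And>i j x. (\<Sum>a\<in>UNIV. W i a x * M a j x) = (if i = j then 1 else 0)"
    and MW: "\<And>i j x. (\<Sum>a\<in>UNIV. M i a x * W a j x) = (if i = j then 1 else 0)"
    and B: "\<And>i j x. \<bar>W i j x\<bar> \<le> B x" "continuous_on UNIV B"
  shows "has_pders (W i j) (\<lambda>k x. - (\<Sum>a\<in>UNIV. \<Sum>b\<in>UNIV. W i a x * M' a b k x * W b j x))"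
proof -
  have key: "W i j y - W i j x =
      - (\<Sum>a\<in>UNIV. \<Sum>b\<in>UNIV. W i a y * (M a b y - M a b x) * W b j x)" for i j x y
  proof -
    have "(\<Sum>a\<in>UNIV. \<Sum>b\<in>UNIV. W i a y * M a b y * W b j x) =
        (\<Sum>b\<in>UNIV. (\<Sum>a\<in>UNIV. W i a y * M a b y) * W b j x)"
      unfolding sum_distrib_right by (rule sum.swap)
    then have 1: "(\<Sum>a\<in>UNIV. \<Sum>b\<in>UNIV. W i a y * M a b y * W b j x) = W i j x"
      by (simp add: WM if_distrib if_distribR cong: if_cong)
    have "(\<Sum>a\<in>UNIV. \<Sum>b\<in>UNIV. W i a y * M a b x * W b j x) =
        (\<Sum>a\<in>UNIV. W i a y * (\<Sum>b\<in>UNIV. M a b x * W b j x))"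
      unfolding sum_distrib_left by (simp add: mult.assoc)
    then have 2: "(\<Sum>a\<in>UNIV. \<Sum>b\<in>UNIV. W i a y * M a b x * W b j x) = W i j y"
      by (simp add: MW if_distrib if_distribR cong: if_cong)
    show ?thesis using 1 2 by (simp add: algebra_simps sum_subtractf)
  qed
  have cM: "continuous_on UNIV (M i j)" and cM': "continuous_on UNIV (M' i j k)" for i j k
    using has_pdersD[OF M] by auto
  have tW: "(W i j \<longlongrightarrow> W i j x) (at x)" for i j x
  proof -
    have z: "((\<lambda>y. W i a y * (M a b y - M a b x)) \<longlongrightarrow> 0) (at x)" for a b
    proof (rule Lim_null_comparison)
      show "\<forall>\<^sub>F y in at x. norm (W i a y * (M a b y - M a b x)) \<le> B y * \<bar>M a b y - M a b x\<bar>"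
        by (simp add: abs_mult mult_right_mono B(1))
      have "(B \<longlongrightarrow> B x) (at x)" "(M a b \<longlongrightarrow> M a b x) (at x)"
        using B(2) cM by (auto simp: continuous_on_def)
      then have "((\<lambda>y. B y * \<bar>M a b y - M a b x\<bar>) \<longlongrightarrow> B x * \<bar>M a b x - M a b x\<bar>) (at x)"
        by (intro tendsto_intros)
      then show "((\<lambda>y. B y * \<bar>M a b y - M a b x\<bar>) \<longlongrightarrow> 0) (at x)" by simp
    qed
    have "((\<lambda>y. - (\<Sum>a\<in>UNIV. \<Sum>b\<in>UNIV. W i a y * (M a b y - M a b x) * W b j x)) \<longlongrightarrow>
        - (\<Sum>a\<in>(UNIV::'n set). \<Sum>b\<in>(UNIV::'n set). 0 * W b j x)) (at x)"
      by (rule tendsto_minus, rule tendsto_sum, rule tendsto_sum, rule tendsto_mult[OF z tendsto_const])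
    then have "((\<lambda>y. W i j y - W i j x) \<longlongrightarrow> 0) (at x)"
      unfolding key by simp
    then show ?thesis by (simp add: LIM_zero_iff)
  qed
  then have cW: "continuous_on UNIV (W i j)" for i j
    by (simp add: continuous_on_def)
  show ?thesis
  proof (rule has_pdersI)
    fix k x
    define e :: "real^'n" where "e = axis k 1"
    have l: "((\<lambda>s. x + s *\<^sub>R e) \<longlongrightarrow> x) (at 0)" by (auto intro!: tendsto_eq_intros)
    have "((\<lambda>s. W i a (x + s *\<^sub>R e)) \<longlongrightarrow> W i a x) (at 0)" for a
      by (rule continuous_on_tendsto_compose[OF cW l]) auto
    moreover have "((\<lambda>s. (M a b (x + s *\<^sub>R e) - M a b x) / s) \<longlongrightarrow> M' a b k x) (at 0)" for a b
      using has_pders_deriv[OF M[of a b], of x k] unfolding e_def[symmetric] has_field_derivative_iff by simp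
    ultimately have "((\<lambda>s. - (\<Sum>a\<in>UNIV. \<Sum>b\<in>UNIV. W i a (x + s *\<^sub>R e) *
         ((M a b (x + s *\<^sub>R e) - M a b x) / s) * W b j x)) \<longlongrightarrow>
       - (\<Sum>a\<in>UNIV. \<Sum>b\<in>UNIV. W i a x * M' a b k x * W b j x)) (at 0)"
      by (intro tendsto_intros)
    moreover have "- (\<Sum>a\<in>UNIV. \<Sum>b\<in>UNIV. W i a (x + s *\<^sub>R e) *
         ((M a b (x + s *\<^sub>R e) - M a b x) / s) * W b j x) = (W i j (x + s *\<^sub>R e) - W i j x) / s" for s
      unfolding key by (simp add: sum_divide_distrib)
    ultimately show "((\<lambda>s. W i j (x + s *\<^sub>R axis k 1)) has_real_derivative
        - (\<Sum>a\<in>UNIV. \<Sum>b\<in>UNIV. W i a x * M' a b k x * W b j x)) (at 0)"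
      unfolding has_field_derivative_iff e_def by simp
  qed (intro continuous_intros cW cM')+
qed

subsection \<open>The divergence-free bivector\<close>

lemma double_sum_swap:
  "(\<Sum>i\<in>UNIV. \<Sum>a\<in>UNIV. f i a) = (\<Sum>i\<in>UNIV. \<Sum>a\<in>UNIV. f a (i::'n::finite))"
  by (rule sum.swap)

lemma double_sum_skew:
  fixes P S :: "'n::finite \<Rightarrow> 'n \<Rightarrow> real"
  assumes "\<And>i j. P j i = - P i j"
  shows "(\<Sum>i\<in>UNIV. \<Sum>a\<in>UNIV. P i a * S i a) = (\<Sum>i\<in>UNIV. \<Sum>a\<in>UNIV. P i a * (S i a - S a i)) / 2"
proof -
  have "(\<Sum>i\<in>UNIV. \<Sum>a\<in>UNIV. P i a * S i a) = (\<Sum>i\<in>UNIV. \<Sum>a\<in>UNIV. P a i * S a i)"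
    by (rule double_sum_swap)
  also have "\<dots> = - (\<Sum>i\<in>UNIV. \<Sum>a\<in>UNIV. P i a * S a i)"
    unfolding sum_negf[symmetric] by (intro sum.cong refl) (use assms in \<open>metis mult_minus_left\<close>)
  finally show ?thesis by (simp add: algebra_simps sum_subtractf)
qed

text \<open>
  With \<open>\<alpha> = d (ln \<rho>)\<close>, the conclusion says that the bivector \<open>P\<close> is divergence-free with
  respect to the density \<open>\<rho>\<close>.
\<close>

lemma bivector_divergence_free:
  fixes P :: "'n::finite \<Rightarrow> 'n \<Rightarrow> real" and A' :: "'n \<Rightarrow> 'n \<Rightarrow> 'n \<Rightarrow> real"
  assumes skew: "\<And>i j. P j i = - P i j" "\<And>a b k. A' b a k = - A' a b k"
    and closed: "\<And>a b k. A' a b k + A' b k a + A' k a b = 0"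
    and P': "\<And>i j k. P' i j k = - (\<Sum>a\<in>UNIV. \<Sum>b\<in>UNIV. P i a * A' a b k * P b j)
      - (\<Sum>a\<in>UNIV. P i a * \<eta>' a k) * \<xi> j - \<xi> i * (\<Sum>a\<in>UNIV. \<eta>' a k * P a j)"
    and \<xi>: "\<And>a. (\<Sum>i\<in>UNIV. \<xi> i * (\<eta>' a i - \<eta>' i a)) = 0"
    and tr: "(\<Sum>i\<in>UNIV. \<Sum>a\<in>UNIV. P i a * (\<eta>' a i - \<eta>' i a)) = 0"
    and \<alpha>: "\<And>k. \<alpha> k = - (\<Sum>i\<in>UNIV. \<Sum>a\<in>UNIV. P i a * A' i a k) / 2 + (\<Sum>a\<in>UNIV. \<xi> a * \<eta>' a k)"
  shows "(\<Sum>i\<in>UNIV. \<alpha> i * P i j + P' i j i) = 0"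
proof -
  define U where "U = (\<lambda>k. \<Sum>i\<in>UNIV. \<Sum>a\<in>UNIV. P i a * A' i a k)"
  define \<kappa> where "\<kappa> = (\<lambda>k. \<Sum>a\<in>UNIV. \<xi> a * \<eta>' a k)"
  \<comment> \<open>Closedness turns the part of \<open>A' a b i\<close> that is skew in
    \<open>a\<close> and \<open>i\<close> into \<open>- A' i a b\<close>, whence minus one half of
    \<open>U\<close>.\<close>
  have T: "(\<Sum>i\<in>UNIV. \<Sum>a\<in>UNIV. P i a * A' a b i) = - U b / 2" for b
  proof -
    have "A' a b i - A' i b a = - A' i a b" for i a
      using closed[of a b i] skew(2)[of b i a] by linarith
    then show ?thesis
      by (subst double_sum_skew[OF skew(1)]) (simp add: U_def sum_negf)
  qed
  have S2: "(\<Sum>i\<in>UNIV. \<Sum>a\<in>UNIV. P i a * \<eta>' a i) = 0"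
    by (subst double_sum_skew[OF skew(1)]) (simp add: tr)
  have S1: "(\<Sum>i\<in>UNIV. \<Sum>a\<in>UNIV. \<Sum>b\<in>UNIV. P i a * A' a b i * P b j) = - (\<Sum>b\<in>UNIV. U b * P b j) / 2"
  proof -
    have "(\<Sum>i\<in>UNIV. \<Sum>a\<in>UNIV. \<Sum>b\<in>UNIV. P i a * A' a b i * P b j) =
        (\<Sum>i\<in>UNIV. \<Sum>b\<in>UNIV. \<Sum>a\<in>UNIV. P i a * A' a b i * P b j)"
      by (intro sum.cong refl sum.swap)
    also have "\<dots> = (\<Sum>b\<in>UNIV. \<Sum>i\<in>UNIV. \<Sum>a\<in>UNIV. P i a * A' a b i * P b j)"
      by (rule sum.swap)
    also have "\<dots> = (\<Sum>b\<in>UNIV. (- U b / 2) * P b j)"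
      by (simp only: sum_distrib_right[symmetric] T)
    finally show ?thesis by (simp add: sum_negf sum_divide_distrib)
  qed
  have S3: "(\<Sum>i\<in>UNIV. \<xi> i * (\<Sum>a\<in>UNIV. \<eta>' a i * P a j)) = (\<Sum>a\<in>UNIV. \<kappa> a * P a j)"
  proof -
    have k: "(\<Sum>i\<in>UNIV. \<xi> i * \<eta>' a i) = \<kappa> a" for a
      using \<xi>[of a] by (simp add: \<kappa>_def right_diff_distrib sum_subtractf)
    have "(\<Sum>i\<in>UNIV. \<xi> i * (\<Sum>a\<in>UNIV. \<eta>' a i * P a j)) = (\<Sum>a\<in>UNIV. (\<Sum>i\<in>UNIV. \<xi> i * \<eta>' a i) * P a j)"
      unfolding sum_distrib_left sum_distrib_right by (subst sum.swap) (simp add: mult.assoc)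
    then show ?thesis by (simp only: k)
  qed
  \<comment> \<open>This is opposite to the contraction of \<open>\<alpha>\<close> with
    \<open>P\<close>: the half of \<open>U\<close> from closedness meets the half from the square
    root in \<open>\<rho>\<close>, and the two terms with \<open>\<kappa>\<close> agree because
    \<open>d\<eta>\<close> annihilates \<open>\<xi>\<close>.\<close>
  have "(\<Sum>i\<in>UNIV. P' i j i) = (\<Sum>b\<in>UNIV. U b * P b j) / 2 - (\<Sum>a\<in>UNIV. \<kappa> a * P a j)"
    unfolding P' sum_subtractf sum_negf S1 S3 by (simp add: S2 flip: sum_distrib_right)
  moreover have "(\<Sum>i\<in>UNIV. \<alpha> i * P i j) = - (\<Sum>i\<in>UNIV. U i * P i j) / 2 + (\<Sum>i\<in>UNIV. \<kappa> i * P i j)"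
  proof -
    have "\<alpha> i * P i j = - (U i * P i j) / 2 + \<kappa> i * P i j" for i
      by (simp add: \<alpha> U_def \<kappa>_def algebra_simps)
    then show ?thesis by (simp only: sum.distrib sum_negf sum_divide_distrib[symmetric])
  qed
  ultimately show ?thesis
    by (simp add: sum.distrib)
qed

text \<open>Half of Jacobi's trace for \<open>A + \<eta> \<otimes> \<eta>\<close>, whose inverse is
  \<open>P + \<xi> \<otimes> \<xi>\<close>. The mixed terms vanish by skewness or because
  \<open>P\<close> annihilates \<open>\<eta>\<close>; the pairing of \<open>\<xi>\<close> with
  \<open>\<eta>'\<close> occurs twice, which absorbs the factor one half.\<close>

lemma log_det_derivative_split:
  fixes P :: "'n::finite \<Rightarrow> 'n \<Rightarrow> real" and A' :: "'n \<Rightarrow> 'n \<Rightarrow> real"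
  assumes skew: "\<And>i j. P j i = - P i j" "\<And>a b. A' b a = - A' a b"
    and P\<eta>: "\<And>i. (\<Sum>a\<in>UNIV. P i a * \<eta> a) = 0" and \<eta>\<xi>: "(\<Sum>a\<in>UNIV. \<xi> a * \<eta> a) = 1"
  shows "(\<Sum>i\<in>UNIV. \<Sum>a\<in>UNIV. (A' i a + (\<eta>' i * \<eta> a + \<eta> i * \<eta>' a)) * (P a i + \<xi> a * \<xi> i)) / 2
    = - (\<Sum>i\<in>UNIV. \<Sum>a\<in>UNIV. P i a * A' i a) / 2 + (\<Sum>a\<in>UNIV. \<xi> a * \<eta>' a)"
proof -
  have 1: "(\<Sum>i\<in>UNIV. \<Sum>a\<in>UNIV. A' i a * P a i) = - (\<Sum>i\<in>UNIV. \<Sum>a\<in>UNIV. P i a * A' i a)"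
  proof -
    have "A' i a * P a i = - (P i a * A' i a)" for i a
      using skew(1)[of i a] by simp
    then show ?thesis by (simp add: sum_negf)
  qed
  have 2: "(\<Sum>i\<in>UNIV. \<Sum>a\<in>UNIV. A' i a * (\<xi> a * \<xi> i)) = 0"
  proof -
    have "(\<Sum>i\<in>UNIV. \<Sum>a\<in>UNIV. A' i a * (\<xi> a * \<xi> i)) =
        (\<Sum>i\<in>UNIV. \<Sum>a\<in>UNIV. A' i a * (\<xi> a * \<xi> i - \<xi> i * \<xi> a)) / 2"
      by (rule double_sum_skew[OF skew(2)])
    then show ?thesis by (simp add: mult.commute)
  qed
  have 3: "(\<Sum>i\<in>UNIV. \<Sum>a\<in>UNIV. \<eta>' i * \<eta> a * P a i) = 0"
  proof -
    have "(\<Sum>a\<in>UNIV. \<eta>' i * \<eta> a * P a i) = - \<eta>' i * (\<Sum>a\<in>UNIV. P i a * \<eta> a)" for i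
      unfolding sum_distrib_left by (rule sum.cong) (simp_all add: skew(1)[of i])
    then show ?thesis by (simp add: P\<eta>)
  qed
  have 4: "(\<Sum>i\<in>UNIV. \<Sum>a\<in>UNIV. \<eta> i * \<eta>' a * P a i) = 0"
  proof -
    have "(\<Sum>i\<in>UNIV. \<Sum>a\<in>UNIV. \<eta> i * \<eta>' a * P a i) = (\<Sum>a\<in>UNIV. \<eta>' a * (\<Sum>i\<in>UNIV. P a i * \<eta> i))"
      unfolding sum_distrib_left by (subst sum.swap) (simp add: ac_simps)
    then show ?thesis by (simp add: P\<eta>)
  qed
  have 5: "(\<Sum>i\<in>UNIV. \<Sum>a\<in>UNIV. \<eta>' i * \<eta> a * (\<xi> a * \<xi> i)) = (\<Sum>a\<in>UNIV. \<xi> a * \<eta>' a)"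
  proof -
    have "(\<Sum>a\<in>UNIV. \<eta>' i * \<eta> a * (\<xi> a * \<xi> i)) = \<eta>' i * \<xi> i * (\<Sum>a\<in>UNIV. \<xi> a * \<eta> a)" for i
      unfolding sum_distrib_left by (simp add: ac_simps)
    then have "(\<Sum>i\<in>UNIV. \<Sum>a\<in>UNIV. \<eta>' i * \<eta> a * (\<xi> a * \<xi> i)) = (\<Sum>i\<in>UNIV. \<eta>' i * \<xi> i)"
      by (simp only: \<eta>\<xi> mult_1_right)
    then show ?thesis by (simp add: mult.commute)
  qed
  have 6: "(\<Sum>i\<in>UNIV. \<Sum>a\<in>UNIV. \<eta> i * \<eta>' a * (\<xi> a * \<xi> i)) = (\<Sum>a\<in>UNIV. \<xi> a * \<eta>' a)"
    using 5 by (subst double_sum_swap) (simp add: ac_simps)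
  have "(\<Sum>i\<in>UNIV. \<Sum>a\<in>UNIV. (A' i a + (\<eta>' i * \<eta> a + \<eta> i * \<eta>' a)) * (P a i + \<xi> a * \<xi> i)) =
     (\<Sum>i\<in>UNIV. \<Sum>a\<in>UNIV. A' i a * P a i) + (\<Sum>i\<in>UNIV. \<Sum>a\<in>UNIV. A' i a * (\<xi> a * \<xi> i)) +
     ((\<Sum>i\<in>UNIV. \<Sum>a\<in>UNIV. \<eta>' i * \<eta> a * P a i) + (\<Sum>i\<in>UNIV. \<Sum>a\<in>UNIV. \<eta> i * \<eta>' a * P a i)) +
     ((\<Sum>i\<in>UNIV. \<Sum>a\<in>UNIV. \<eta>' i * \<eta> a * (\<xi> a * \<xi> i)) + (\<Sum>i\<in>UNIV. \<Sum>a\<in>UNIV. \<eta> i * \<eta>' a * (\<xi> a * \<xi> i)))"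
    unfolding sum.distrib[symmetric] by (intro sum.cong refl) (simp add: algebra_simps)
  also have "\<dots> = - (\<Sum>i\<in>UNIV. \<Sum>a\<in>UNIV. P i a * A' i a) + 2 * (\<Sum>a\<in>UNIV. \<xi> a * \<eta>' a)"
    unfolding 1 2 3 4 5 6 by simp
  finally show ?thesis by simp
qed

lemma matrix_mult_minus_left: "(- A) ** B = - (A ** (B :: real^'n^'n))"
  by (simp add: matrix_matrix_mult_def vec_eq_iff sum_negf)

lemma matrix_mult_minus_right: "A ** (- B) = - (A ** (B :: real^'n^'n))"
  by (simp add: matrix_matrix_mult_def vec_eq_iff sum_negf)

lemma matrix_mult_diff_left: "(A - C) ** B = A ** B - C ** (B :: real^'n^'n)"
  by (simp add: matrix_matrix_mult_def vec_eq_iff sum_subtractf algebra_simps)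

lemma matrix_mult_diff_right: "A ** (B - C) = A ** B - A ** (C :: real^'n^'n)"
  by (simp add: matrix_matrix_mult_def vec_eq_iff sum_subtractf algebra_simps)

text \<open>
  The inverse bivector \<open>P\<close> of an \<open>F\<close>-invariant two-form \<open>A\<close> is again \<open>F\<close>-invariant, so its
  trace against an \<open>F\<close>-anti-invariant two-form \<open>Q\<close> vanishes.
\<close>

lemma trace_anti_invariant:
  fixes A P F Q E :: "real^'n^'n"
  assumes AP: "A ** P = mat 1 - E" and PA: "P ** A = mat 1 - transpose E"
    and EP: "transpose E ** P = 0" and FE: "transpose F ** E = 0" and EF: "transpose E ** F = 0"
    and FF: "F ** F = transpose E - mat 1" and AF: "transpose F ** A = - (A ** F)"
    and Q: "transpose F ** Q ** F = - Q"
  shows "trace (P ** Q) = 0"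
proof -
  define X where "X = F ** P ** transpose F"
  \<comment> \<open>Invariance \<open>X = P\<close> comes from computing \<open>X A P\<close> in two
    ways: moving \<open>F\<close> past \<open>A\<close> gives \<open>P\<close>, while
    \<open>A P = 1 - E\<close> gives \<open>X\<close>, as \<open>transpose F\<close> annihilates
    \<open>E\<close>.\<close>
  have "X ** (A ** P) = F ** P ** (transpose F ** A) ** P"
    by (simp add: X_def matrix_mul_assoc)
  also have "\<dots> = - (F ** (P ** A) ** F ** P)"
    by (simp add: AF matrix_mult_minus_left matrix_mult_minus_right matrix_mul_assoc)
  also have "F ** (P ** A) ** F ** P = F ** F ** P - F ** (transpose E ** F) ** P"
    by (simp add: PA matrix_mult_diff_left matrix_mult_diff_right matrix_mul_assoc)
  also have "\<dots> = - P"
    by (simp add: EF FF EP matrix_mult_diff_left)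
  finally have "X ** (A ** P) = P" by simp
  moreover have "X ** (A ** P) = X - F ** P ** (transpose F ** E)"
    by (simp add: X_def AP matrix_mult_diff_right matrix_mul_assoc)
  ultimately have X: "X = P" by (simp add: FE)
  \<comment> \<open>Cyclicity of the trace moves the conjugation by \<open>F\<close> from
    \<open>Q\<close>, which changes sign, to \<open>P\<close>, which does not; the trace is its own
    negative.\<close>
  have "trace (P ** Q) = - trace (P ** (transpose F ** Q ** F))"
    by (simp add: Q matrix_mult_minus_right trace_def sum_negf)
  also have "P ** (transpose F ** Q ** F) = (P ** transpose F ** Q) ** F"
    by (simp add: matrix_mul_assoc)
  also have "trace \<dots> = trace (X ** Q)"
    by (simp add: trace_mul_sym[of _ F] X_def matrix_mul_assoc)
  finally show ?thesis by (simp add: X)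
qed

lemma sum_delta_mult [simp]:
  fixes f :: "'n::finite \<Rightarrow> real"
  shows "(\<Sum>b\<in>UNIV. (if a = b then 1 else 0) * f b) = f a"
    "(\<Sum>b\<in>UNIV. f b * (if b = a then 1 else 0)) = f a"
    "(\<Sum>b\<in>UNIV. (if b = a then 1 else 0) * f b) = f a"
    "(\<Sum>b\<in>UNIV. f b * (if a = b then 1 else 0)) = f a"
  by (simp_all add: if_distrib if_distribR cong: if_cong)

lemma abs_det_le:
  fixes M :: "real^'n^'n"
  assumes "\<And>i j. \<bar>M $ i $ j\<bar> \<le> D"
  shows "\<bar>det M\<bar> \<le> real (card {p :: 'n \<Rightarrow> 'n. p permutes UNIV}) * D ^ CARD('n)"
proof -
  have "\<bar>det M\<bar> \<le> (\<Sum>p | p permutes (UNIV :: 'n set). D ^ CARD('n))"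
    unfolding det_def
  proof (rule sum_norm_le[where 'a=real, unfolded real_norm_def])
    fix p :: "'n \<Rightarrow> 'n"
    have "(\<Prod>i\<in>UNIV. \<bar>M $ i $ p i\<bar>) \<le> (\<Prod>i\<in>(UNIV::'n set). D)"
      by (intro prod_mono) (simp add: assms)
    then show "\<bar>of_int (sign p) * (\<Prod>i\<in>UNIV. M $ i $ p i)\<bar> \<le> D ^ CARD('n)"
      by (simp add: abs_mult abs_prod sign_def)
  qed
  then show ?thesis by simp
qed

text \<open>\<open>A\<close> is degenerate along \<open>\<xi>\<close>, so
  \<open>A + \<eta> \<otimes> \<eta>\<close> is inverted instead. This matrix and its transpose both
  send \<open>\<xi>\<close> to \<open>\<eta>\<close>; hence \<open>W\<close> sends
  \<open>\<eta>\<close> back to \<open>\<xi>\<close>, and subtracting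
  \<open>\<xi> \<otimes> \<xi>\<close> leaves an inverse of \<open>A\<close> transverse to
  \<open>\<xi>\<close>.\<close>

lemma inverse_bivector:
  fixes A W P :: "'n::finite \<Rightarrow> 'n \<Rightarrow> real"
  assumes skew: "\<And>i j. A j i = - A i j"
    and A\<xi>: "\<And>i. (\<Sum>j\<in>UNIV. A i j * \<xi> j) = 0" and \<eta>\<xi>: "(\<Sum>i\<in>UNIV. \<eta> i * \<xi> i) = 1"
    and WM: "\<And>i j. (\<Sum>a\<in>UNIV. W i a * (A a j + \<eta> a * \<eta> j)) = (if i = j then 1 else 0)"
    and MW: "\<And>i j. (\<Sum>a\<in>UNIV. (A i a + \<eta> i * \<eta> a) * W a j) = (if i = j then 1 else 0)"
    and P: "\<And>i j. P i j = W i j - \<xi> i * \<xi> j"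
  shows "\<xi> i = (\<Sum>a\<in>UNIV. W i a * \<eta> a)"
    and "(\<Sum>a\<in>UNIV. P i a * \<eta> a) = 0" "(\<Sum>a\<in>UNIV. \<eta> a * P a i) = 0"
    and "(\<Sum>a\<in>UNIV. A i a * P a j) = (if i = j then 1 else 0) - \<eta> i * \<xi> j"
    and "(\<Sum>a\<in>UNIV. P i a * A a j) = (if i = j then 1 else 0) - \<xi> i * \<eta> j"
    and "P j i = - P i j"
proof -
  have M\<xi>: "(\<Sum>j\<in>UNIV. (A a j + \<eta> a * \<eta> j) * \<xi> j) = \<eta> a" for a
  proof -
    have "(\<Sum>j\<in>UNIV. (A a j + \<eta> a * \<eta> j) * \<xi> j) = (\<Sum>j\<in>UNIV. A a j * \<xi> j) + \<eta> a * (\<Sum>j\<in>UNIV. \<eta> j * \<xi> j)"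
      by (simp add: sum_distrib_left sum.distrib algebra_simps)
    then show ?thesis by (simp add: A\<xi> \<eta>\<xi>)
  qed
  have \<xi>M: "(\<Sum>j\<in>UNIV. \<xi> j * (A j a + \<eta> j * \<eta> a)) = \<eta> a" for a
  proof -
    have "(\<Sum>j\<in>UNIV. \<xi> j * (A j a + \<eta> j * \<eta> a)) = - (\<Sum>j\<in>UNIV. A a j * \<xi> j) + \<eta> a * (\<Sum>j\<in>UNIV. \<eta> j * \<xi> j)"
      unfolding sum_distrib_left sum_negf[symmetric] sum.distrib[symmetric]
      by (rule sum.cong) (simp_all add: skew[of a] algebra_simps)
    then show ?thesis by (simp add: A\<xi> \<eta>\<xi>)
  qed
  show W\<eta>: "\<xi> i = (\<Sum>a\<in>UNIV. W i a * \<eta> a)" for i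
  proof -
    have "(\<Sum>a\<in>UNIV. W i a * \<eta> a) = (\<Sum>a\<in>UNIV. W i a * (\<Sum>j\<in>UNIV. (A a j + \<eta> a * \<eta> j) * \<xi> j))"
      by (simp only: M\<xi>)
    also have "\<dots> = (\<Sum>j\<in>UNIV. (\<Sum>a\<in>UNIV. W i a * (A a j + \<eta> a * \<eta> j)) * \<xi> j)"
      unfolding sum_distrib_left sum_distrib_right by (subst sum.swap) (simp only: mult.assoc)
    finally show ?thesis by (simp add: WM)
  qed
  have \<eta>W: "\<xi> j = (\<Sum>a\<in>UNIV. \<eta> a * W a j)" for j
  proof -
    have "(\<Sum>a\<in>UNIV. \<eta> a * W a j) = (\<Sum>a\<in>UNIV. (\<Sum>i\<in>UNIV. \<xi> i * (A i a + \<eta> i * \<eta> a)) * W a j)"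
      by (simp only: \<xi>M)
    also have "\<dots> = (\<Sum>i\<in>UNIV. \<xi> i * (\<Sum>a\<in>UNIV. (A i a + \<eta> i * \<eta> a) * W a j))"
      unfolding sum_distrib_left sum_distrib_right by (subst sum.swap) (simp only: mult.assoc)
    finally show ?thesis by (simp add: MW)
  qed
  show P\<eta>: "(\<Sum>a\<in>UNIV. P i a * \<eta> a) = 0" for i
  proof -
    have "(\<Sum>a\<in>UNIV. P i a * \<eta> a) = (\<Sum>a\<in>UNIV. W i a * \<eta> a) - \<xi> i * (\<Sum>a\<in>UNIV. \<eta> a * \<xi> a)"
      by (simp add: P sum_distrib_left sum_subtractf algebra_simps)
    then show ?thesis by (simp add: \<eta>\<xi> flip: W\<eta>)
  qed
  show \<eta>P: "(\<Sum>a\<in>UNIV. \<eta> a * P a i) = 0" for i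
  proof -
    have "(\<Sum>a\<in>UNIV. \<eta> a * P a i) = (\<Sum>a\<in>UNIV. \<eta> a * W a i) - (\<Sum>a\<in>UNIV. \<eta> a * \<xi> a) * \<xi> i"
      unfolding sum_distrib_right sum_subtractf[symmetric]
      by (rule sum.cong) (simp_all add: P algebra_simps)
    then show ?thesis by (simp add: \<eta>\<xi> flip: \<eta>W)
  qed
  show AP: "(\<Sum>a\<in>UNIV. A i a * P a j) = (if i = j then 1 else 0) - \<eta> i * \<xi> j" for i j
  proof -
    have "(\<Sum>a\<in>UNIV. A i a * P a j) = (\<Sum>a\<in>UNIV. (A i a + \<eta> i * \<eta> a) * W a j)
        - \<eta> i * (\<Sum>a\<in>UNIV. \<eta> a * W a j) - (\<Sum>a\<in>UNIV. A i a * \<xi> a) * \<xi> j"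
      unfolding sum_distrib_left sum_distrib_right sum_subtractf[symmetric]
      by (rule sum.cong) (simp_all add: P algebra_simps)
    then show ?thesis by (simp add: MW A\<xi> flip: \<eta>W)
  qed
  show skewP: "P j i = - P i j" for i j
  proof -
    \<comment> \<open>In matrix form \<open>P^T A P = P^T\<close>; the left-hand side is skew
      because \<open>A\<close> is.\<close>
    have e: "(\<Sum>a\<in>UNIV. P a i * (\<Sum>b\<in>UNIV. A a b * P b j)) = P j i" for i j
    proof -
      have "(\<Sum>a\<in>UNIV. P a i * (\<Sum>b\<in>UNIV. A a b * P b j)) =
          (\<Sum>a\<in>UNIV. P a i * (if a = j then 1 else 0)) - (\<Sum>a\<in>UNIV. \<eta> a * P a i) * \<xi> j"
        unfolding AP sum_distrib_right sum_subtractf[symmetric]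
        by (rule sum.cong) (simp_all add: algebra_simps)
      then show ?thesis by (simp add: \<eta>P)
    qed
    have "P j i = (\<Sum>a\<in>UNIV. \<Sum>b\<in>UNIV. P a i * A a b * P b j)"
      unfolding e[of i j, symmetric] by (simp add: sum_distrib_left mult.assoc)
    also have "\<dots> = (\<Sum>a\<in>UNIV. \<Sum>b\<in>UNIV. P b i * A b a * P a j)"
      by (rule sum.swap)
    also have "\<dots> = - (\<Sum>a\<in>UNIV. \<Sum>b\<in>UNIV. P a j * A a b * P b i)"
      unfolding sum_negf[symmetric] by (intro sum.cong refl) (metis skew mult.commute mult_minus_left mult_minus_right mult.left_commute)
    also have "(\<Sum>a\<in>UNIV. \<Sum>b\<in>UNIV. P a j * A a b * P b i) = P i j"
      unfolding e[of j i, symmetric] by (simp add: sum_distrib_left mult.assoc)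
    finally show ?thesis .
  qed
  show "(\<Sum>a\<in>UNIV. P i a * A a j) = (if i = j then 1 else 0) - \<xi> i * \<eta> j"
  proof -
    have "P i a * A a j = A j a * P a i" for a
      using skewP[of i a] skew[of a j] by simp
    then show ?thesis by (simp add: AP)
  qed
qed

text \<open>\<open>P\<close> is singular, so the relation
  \<open>A P = 1 - \<eta> \<otimes> \<xi>\<close> is differentiated and multiplied by
  \<open>P\<close> from the left. This determines \<open>P'\<close> up to its contraction with
  \<open>\<eta>\<close>, which the derivative of \<open>\<eta> P = 0\<close> supplies;
  \<open>\<xi>'\<close> drops out because \<open>P\<close> annihilates
  \<open>\<eta>\<close>.\<close>

lemma inverse_bivector_derivative:
  fixes A P :: "'n::finite \<Rightarrow> 'n \<Rightarrow> real"
  assumes PA: "\<And>i j. (\<Sum>a\<in>UNIV. P i a * A a j) = (if i = j then 1 else 0) - \<xi> i * \<eta> j"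
    and P\<eta>: "\<And>i. (\<Sum>a\<in>UNIV. P i a * \<eta> a) = 0"
    and AP': "\<And>a j. (\<Sum>b\<in>UNIV. A' a b * P b j + A a b * P' b j) = - (\<eta>' a * \<xi> j + \<eta> a * \<xi>' j)"
    and \<eta>P': "\<And>j. (\<Sum>b\<in>UNIV. \<eta>' b * P b j + \<eta> b * P' b j) = (0::real)"
  shows "P' i j = - (\<Sum>a\<in>UNIV. \<Sum>b\<in>UNIV. P i a * A' a b * P b j)
      - (\<Sum>a\<in>UNIV. P i a * \<eta>' a) * \<xi> j - \<xi> i * (\<Sum>a\<in>UNIV. \<eta>' a * P a j)"
proof -
  have "(\<Sum>a\<in>UNIV. P i a * (\<Sum>b\<in>UNIV. A' a b * P b j + A a b * P' b j)) =
      (\<Sum>a\<in>UNIV. \<Sum>b\<in>UNIV. P i a * A' a b * P b j) + (\<Sum>b\<in>UNIV. (\<Sum>a\<in>UNIV. P i a * A a b) * P' b j)"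
    unfolding sum.distrib sum_distrib_left sum_distrib_right distrib_left
    by (subst (3) sum.swap) (simp add: mult.assoc)
  also have "(\<Sum>b\<in>UNIV. (\<Sum>a\<in>UNIV. P i a * A a b) * P' b j) = P' i j - \<xi> i * (\<Sum>b\<in>UNIV. \<eta> b * P' b j)"
    unfolding PA left_diff_distrib sum_subtractf by (simp add: sum_distrib_left mult.assoc)
  also have "(\<Sum>b\<in>UNIV. \<eta> b * P' b j) = - (\<Sum>b\<in>UNIV. \<eta>' b * P b j)"
    using \<eta>P'[of j] by (simp add: sum.distrib)
  finally have "(\<Sum>a\<in>UNIV. P i a * - (\<eta>' a * \<xi> j + \<eta> a * \<xi>' j)) =
      (\<Sum>a\<in>UNIV. \<Sum>b\<in>UNIV. P i a * A' a b * P b j) + P' i j + \<xi> i * (\<Sum>b\<in>UNIV. \<eta>' b * P b j)"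
    unfolding AP' by simp
  moreover have "(\<Sum>a\<in>UNIV. P i a * - (\<eta>' a * \<xi> j + \<eta> a * \<xi>' j)) =
      - (\<Sum>a\<in>UNIV. P i a * \<eta>' a) * \<xi> j - (\<Sum>a\<in>UNIV. P i a * \<eta> a) * \<xi>' j"
    unfolding minus_mult_left[symmetric] sum_distrib_right sum_negf[symmetric] sum_subtractf[symmetric]
    by (rule sum.cong) (simp_all add: algebra_simps)
  ultimately show ?thesis by (simp add: P\<eta>)
qed

subsection \<open>The Poincare lemma for two-forms\<close>

lemma chain_partial_derivatives:
  fixes f :: "real^'n \<Rightarrow> real"
  assumes "\<And>x. (f has_derivative (\<lambda>v. \<Sum>k\<in>UNIV. v $ k * f' k x)) (at x)"
    and "(\<gamma> has_vector_derivative \<gamma>') (at t)"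
  shows "((\<lambda>s. f (\<gamma> s)) has_real_derivative (\<Sum>k\<in>UNIV. \<gamma>' $ k * f' k (\<gamma> t))) (at t)"
proof -
  have "((\<lambda>s. f (\<gamma> s)) has_derivative (\<lambda>s. \<Sum>k\<in>UNIV. (s *\<^sub>R \<gamma>') $ k * f' k (\<gamma> t))) (at t)"
    using diff_chain_at[OF assms(2)[unfolded has_vector_derivative_def] assms(1)]
    by (simp only: o_def)
  moreover have "(\<lambda>s. \<Sum>k\<in>UNIV. (s *\<^sub>R \<gamma>') $ k * f' k (\<gamma> t)) = (*) (\<Sum>k\<in>UNIV. \<gamma>' $ k * f' k (\<gamma> t))"
    unfolding sum_distrib_right by (intro ext sum.cong) auto
  ultimately show ?thesis by (simp add: has_field_derivative_def)
qed

text \<open>An antiderivative is \<open>t^2 r / (2 (1 + t^2 r^2))\<close>. The integrand combines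
  the weight \<open>t\<close> of the radial homotopy, the length \<open>r\<close> of the contracted
  vector and the decay of the two-form along the ray.\<close>

lemma integral_ray_kernel:
  fixes r :: real
  shows "((\<lambda>t. t * (r / (1 + (t * r)\<^sup>2)\<^sup>2)) has_integral r / (2 * (1 + r\<^sup>2))) {0..1}"
proof -
  have "((\<lambda>t. t * (r / (1 + (t * r)\<^sup>2)\<^sup>2)) has_integral
      1\<^sup>2 * r / (2 * (1 + (1 * r)\<^sup>2)) - 0\<^sup>2 * r / (2 * (1 + (0 * r)\<^sup>2))) {0..1}"
  proof (rule fundamental_theorem_of_calculus)
    fix t :: real
    have ne: "1 + (t * r)\<^sup>2 \<noteq> 0" using zero_le_power2[of "t * r"] by linarith
    have "((\<lambda>t. t\<^sup>2 * r / (2 * (1 + (t * r)\<^sup>2))) has_real_derivative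
        (2 * t * r * (2 * (1 + (t * r)\<^sup>2)) - t\<^sup>2 * r * (2 * (2 * (t * r) * r))) / (2 * (1 + (t * r)\<^sup>2))\<^sup>2)
        (at t within {0..1})"
      using ne by (auto intro!: derivative_eq_intros simp: power2_eq_square)
    moreover have "(2 * t * r * (2 * (1 + (t * r)\<^sup>2)) - t\<^sup>2 * r * (2 * (2 * (t * r) * r))) / (2 * (1 + (t * r)\<^sup>2))\<^sup>2
        = t * (r / (1 + (t * r)\<^sup>2)\<^sup>2)"
      using ne by (simp add: divide_simps) (simp add: power2_eq_square algebra_simps)
    ultimately show "((\<lambda>t. t\<^sup>2 * r / (2 * (1 + (t * r)\<^sup>2))) has_vector_derivative
        t * (r / (1 + (t * r)\<^sup>2)\<^sup>2)) (at t within {0..1})"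
      by (simp add: has_real_derivative_iff_has_vector_derivative)
  qed simp
  then show ?thesis by simp
qed

text \<open>The weight \<open>t\<close> is the one for degree two: closedness makes the exterior
  derivative of the integrand the \<open>t\<close>-derivative of \<open>t^2 A (t x)\<close>, whose
  increment over \<open>[0, 1]\<close> is \<open>A x\<close>. Fourth-order decay of \<open>A\<close>
  along the ray leaves first-order decay of \<open>\<beta>\<close>.\<close>

lemma poincare_two_form:
  fixes A :: "'n::finite \<Rightarrow> 'n \<Rightarrow> real^'n \<Rightarrow> real"
  assumes A: "\<And>i j x. (A i j has_derivative (\<lambda>v. \<Sum>k\<in>UNIV. v $ k * A' i j k x)) (at x)"
    and cA': "\<And>i j k. continuous_on UNIV (A' i j k)"
    and skew: "\<And>i j x. A j i x = - A i j x"
    and closed: "\<And>i j k x. A' i j k x + A' j k i x + A' k i j x = 0"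
    and decay: "\<And>i j x. \<bar>A i j x\<bar> \<le> C / (1 + (norm x)\<^sup>2)\<^sup>2"
  obtains \<beta> \<beta>' where "\<And>j. has_pders (\<beta> j) (\<beta>' j)"
    and "\<And>j k x. \<beta>' j k x - \<beta>' k j x = A k j x"
    and "\<And>j x. \<bar>\<beta> j x\<bar> \<le> real CARD('n) * C * norm x / (1 + (norm x)\<^sup>2)"
proof
  define \<beta> where "\<beta> = (\<lambda>j x. integral {0..1} (\<lambda>t. t * (\<Sum>i\<in>UNIV. x $ i * A i j (t *\<^sub>R x))))"
  define b where "b = (\<lambda>j k x t. t * (\<Sum>i\<in>UNIV. axis k 1 $ i * A i j (t *\<^sub>R x) + x $ i * (t * A' i j k (t *\<^sub>R x))))"
  define \<beta>' where "\<beta>' = (\<lambda>j k x. integral {0..1} (b j k x))"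
  have pA: "has_pders (A i j) (A' i j)" for i j
    by (rule has_pders_has_derivative[OF A cA'])
  have skew': "A' j i k x = - A' i j k x" for i j k x
  proof -
    have "has_pders (A j i) (\<lambda>k x. - A' i j k x)"
      by (rule has_pders_cong[OF has_pders_minus[OF pA[of i j]]]) (simp_all add: skew[of i j])
    from has_pders_unique[OF pA this] show ?thesis .
  qed
  have cA: "continuous_on UNIV (A i j)" for i j
    using has_pdersD(1)[OF pA] .
  note [continuous_intros] = continuous_on_compose2[OF cA] continuous_on_compose2[OF cA']
  have cb: "continuous_on UNIV (\<lambda>(x, t). b j k x t)" for j k
    unfolding b_def split_def by (intro continuous_intros) auto
  have ib: "b j k x integrable_on {0..1}" for j k x
    unfolding b_def by (intro integrable_continuous_real continuous_intros) auto
  show "has_pders (\<beta> j) (\<beta>' j)" for j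
  proof (rule has_pdersI)
    show "continuous_on UNIV (\<beta> j)"
    proof -
      have "continuous_on UNIV (\<lambda>x. integral (cbox 0 1) (\<lambda>t. t * (\<Sum>i\<in>UNIV. x $ i * A i j (t *\<^sub>R x))))"
        by (rule integral_continuous_on_param) (auto simp: split_def intro!: continuous_intros)
      then show ?thesis by (simp add: \<beta>_def)
    qed
    show "continuous_on UNIV (\<beta>' j k)" for k
    proof -
      have "continuous_on UNIV (\<lambda>x. integral (cbox 0 1) (b j k x))"
        by (rule integral_continuous_on_param) (use cb continuous_on_subset in blast)
      then show ?thesis by (simp add: \<beta>'_def)
    qed
    fix k and x :: "real^'n"
    have "((\<lambda>s. integral (cbox 0 1) (\<lambda>t. t * (\<Sum>i\<in>UNIV. (x + s *\<^sub>R axis k 1) $ i * A i j (t *\<^sub>R (x + s *\<^sub>R axis k 1)))))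
        has_real_derivative integral (cbox 0 1) (b j k (x + 0 *\<^sub>R axis k 1))) (at 0 within UNIV)"
    proof (rule leibniz_rule_field_derivative)
      fix s t :: real
      let ?y = "x + s *\<^sub>R axis k 1"
      have v: "((\<lambda>s. t *\<^sub>R (x + s *\<^sub>R axis k 1)) has_vector_derivative t *\<^sub>R axis k 1) (at s)"
        by (auto intro!: derivative_eq_intros simp: has_vector_derivative_def)
      have s: "(\<Sum>l\<in>UNIV. (t *\<^sub>R axis k 1 :: real^'n) $ l * A' i j l (t *\<^sub>R ?y)) = t * A' i j k (t *\<^sub>R ?y)" for i
        by (simp add: axis_def if_distrib if_distribR cong: if_cong)
      have dA: "((\<lambda>s. A i j (t *\<^sub>R (x + s *\<^sub>R axis k 1))) has_real_derivative t * A' i j k (t *\<^sub>R ?y)) (at s)" for i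
        using chain_partial_derivatives[OF A v, of i j] unfolding s .
      have dx: "((\<lambda>s. (x + s *\<^sub>R axis k 1) $ i) has_real_derivative axis k 1 $ i) (at s)" for i
        by (auto intro!: derivative_eq_intros)
      have "((\<lambda>s. \<Sum>i\<in>UNIV. (x + s *\<^sub>R axis k 1) $ i * A i j (t *\<^sub>R (x + s *\<^sub>R axis k 1)))
          has_real_derivative (\<Sum>i\<in>UNIV. axis k 1 $ i * A i j (t *\<^sub>R ?y) + t * A' i j k (t *\<^sub>R ?y) * ?y $ i)) (at s)"
        by (intro DERIV_sum DERIV_mult dA dx)
      from DERIV_cmult[OF this, of t]
      show "((\<lambda>s. t * (\<Sum>i\<in>UNIV. (x + s *\<^sub>R axis k 1) $ i * A i j (t *\<^sub>R (x + s *\<^sub>R axis k 1))))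
          has_real_derivative b j k ?y t) (at s within UNIV)"
        unfolding b_def by (simp add: mult.commute mult.left_commute)
    next
      show "(\<lambda>t. t * (\<Sum>i\<in>UNIV. (x + s *\<^sub>R axis k 1) $ i * A i j (t *\<^sub>R (x + s *\<^sub>R axis k 1)))) integrable_on cbox 0 1" for s
        by (intro integrable_continuous continuous_intros) auto
      show "continuous_on (UNIV \<times> cbox 0 1) (\<lambda>(s, t). b j k (x + s *\<^sub>R axis k 1) t)"
        unfolding b_def split_def by (intro continuous_intros) auto
    qed auto
    then show "((\<lambda>s. \<beta> j (x + s *\<^sub>R axis k 1)) has_real_derivative \<beta>' j k x) (at 0)"
      by (simp add: \<beta>_def \<beta>'_def)
  qed
  show "\<beta>' j k x - \<beta>' k j x = A k j x" for j k x
  proof -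
    have "((\<lambda>t. b j k x t - b k j x t) has_integral 1\<^sup>2 * A k j (1 *\<^sub>R x) - 0\<^sup>2 * A k j (0 *\<^sub>R x)) {0..1}"
    proof (rule fundamental_theorem_of_calculus)
      fix t :: real
      have v: "((\<lambda>t. t *\<^sub>R x) has_vector_derivative x) (at t)"
        by (auto intro!: derivative_eq_intros simp: has_vector_derivative_def)
      have "((\<lambda>t. t\<^sup>2 * A k j (t *\<^sub>R x)) has_real_derivative
          2 * t * A k j (t *\<^sub>R x) + (\<Sum>i\<in>UNIV. x $ i * A' k j i (t *\<^sub>R x)) * t\<^sup>2) (at t)"
        by (rule DERIV_mult[OF _ chain_partial_derivatives[OF A v]])
          (auto intro!: derivative_eq_intros)
      also have "2 * t * A k j (t *\<^sub>R x) + (\<Sum>i\<in>UNIV. x $ i * A' k j i (t *\<^sub>R x)) * t\<^sup>2 = b j k x t - b k j x t"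
      proof -
        have ax: "(\<Sum>i\<in>UNIV. axis k 1 $ i * f i) = f k" for k and f :: "'n \<Rightarrow> real"
          by (simp add: axis_def if_distrib if_distribR cong: if_cong)
        have c: "x $ i * (t * A' i j k (t *\<^sub>R x)) - x $ i * (t * A' i k j (t *\<^sub>R x)) = t * (x $ i * A' k j i (t *\<^sub>R x))" for i
        proof -
          have "A' i j k (t *\<^sub>R x) - A' i k j (t *\<^sub>R x) = A' k j i (t *\<^sub>R x)"
            using closed[of i j k "t *\<^sub>R x"] skew'[of i k j "t *\<^sub>R x"] skew'[of j k i "t *\<^sub>R x"] by linarith
          then show ?thesis by (simp flip: right_diff_distrib)
        qed
        have "b j k x t - b k j x t = t * (A k j (t *\<^sub>R x) - A j k (t *\<^sub>R x) +
            (\<Sum>i\<in>UNIV. x $ i * (t * A' i j k (t *\<^sub>R x)) - x $ i * (t * A' i k j (t *\<^sub>R x))))"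
          unfolding b_def sum.distrib ax by (simp add: sum_subtractf algebra_simps)
        also have "\<dots> = t * (2 * A k j (t *\<^sub>R x) + t * (\<Sum>i\<in>UNIV. x $ i * A' k j i (t *\<^sub>R x)))"
          unfolding c using skew[of j k] by (simp add: sum_distrib_left)
        finally show ?thesis by (simp add: power2_eq_square algebra_simps)
      qed
      finally show "((\<lambda>t. t\<^sup>2 * A k j (t *\<^sub>R x)) has_vector_derivative b j k x t - b k j x t) (at t within {0..1})"
        by (simp add: has_real_derivative_iff_has_vector_derivative has_vector_derivative_at_within)
    qed simp
    then show ?thesis
      unfolding \<beta>'_def integral_diff[OF ib ib, symmetric] by (simp add: integral_unique)
  qed
  show "\<bar>\<beta> j x\<bar> \<le> real CARD('n) * C * norm x / (1 + (norm x)\<^sup>2)" for j x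
  proof -
    let ?n = "real CARD('n)"
    define r where "r = norm x"
    have C: "0 \<le> C"
      using decay[of j j 0] by simp
    have bd: "norm (t * (\<Sum>i\<in>UNIV. x $ i * A i j (t *\<^sub>R x))) \<le> ?n * C * (t * (r / (1 + (t * r)\<^sup>2)\<^sup>2))"
      if "t \<in> {0..1}" for t
    proof -
      have "\<bar>x $ i * A i j (t *\<^sub>R x)\<bar> \<le> r * (C / (1 + (t * r)\<^sup>2)\<^sup>2)" for i
        unfolding abs_mult
        using decay[of i j "t *\<^sub>R x"] component_le_norm_cart[of x i] that
        by (intro mult_mono) (auto simp: r_def)
      then have "\<bar>\<Sum>i\<in>UNIV. x $ i * A i j (t *\<^sub>R x)\<bar> \<le> (\<Sum>i\<in>(UNIV::'n set). r * (C / (1 + (t * r)\<^sup>2)\<^sup>2))"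
        by (intro sum_norm_le[where 'a=real, unfolded real_norm_def]) auto
      also have "\<dots> = ?n * (r * (C / (1 + (t * r)\<^sup>2)\<^sup>2))" by simp
      finally have "t * \<bar>\<Sum>i\<in>UNIV. x $ i * A i j (t *\<^sub>R x)\<bar> \<le> t * (?n * (r * (C / (1 + (t * r)\<^sup>2)\<^sup>2)))"
        using that by (intro mult_left_mono) auto
      then show ?thesis using that by (simp add: abs_mult algebra_simps)
    qed
    have "norm (\<beta> j x) \<le> integral {0..1} (\<lambda>t. ?n * C * (t * (r / (1 + (t * r)\<^sup>2)\<^sup>2)))"
      unfolding \<beta>_def
    proof (rule integral_norm_bound_integral)
      show "(\<lambda>t. t * (\<Sum>i\<in>UNIV. x $ i * A i j (t *\<^sub>R x))) integrable_on {0..1}"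
        by (intro integrable_continuous_real continuous_intros) auto
      show "(\<lambda>t. ?n * C * (t * (r / (1 + (t * r)\<^sup>2)\<^sup>2))) integrable_on {0..1}"
        using integral_ray_kernel[of r] by (intro integrable_on_mult_right) (auto simp: integrable_on_def)
    qed (rule bd)
    also have "\<dots> = ?n * C * (r / (2 * (1 + r\<^sup>2)))"
      by (rule integral_unique[OF has_integral_mult_right[OF integral_ray_kernel]])
    also have "\<dots> \<le> ?n * C * (r / (1 + r\<^sup>2))"
      using C by (intro mult_left_mono divide_left_mono) (auto simp: r_def add_pos_nonneg)
    finally show ?thesis by (simp add: r_def)
  qed
qed

subsection \<open>The flux argument\<close>

text \<open>The minimum of \<open>f\<close> over the cube with \<open>R = 1\<close> gives a bound
  that survives in all larger cubes. It keeps the mass of \<open>\<rho>\<close> away from zero while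
  the flux tends to zero.\<close>

lemma integral_cube_positive:
  fixes f :: "real^'n \<Rightarrow> real"
  assumes "continuous_on UNIV f" "\<And>x. 0 < f x"
  obtains c where "0 < c" "\<And>R. 1 \<le> R \<Longrightarrow> c \<le> integral (cbox (\<chi> i. - R) (\<chi> i. R)) f"
proof -
  let ?Q = "\<lambda>R. cbox (\<chi> i. - R) ((\<chi> i. R) :: real^'n)"
  have int: "f integrable_on ?Q R" for R
    using assms(1) continuous_on_subset by (blast intro: integrable_continuous)
  have ne: "?Q 1 \<noteq> {}" by (auto simp: interval_eq_empty_cart)
  obtain z where z: "\<And>x. x \<in> ?Q 1 \<Longrightarrow> f z \<le> f x"
    using continuous_attains_inf[OF compact_cbox ne] assms(1) continuous_on_subset by blast
  have m: "measure lborel (?Q 1) = (\<Prod>i\<in>(UNIV::'n set). 2)"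
    using content_cbox_cart[OF ne] by simp
  have pos: "0 < f z * measure lborel (?Q 1)"
    unfolding m by (simp add: assms(2))
  have "f z * measure lborel (?Q 1) \<le> integral (?Q R) f" if R: "1 \<le> R" for R
  proof -
  have "f z * measure lborel (?Q 1) = integral (?Q 1) (\<lambda>x. f z)" by simp
  also have "\<dots> \<le> integral (?Q 1) f"
    by (rule integral_le) (use int z in auto)
  also have "\<dots> \<le> integral (?Q R) f"
  proof (rule integral_subset_le)
    show "?Q 1 \<subseteq> ?Q R"
    proof
      fix x :: "real^'n" assume "x \<in> ?Q 1"
      then have "- 1 \<le> x $ i" "x $ i \<le> 1" for i by (auto simp: mem_box_cart)
      then have "- R \<le> x $ i" "x $ i \<le> R" for i using R by (smt (verit))+
      then show "x \<in> ?Q R" by (simp add: mem_box_cart)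
    qed
  qed (use int assms(2) in \<open>auto simp: less_imp_le\<close>)
  finally show ?thesis .
  qed
  with pos show thesis by (rule that)
qed

lemma no_decaying_expanding_field:
  fixes G :: "'n::finite \<Rightarrow> real^'n \<Rightarrow> real"
  assumes card: "3 \<le> CARD('n)"
    and G: "\<And>i. has_pders (G i) (G' i)"
    and div: "\<And>x. (\<Sum>i\<in>UNIV. G' i i x) = - c * \<rho> x" and c: "0 < c"
    and \<rho>: "continuous_on UNIV \<rho>" "\<And>x. 0 < \<rho> x"
    and bound: "\<And>i x. \<bar>G i x\<bar> \<le> K * norm x / (1 + (norm x)\<^sup>2) ^ (CARD('n) - 1)"
  shows False
proof -
  obtain q where q: "CARD('n) = q + 3" using card by (metis le_iff_add add.commute)
  let ?Q = "\<lambda>R. cbox (\<chi> i. - R) ((\<chi> i. R) :: real^'n)"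
  obtain d where d: "0 < d" "\<And>R. 1 \<le> R \<Longrightarrow> d \<le> integral (?Q R) \<rho>"
    using integral_cube_positive[OF \<rho>] by blast
  have K: "0 \<le> K"
  proof -
    have "0 \<le> \<bar>G i (axis i 1)\<bar>" for i by simp
    from order_trans[OF this bound] have "0 \<le> K / 2 ^ (CARD('n) - 1)" by simp
    then have "0 \<le> K / 2 ^ (CARD('n) - 1) * 2 ^ (CARD('n) - 1)"
      by (intro mult_nonneg_nonneg) auto
    then show ?thesis by simp
  qed
  \<comment> \<open>In dimension \<open>q + 3\<close> the field is at most
    \<open>K (2 / R)^(2q + 3)\<close> beyond distance \<open>R / 2\<close>, and a face has area
    \<open>(2 R)^(q + 2)\<close>. This leaves \<open>R^(q + 1)\<close> in the denominator, of which
    a single factor \<open>R\<close> is kept.\<close>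
  have face: "\<bar>integral (?Q R) (G' i i)\<bar> \<le> 2 * K * 2 ^ (3 * q + 5) / R" if R: "2 \<le> R" for R i
  proof -
    have "\<bar>G i x\<bar> \<le> K * (2 / R) ^ (2 * q + 3)" if x: "R / 2 \<le> norm x" for x
    proof -
      define r where "r = norm x"
      have r: "1 \<le> r" "R / 2 \<le> r" using x R by (auto simp: r_def)
      have "r / (1 + r\<^sup>2) ^ (q + 2) \<le> r / (r\<^sup>2) ^ (q + 2)"
        using r by (intro divide_left_mono power_mono mult_pos_pos zero_less_power add_pos_pos) auto
      also have "\<dots> = (1 / r) ^ (2 * q + 3)"
      proof -
        have "(r\<^sup>2) ^ (q + 2) = r * r ^ (2 * q + 3)"
          by (simp flip: power_mult power_Suc add: numeral_eq_Suc algebra_simps)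
        then show ?thesis using r by (simp add: power_divide)
      qed
      also have "\<dots> \<le> (2 / R) ^ (2 * q + 3)"
        using r R by (intro power_mono) (auto simp: field_simps)
      finally have "K * (r / (1 + r\<^sup>2) ^ (q + 2)) \<le> K * (2 / R) ^ (2 * q + 3)"
        using K by (rule mult_left_mono)
      then show ?thesis using bound[of i x] by (simp add: q r_def)
    qed
    then have "\<bar>integral (?Q R) (G' i i)\<bar> \<le> 2 * (K * (2 / R) ^ (2 * q + 3)) * (2 * R) ^ (CARD('n) - 1)"
      by (intro integral_pder_cube_bound[OF G]) (use R in auto)
    then have "\<bar>integral (?Q R) (G' i i)\<bar> \<le> 2 * (K * (2 / R) ^ (2 * q + 3)) * (2 * R) ^ (q + 2)"
      by (simp add: q)
    also have "\<dots> = 2 * K * 2 ^ (3 * q + 5) / R ^ (q + 1)"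
    proof -
      have e: "2 * q + 3 = (q + 2) + (q + 1)" "3 * q + 5 = (2 * q + 3) + (q + 2)" by simp_all
      have "R ^ (2 * q + 3) = R ^ (q + 2) * R ^ (q + 1)"
        unfolding e(1) by (rule power_add)
      moreover have "(2::real) ^ (3 * q + 5) = 2 ^ (2 * q + 3) * 2 ^ (q + 2)"
        unfolding e(2) by (rule power_add)
      ultimately show ?thesis using R
        by (simp only: power_divide power_mult_distrib) (simp add: field_simps)
    qed
    also have "\<dots> \<le> 2 * K * 2 ^ (3 * q + 5) / R"
      using R K self_le_power[of R "q + 1"] by (intro divide_left_mono) auto
    finally show ?thesis .
  qed
  define L where "L = real CARD('n) * (2 * K * 2 ^ (3 * q + 5))"
  have main: "c * d \<le> L / R" if R: "2 \<le> R" for R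
  proof -
    have int: "G' i i integrable_on ?Q R" for i
      using has_pders_continuous'[OF G] continuous_on_subset by (blast intro: integrable_continuous)
    have "c * d \<le> c * integral (?Q R) \<rho>"
      using d(2)[of R] R c by simp
    also have "\<dots> = - integral (?Q R) (\<lambda>x. \<Sum>i\<in>UNIV. G' i i x)"
      unfolding div by simp
    also have "integral (?Q R) (\<lambda>x. \<Sum>i\<in>UNIV. G' i i x) = (\<Sum>i\<in>UNIV. integral (?Q R) (G' i i))"
      by (rule integral_sum) (use int in auto)
    also have "- \<dots> \<le> \<bar>\<Sum>i\<in>UNIV. integral (?Q R) (G' i i)\<bar>" by simp
    also have "\<dots> \<le> (\<Sum>i\<in>(UNIV::'n set). 2 * K * 2 ^ (3 * q + 5) / R)"
      by (rule sum_norm_le[where 'a=real, unfolded real_norm_def]) (rule face[OF R])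
    finally show ?thesis by (simp add: L_def)
  qed
  \<comment> \<open>Large enough that \<open>R * c * d\<close> exceeds \<open>L\<close>, against
    \<open>main\<close>.\<close>
  define R where "R = max 2 (L / (c * d) + 1)"
  have cd: "0 < c * d" using c d by simp
  have "L / (c * d) < R" by (simp add: R_def)
  then have "L < R * (c * d)" using cd by (simp add: divide_less_eq)
  moreover have "c * d * R \<le> L" using main[of R] by (simp add: R_def le_divide_eq)
  ultimately show False by (simp add: mult.commute)
qed

text \<open>
  Here \<open>A' i j k\<close> and \<open>\<eta>' i k\<close> are the derivatives in direction \<open>k\<close>, so that \<open>\<eta>' j i - \<eta>' i j\<close> is the
  component \<open>(i, j)\<close> of \<open>d\<eta>\<close>; \<open>F\<close> is the matrix of \<open>\<phi>\<close>, with \<open>A\<close> that of \<open>\<Phi>\<close>.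
\<close>

lemma no_decaying_structure:
  fixes A :: "'n::finite \<Rightarrow> 'n \<Rightarrow> real^'n \<Rightarrow> real" and \<eta> \<xi> :: "'n \<Rightarrow> real^'n \<Rightarrow> real"
  assumes card: "3 \<le> CARD('n)"
    and A: "\<And>i j x. (A i j has_derivative (\<lambda>v. \<Sum>k\<in>UNIV. v $ k * A' i j k x)) (at x)"
    and cA': "\<And>i j k. continuous_on UNIV (A' i j k)"
    and \<eta>: "\<And>i x. (\<eta> i has_derivative (\<lambda>v. \<Sum>k\<in>UNIV. v $ k * \<eta>' i k x)) (at x)"
    and c\<eta>': "\<And>i k. continuous_on UNIV (\<eta>' i k)"
    and skew: "\<And>i j x. A j i x = - A i j x"
    and closed: "\<And>i j k x. A' i j k x + A' j k i x + A' k i j x = 0"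
    and A\<xi>: "\<And>i x. (\<Sum>j\<in>UNIV. A i j x * \<xi> j x) = 0"
    and \<eta>\<xi>: "\<And>x. (\<Sum>i\<in>UNIV. \<eta> i x * \<xi> i x) = 1"
    and d\<eta>\<xi>: "\<And>a x. (\<Sum>i\<in>UNIV. \<xi> i x * (\<eta>' a i x - \<eta>' i a x)) = 0"
    and FF: "\<And>i k x. (\<Sum>j\<in>UNIV. F i j x * F j k x) = \<xi> i x * \<eta> k x - (if i = k then 1 else 0)"
    and \<eta>F: "\<And>j x. (\<Sum>i\<in>UNIV. \<eta> i x * F i j x) = 0"
    and AF: "\<And>i k x. (\<Sum>j\<in>UNIV. F j i x * A j k x) = - (\<Sum>j\<in>UNIV. A i j x * F j k x)"
    and d\<eta>F: "\<And>i j x. (\<Sum>b\<in>UNIV. (\<Sum>a\<in>UNIV. F a i x * (\<eta>' a b x - \<eta>' b a x)) * F b j x) =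
      - (\<eta>' i j x - \<eta>' j i x)"
    and decay: "\<And>i j x. \<bar>A i j x\<bar> \<le> C / (1 + (norm x)\<^sup>2)\<^sup>2" "\<And>i x. \<bar>\<eta> i x\<bar> \<le> C / (1 + (norm x)\<^sup>2)"
    and coercive: "\<And>w x. norm w \<le> C * (1 + (norm x)\<^sup>2)\<^sup>2 *
      norm ((\<chi> i. \<Sum>j\<in>UNIV. (A i j x + \<eta> i x * \<eta> j x) * w $ j) :: real^'n)"
  shows False
proof -
  define M where "M = (\<lambda>i j x. A i j x + \<eta> i x * \<eta> j x)"
  define M' where "M' = (\<lambda>i j k x. A' i j k x + (\<eta>' i k x * \<eta> j x + \<eta> i x * \<eta>' j k x))"
  define Mx :: "real^'n \<Rightarrow> real^'n^'n" where "Mx = (\<lambda>x. \<chi> i j. M i j x)"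
  define W where "W = (\<lambda>i j x. matrix_inv (Mx x) $ i $ j)"
  define P where "P = (\<lambda>i j x. W i j x - \<xi> i x * \<xi> j x)"
  define s :: "real^'n \<Rightarrow> real" where "s = (\<lambda>x. 1 + (norm x)\<^sup>2)"
  have s: "1 \<le> s x" for x by (simp add: s_def)
  have C0: "0 \<le> C" using order_trans[OF abs_ge_zero decay(2)[of undefined 0]] by simp
  have pA: "has_pders (A i j) (A' i j)" for i j by (rule has_pders_has_derivative[OF A cA'])
  have p\<eta>: "has_pders (\<eta> i) (\<eta>' i)" for i by (rule has_pders_has_derivative[OF \<eta> c\<eta>'])
  have pM: "has_pders (M i j) (M' i j)" for i j
    unfolding M_def M'_def by (intro has_pders_add has_pders_mult pA p\<eta>)
  have skew': "A' j i k x = - A' i j k x" for i j k x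
  proof -
    have "has_pders (A j i) (\<lambda>k x. - A' i j k x)"
      by (rule has_pders_cong[OF has_pders_minus[OF pA[of i j]]]) (simp_all add: skew[of i j])
    from has_pders_unique[OF pA this] show ?thesis .
  qed
  have Mxv: "Mx x *v w = (\<chi> i. \<Sum>j\<in>UNIV. (A i j x + \<eta> i x * \<eta> j x) * w $ j)" for x w
    by (simp add: Mx_def M_def matrix_vector_mult_def)
  have inv: "invertible (Mx x)" for x
    unfolding invertible_left_inverse matrix_left_invertible_ker
    using coercive[of _ x] unfolding Mxv[symmetric] by (metis mult_zero_right norm_le_zero_iff norm_zero)
  have "matrix_inv (Mx x) ** Mx x = mat 1 \<and> Mx x ** matrix_inv (Mx x) = mat 1" for x
    using inv[of x] unfolding invertible_def matrix_inv_def by (metis (mono_tags, lifting) someI_ex)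
  then have WM: "(\<Sum>a\<in>UNIV. W i a x * M a j x) = (if i = j then 1 else 0)"
    and MW: "(\<Sum>a\<in>UNIV. M i a x * W a j x) = (if i = j then 1 else 0)" for i j x
    by (simp_all add: vec_eq_iff matrix_matrix_mult_def mat_def W_def Mx_def)
  \<comment> \<open>Column \<open>j\<close> of \<open>W\<close> is the solution \<open>w\<close> of
    \<open>Mx x *v w = axis j 1\<close>, so coercivity bounds its norm.\<close>
  have W_bound: "\<bar>W i j x\<bar> \<le> C * (s x)\<^sup>2" for i j x
  proof -
    define w :: "real^'n" where "w = (\<chi> a. W a j x)"
    have "Mx x *v w = axis j 1"
      unfolding Mxv by (simp add: w_def vec_eq_iff axis_def MW[unfolded M_def])
    then have "norm w \<le> C * (s x)\<^sup>2"
      using coercive[of w x] by (simp add: Mxv s_def)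
    then show ?thesis using component_le_norm_cart[of w i] by (simp add: w_def)
  qed
  note biv = inverse_bivector[of "\<lambda>i j. A i j x" "\<lambda>i. \<xi> i x" "\<lambda>i. \<eta> i x" "\<lambda>i j. W i j x" "\<lambda>i j. P i j x" for x,
      OF skew A\<xi> \<eta>\<xi> WM[unfolded M_def] MW[unfolded M_def] P_def[THEN fun_cong, THEN fun_cong, THEN fun_cong]]
  define W' where "W' = (\<lambda>i j k x. - (\<Sum>a\<in>UNIV. \<Sum>b\<in>UNIV. W i a x * M' a b k x * W b j x))"
  have pW: "has_pders (W i j) (W' i j)" for i j
    unfolding W'_def
    by (rule has_pders_matrix_inverse[OF pM WM MW W_bound]) (auto simp: s_def intro!: continuous_intros)
  \<comment> \<open>The components of \<open>\<xi>\<close> are given without derivatives; they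
    inherit them from \<open>\<xi> = W \<eta>\<close>.\<close>
  define \<xi>' where "\<xi>' = (\<lambda>i k x. \<Sum>a\<in>UNIV. W' i a k x * \<eta> a x + W i a x * \<eta>' a k x)"
  have p\<xi>: "has_pders (\<xi> i) (\<xi>' i)" for i
    unfolding \<xi>'_def
    by (rule has_pders_cong[OF has_pders_sum[OF has_pders_mult[OF pW p\<eta>]]]) (simp_all add: biv(1)[of i])
  define P' where "P' = (\<lambda>i j k x. W' i j k x - (\<xi>' i k x * \<xi> j x + \<xi> i x * \<xi>' j k x))"
  have pP: "has_pders (P i j) (P' i j)" for i j
    unfolding P_def P'_def by (intro has_pders_diff has_pders_mult pW p\<xi>)
  have P'_eq: "P' i j k x = - (\<Sum>a\<in>UNIV. \<Sum>b\<in>UNIV. P i a x * A' a b k x * P b j x)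
      - (\<Sum>a\<in>UNIV. P i a x * \<eta>' a k x) * \<xi> j x - \<xi> i x * (\<Sum>a\<in>UNIV. \<eta>' a k x * P a j x)" for i j k x
  proof (rule inverse_bivector_derivative[where A = "\<lambda>i j. A i j x" and \<eta> = "\<lambda>i. \<eta> i x" and \<xi>' = "\<lambda>j. \<xi>' j k x"])
    fix a j
    have "has_pders (\<lambda>x. (if a = j then 1 else 0) - \<eta> a x * \<xi> j x)
        (\<lambda>k x. 0 - (\<eta>' a k x * \<xi> j x + \<eta> a x * \<xi>' j k x))"
      by (intro has_pders_diff has_pders_const has_pders_mult p\<eta> p\<xi>)
    then have "has_pders (\<lambda>x. \<Sum>b\<in>UNIV. A a b x * P b j x)
        (\<lambda>k x. 0 - (\<eta>' a k x * \<xi> j x + \<eta> a x * \<xi>' j k x))"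
      by (simp only: biv(4))
    from has_pders_unique[OF has_pders_sum[OF has_pders_mult[OF pA pP]] this]
    show "(\<Sum>b\<in>UNIV. A' a b k x * P b j x + A a b x * P' b j k x) = - (\<eta>' a k x * \<xi> j x + \<eta> a x * \<xi>' j k x)"
      by simp
  next
    fix j
    have "has_pders (\<lambda>x. \<Sum>b\<in>UNIV. \<eta> b x * P b j x) (\<lambda>k x. 0)"
      unfolding biv(3) by (rule has_pders_const)
    from has_pders_unique[OF has_pders_sum[OF has_pders_mult[OF p\<eta> pP]] this]
    show "(\<Sum>b\<in>UNIV. \<eta>' b k x * P b j x + \<eta> b x * P' b j k x) = 0" .
  qed (rule biv(5) biv(2))+
  define \<rho> where "\<rho> = (\<lambda>x. sqrt \<bar>det (Mx x)\<bar>)"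
  define \<alpha> where "\<alpha> = (\<lambda>k x. (\<Sum>i\<in>UNIV. \<Sum>a\<in>UNIV. M' i a k x * W a i x) / 2)"
  have cW: "continuous_on UNIV (W i j)" for i j using has_pders_continuous[OF pW] .
  have \<rho>_pos: "0 < \<rho> x" for x
    using det_nonzero[OF pM cW WM, of x] by (simp add: \<rho>_def Mx_def)
  have p\<rho>: "has_pders \<rho> (\<lambda>k x. \<rho> x * \<alpha> k x)"
    using has_pders_sqrt_abs_det(2)[OF pM cW WM] by (simp add: \<rho>_def Mx_def \<alpha>_def)
  have trP: "(\<Sum>i\<in>UNIV. \<Sum>a\<in>UNIV. P i a x * (\<eta>' a i x - \<eta>' i a x)) = 0" for x
  proof -
    have z: "(\<Sum>k\<in>UNIV. \<eta> k x * (\<xi> i x * P k j x)) = 0" "(\<Sum>k\<in>UNIV. F k i x * (\<eta> k x * \<xi> j x)) = 0"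
      "(\<Sum>k\<in>UNIV. \<eta> k x * (\<xi> i x * F k j x)) = 0" for i j
    proof -
      have l: "(\<Sum>k\<in>UNIV. a k * (c * b k)) = c * (\<Sum>k\<in>UNIV. a k * b k)"
        "(\<Sum>k\<in>UNIV. b k * (a k * c)) = c * (\<Sum>k\<in>UNIV. a k * b k)" for a b :: "'n \<Rightarrow> real" and c
        unfolding sum_distrib_left by (auto intro!: sum.cong)
      show "(\<Sum>k\<in>UNIV. \<eta> k x * (\<xi> i x * P k j x)) = 0" "(\<Sum>k\<in>UNIV. F k i x * (\<eta> k x * \<xi> j x)) = 0"
        "(\<Sum>k\<in>UNIV. \<eta> k x * (\<xi> i x * F k j x)) = 0"
        unfolding l by (simp_all add: \<eta>F biv(3))
    qed
    \<comment> \<open>\<open>E\<close> is \<open>\<eta> \<otimes> \<xi>\<close>, the defect in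
      \<open>A P = 1 - E\<close>. The sums in \<open>z\<close> are its products with
      \<open>P\<close> and \<open>F\<close>, which vanish because \<open>\<eta>\<close> annihilates
      the columns of both.\<close>
    have "trace ((\<chi> i j. P i j x) ** (\<chi> i j. \<eta>' i j x - \<eta>' j i x)) = 0"
      by (rule trace_anti_invariant[where A = "\<chi> i j. A i j x" and F = "\<chi> i j. F i j x" and E = "\<chi> i j. \<eta> i x * \<xi> j x"])
        (simp_all add: vec_eq_iff matrix_matrix_mult_def transpose_def mat_def biv(4) biv(5) FF AF d\<eta>F mult.assoc z)
    then show ?thesis by (simp add: trace_def matrix_matrix_mult_def)
  qed
  have \<alpha>_eq: "\<alpha> k x = - (\<Sum>i\<in>UNIV. \<Sum>a\<in>UNIV. P i a x * A' i a k x) / 2 + (\<Sum>a\<in>UNIV. \<xi> a x * \<eta>' a k x)" for k x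
  proof -
    have W: "W i a x = P i a x + \<xi> i x * \<xi> a x" for i a by (simp add: P_def)
    show ?thesis unfolding \<alpha>_def M'_def W
      by (rule log_det_derivative_split[OF biv(6) skew' biv(2)]) (simp add: \<eta>\<xi> mult.commute)
  qed
  have divP: "(\<Sum>i\<in>UNIV. \<alpha> i x * P i j x + P' i j i x) = 0" for j x
    by (rule bivector_divergence_free[OF biv(6) skew' closed P'_eq d\<eta>\<xi> trP \<alpha>_eq])
  obtain \<beta> \<beta>' where p\<beta>: "\<And>j. has_pders (\<beta> j) (\<beta>' j)"
    and d\<beta>: "\<And>j k x. \<beta>' j k x - \<beta>' k j x = A k j x"
    and \<beta>_bound: "\<And>j x. \<bar>\<beta> j x\<bar> \<le> real CARD('n) * C * norm x / (1 + (norm x)\<^sup>2)"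
    using poincare_two_form[OF A cA' skew closed decay(1)] by blast
  define G where "G = (\<lambda>i x. \<Sum>j\<in>UNIV. \<rho> x * P i j x * \<beta> j x)"
  define G' where "G' = (\<lambda>i k x. \<Sum>j\<in>UNIV. (\<rho> x * \<alpha> k x * P i j x + \<rho> x * P' i j k x) * \<beta> j x + \<rho> x * P i j x * \<beta>' j k x)"
  have pG: "has_pders (G i) (G' i)" for i
    unfolding G_def G'_def by (intro has_pders_sum has_pders_mult p\<rho> pP p\<beta>)
  \<comment> \<open>Differentiating \<open>\<rho> P\<close> contributes nothing by
    \<open>divP\<close>. What is left is, up to sign, half the contraction of \<open>P\<close> with
    \<open>d\<beta>\<close>, that is half the trace of
    \<open>P A = 1 - \<xi> \<otimes> \<eta>\<close>, which is \<open>CARD('n) - 1\<close>.\<close>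
  have div: "(\<Sum>i\<in>UNIV. G' i i x) = - ((real CARD('n) - 1) / 2) * \<rho> x" for x
  proof -
    have "(\<Sum>i\<in>UNIV. G' i i x) = (\<Sum>i\<in>UNIV. \<Sum>j\<in>UNIV. \<rho> x * ((\<alpha> i x * P i j x + P' i j i x) * \<beta> j x)) +
        (\<Sum>i\<in>UNIV. \<Sum>j\<in>UNIV. \<rho> x * (P i j x * \<beta>' j i x))"
      unfolding sum.distrib[symmetric] by (simp add: G'_def algebra_simps)
    also have "(\<Sum>i\<in>UNIV. \<Sum>j\<in>UNIV. \<rho> x * ((\<alpha> i x * P i j x + P' i j i x) * \<beta> j x)) =
        \<rho> x * (\<Sum>j\<in>UNIV. (\<Sum>i\<in>UNIV. \<alpha> i x * P i j x + P' i j i x) * \<beta> j x)"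
      unfolding sum_distrib_right sum_distrib_left by (rule sum.swap)
    also have "(\<Sum>i\<in>UNIV. \<Sum>j\<in>UNIV. \<rho> x * (P i j x * \<beta>' j i x)) =
        \<rho> x * (\<Sum>i\<in>UNIV. \<Sum>j\<in>UNIV. P i j x * \<beta>' j i x)"
      by (simp only: sum_distrib_left)
    also have "(\<Sum>i\<in>UNIV. \<Sum>j\<in>UNIV. P i j x * \<beta>' j i x) = (\<Sum>i\<in>UNIV. \<Sum>j\<in>UNIV. P i j x * (\<beta>' j i x - \<beta>' i j x)) / 2"
      by (rule double_sum_skew) (rule biv(6))
    also have "(\<Sum>i\<in>UNIV. \<Sum>j\<in>UNIV. P i j x * (\<beta>' j i x - \<beta>' i j x)) = - (\<Sum>i\<in>UNIV. \<Sum>j\<in>UNIV. P i j x * A j i x)"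
    proof -
      have "P i j x * A i j x = - (P i j x * A j i x)" for i j
        using skew[of i j x] by simp
      then show ?thesis unfolding d\<beta> by (simp only: sum_negf)
    qed
    also have "(\<Sum>i\<in>UNIV. \<Sum>j\<in>UNIV. P i j x * A j i x) = real CARD('n) - 1"
      unfolding biv(5) using \<eta>\<xi>[of x] by (simp add: sum_subtractf mult.commute)
    finally have "(\<Sum>i\<in>UNIV. G' i i x) = \<rho> x * (- (real CARD('n) - 1) / 2)"
      unfolding divP by simp
    then show ?thesis by (simp add: field_simps)
  qed
  let ?n = "real CARD('n)"
  define N where "N = real (card {p :: 'n \<Rightarrow> 'n. p permutes UNIV})"
  define D where "D = C + C * C"
  define E where "E = sqrt (N * D ^ CARD('n))"
  define K where "K = C + (?n * C\<^sup>2)\<^sup>2"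
  have nonneg: "0 \<le> D" "0 \<le> E" "0 \<le> K" using C0 by (auto simp: D_def E_def K_def N_def)
  \<comment> \<open>The entries of \<open>M\<close> decay like \<open>s^(-2)\<close>, so the
    determinant decays like \<open>s^(-2m)\<close> in dimension \<open>m\<close>, and its square
    root like \<open>s^(-m)\<close>.\<close>
  have \<rho>_bound: "\<rho> x \<le> E / s x ^ CARD('n)" for x
  proof -
    have "\<bar>M i j x\<bar> \<le> D / (s x)\<^sup>2" for i j
    proof -
      have "\<bar>M i j x\<bar> \<le> \<bar>A i j x\<bar> + \<bar>\<eta> i x\<bar> * \<bar>\<eta> j x\<bar>"
        unfolding M_def by (metis abs_mult abs_triangle_ineq)
      also have "\<dots> \<le> C / (s x)\<^sup>2 + (C / s x) * (C / s x)"
        by (intro add_mono mult_mono) (use decay C0 s in \<open>auto simp: s_def\<close>)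
      finally show ?thesis by (simp add: D_def power2_eq_square add_divide_distrib)
    qed
    then have "\<bar>det (Mx x)\<bar> \<le> N * (D / (s x)\<^sup>2) ^ CARD('n)"
      unfolding N_def by (intro abs_det_le) (simp add: Mx_def)
    also have "\<dots> = N * D ^ CARD('n) / (s x ^ CARD('n))\<^sup>2"
      by (simp add: power_divide mult.commute flip: power_mult)
    finally have "\<rho> x \<le> sqrt (N * D ^ CARD('n) / (s x ^ CARD('n))\<^sup>2)"
      unfolding \<rho>_def by (rule real_sqrt_le_mono)
    then show ?thesis using s[of x] by (simp add: E_def real_sqrt_divide)
  qed
  have \<xi>_bound: "\<bar>\<xi> i x\<bar> \<le> ?n * C\<^sup>2 * s x" for i x
  proof -
    have "\<bar>W i a x * \<eta> a x\<bar> \<le> C\<^sup>2 * s x" for a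
    proof -
      have "\<bar>W i a x\<bar> * \<bar>\<eta> a x\<bar> \<le> (C * (s x)\<^sup>2) * (C / s x)"
        by (intro mult_mono) (use W_bound decay(2) C0 s in \<open>auto simp: s_def\<close>)
      then show ?thesis using s[of x] by (simp add: abs_mult power2_eq_square mult_ac)
    qed
    then have "\<bar>\<Sum>a\<in>UNIV. W i a x * \<eta> a x\<bar> \<le> (\<Sum>a\<in>(UNIV::'n set). C\<^sup>2 * s x)"
      by (intro sum_norm_le[where 'a=real, unfolded real_norm_def])
    then show ?thesis by (simp flip: biv(1))
  qed
  have P_bound: "\<bar>P i j x\<bar> \<le> K * (s x)\<^sup>2" for i j x
  proof -
    have "\<bar>P i j x\<bar> \<le> \<bar>W i j x\<bar> + \<bar>\<xi> i x\<bar> * \<bar>\<xi> j x\<bar>"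
      unfolding P_def by (metis abs_mult abs_triangle_ineq4)
    also have "\<dots> \<le> C * (s x)\<^sup>2 + (?n * C\<^sup>2 * s x) * (?n * C\<^sup>2 * s x)"
      by (intro add_mono mult_mono W_bound \<xi>_bound) (use C0 s[of x] in auto)
    finally show ?thesis by (simp add: K_def power2_eq_square algebra_simps)
  qed
  \<comment> \<open>The powers of \<open>s\<close> are \<open>- m\<close> from
    \<open>\<rho>\<close>, \<open>2\<close> from \<open>P\<close> and \<open>- 1\<close> from
    \<open>\<beta>\<close>, in total \<open>1 - m\<close>; the factor \<open>norm x\<close> comes
    from \<open>\<beta>\<close>.\<close>
  have G_bound: "\<bar>G i x\<bar> \<le> (?n * (E * K * (?n * C))) * norm x / (1 + (norm x)\<^sup>2) ^ (CARD('n) - 1)" for i x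
  proof -
    have "\<bar>\<rho> x * P i j x * \<beta> j x\<bar> \<le> E * K * (?n * C) * norm x / s x ^ (CARD('n) - 1)" for j
    proof -
      have "\<rho> x * \<bar>P i j x\<bar> * \<bar>\<beta> j x\<bar> \<le> (E / s x ^ CARD('n)) * (K * (s x)\<^sup>2) * (?n * C * norm x / s x)"
        by (intro mult_mono \<rho>_bound P_bound)
          (use \<beta>_bound nonneg C0 s[of x] \<rho>_pos[of x] in \<open>auto simp: s_def\<close>)
      also have "\<dots> = E * K * (?n * C) * norm x * ((s x)\<^sup>2 / (s x * s x ^ CARD('n)))"
        by (simp add: field_simps)
      also have "(s x)\<^sup>2 / (s x * s x ^ CARD('n)) = 1 / s x ^ (CARD('n) - 1)"
      proof -
        have "s x ^ CARD('n) = s x * s x ^ (CARD('n) - 1)"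
          using card by (simp flip: power_Suc)
        then show ?thesis using s[of x] by (simp add: power2_eq_square)
      qed
      finally show ?thesis using \<rho>_pos[of x] by (simp add: abs_mult)
    qed
    then have "\<bar>G i x\<bar> \<le> (\<Sum>j\<in>(UNIV::'n set). E * K * (?n * C) * norm x / s x ^ (CARD('n) - 1))"
      unfolding G_def by (intro sum_norm_le[where 'a=real, unfolded real_norm_def])
    then show ?thesis by (simp add: s_def)
  qed
  show False
    by (rule no_decaying_expanding_field[OF card pG div _ has_pders_continuous[OF p\<rho>] \<rho>_pos G_bound])
      (use card in simp)
qed

subsection \<open>Smooth maps and tangent vectors of the sphere\<close>

lemma higher_differentiable_on_subset:
  assumes "higher_differentiable_on U f k" "V \<subseteq> U"
  shows "higher_differentiable_on V f k"
  using assms by (induction k arbitrary: f) (auto intro: continuous_on_subset)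

lemma higher_differentiable_on_Suc_imp:
  assumes "higher_differentiable_on U f (Suc k)"
  shows "higher_differentiable_on U f k"
  using assms
proof (induction k arbitrary: f)
  case 0
  then show ?case
    by (simp add: continuous_at_imp_continuous_on differentiable_imp_continuous_within)
next
  case (Suc k)
  have "higher_differentiable_on U (\<lambda>x. frechet_derivative f (at x) v) k" for v
    using Suc.prems by (intro Suc.IH) auto
  with Suc.prems show ?case by auto
qed

lemma higher_differentiable_on_const:
  "higher_differentiable_on U (\<lambda>x. c) k"
  by (induction k arbitrary: c) (auto simp: frechet_derivative_const)

lemma higher_differentiable_on_bounded_linear:
  assumes "bounded_linear f"
  shows "higher_differentiable_on U f k"
proof (cases k)
  case 0
  then show ?thesis using assms by (simp add: linear_continuous_on)
next
  case (Suc l)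
  have D: "(f has_derivative f) (at x)" for x
    by (rule bounded_linear_imp_has_derivative[OF assms])
  have "frechet_derivative f (at x) = f" for x
    by (rule frechet_derivative_at[OF D, symmetric])
  moreover have "f differentiable (at x)" for x
    using D unfolding differentiable_def by blast
  ultimately show ?thesis
    by (simp add: Suc higher_differentiable_on_const)
qed

text \<open>On the whole space the formula for the derivative holds at every point, so it can be
  rewritten under the binder in the recursive clause.\<close>

lemma higher_differentiable_on_add:
  assumes "higher_differentiable_on U f k" "higher_differentiable_on U g k" "U = UNIV"
  shows "higher_differentiable_on U (\<lambda>x. f x + g x) k"
  using assms
proof (induction k arbitrary: f g)
  case 0
  then show ?case by (auto intro: continuous_on_add)
next
  case (Suc k)
  have D: "((\<lambda>x. f x + g x) has_derivative
      (\<lambda>v. frechet_derivative f (at x) v + frechet_derivative g (at x) v)) (at x)" for x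
    using Suc.prems by (intro has_derivative_add) (auto simp: frechet_derivative_works)
  have "frechet_derivative (\<lambda>x. f x + g x) (at x) =
      (\<lambda>v. frechet_derivative f (at x) v + frechet_derivative g (at x) v)" for x
    by (rule frechet_derivative_at[OF D, symmetric])
  moreover have "(\<lambda>x. f x + g x) differentiable (at x)" for x
    using D unfolding differentiable_def by blast
  moreover have "higher_differentiable_on U (\<lambda>x. frechet_derivative f (at x) v +
      frechet_derivative g (at x) v) k" for v
    using Suc.prems by (intro Suc.IH) simp_all
  ultimately show ?case by simp
qed

lemma higher_differentiable_on_scaleR:
  assumes "higher_differentiable_on U f k" "higher_differentiable_on U g k" "U = UNIV"
  shows "higher_differentiable_on U (\<lambda>x. f x *\<^sub>R g x) k"
  using assms
proof (induction k arbitrary: f g)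
  case 0
  then show ?case by (auto intro: continuous_on_scaleR)
next
  case (Suc k)
  have D: "((\<lambda>x. f x *\<^sub>R g x) has_derivative
      (\<lambda>v. f x *\<^sub>R frechet_derivative g (at x) v + frechet_derivative f (at x) v *\<^sub>R g x)) (at x)" for x
    using Suc.prems by (intro has_derivative_scaleR) (auto simp: frechet_derivative_works)
  have "frechet_derivative (\<lambda>x. f x *\<^sub>R g x) (at x) =
      (\<lambda>v. f x *\<^sub>R frechet_derivative g (at x) v + frechet_derivative f (at x) v *\<^sub>R g x)" for x
    by (rule frechet_derivative_at[OF D, symmetric])
  moreover have "higher_differentiable_on U (\<lambda>x. f x *\<^sub>R frechet_derivative g (at x) v +
      frechet_derivative f (at x) v *\<^sub>R g x) k" for v
    using Suc.prems higher_differentiable_on_Suc_imp[OF Suc.prems(1)] higher_differentiable_on_Suc_imp[OF Suc.prems(2)]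
    by (intro higher_differentiable_on_add Suc.IH) simp_all
  moreover have "(\<lambda>x. f x *\<^sub>R g x) differentiable (at x)" for x
    using D unfolding differentiable_def by blast
  ultimately show ?case by simp
qed

lemma smooth_map_onI_UNIV:
  assumes "smooth_on UNIV f"
  shows "smooth_map_on M f"
  unfolding smooth_map_on_def
  by (intro ballI exI[of _ UNIV] exI[of _ f] conjI assms) auto

lemma smooth_on_const: "smooth_on UNIV (\<lambda>x. c)"
  by (simp add: smooth_on_def higher_differentiable_on_const)

lemma smooth_on_bounded_linear: "bounded_linear f \<Longrightarrow> smooth_on UNIV f"
  by (simp add: smooth_on_def higher_differentiable_on_bounded_linear)

lemma smooth_on_add: "smooth_on UNIV f \<Longrightarrow> smooth_on UNIV g \<Longrightarrow> smooth_on UNIV (\<lambda>x. f x + g x)"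
  by (simp add: smooth_on_def higher_differentiable_on_add)

lemma smooth_on_scaleR: "smooth_on UNIV f \<Longrightarrow> smooth_on UNIV g \<Longrightarrow> smooth_on UNIV (\<lambda>x. f x *\<^sub>R g x)"
  by (simp add: smooth_on_def higher_differentiable_on_scaleR)

text \<open>The family is closed under differentiation: the derivative in direction \<open>v\<close>
  replaces \<open>p\<close> by \<open>v c q\<close> and \<open>q\<close> by \<open>- v c p\<close>.
  The induction therefore runs over all \<open>p\<close> and \<open>q\<close>.\<close>

lemma smooth_on_circle:
  "smooth_on UNIV (\<lambda>t::real. cos (c * t) *\<^sub>R p + sin (c * t) *\<^sub>R q)"
proof -
  have "higher_differentiable_on UNIV (\<lambda>t::real. cos (c * t) *\<^sub>R p + sin (c * t) *\<^sub>R q) k" for k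
  proof (induction k arbitrary: p q)
    case 0
    then show ?case by (simp, intro continuous_intros)
  next
    case (Suc k)
    have D: "((\<lambda>t::real. cos (c * t) *\<^sub>R p + sin (c * t) *\<^sub>R q) has_derivative
        (\<lambda>v. cos (c * t) *\<^sub>R (v * c) *\<^sub>R q + sin (c * t) *\<^sub>R (- v * c) *\<^sub>R p)) (at t)" for t
      by (auto intro!: derivative_eq_intros simp: algebra_simps)
    have "frechet_derivative (\<lambda>t::real. cos (c * t) *\<^sub>R p + sin (c * t) *\<^sub>R q) (at t) =
        (\<lambda>v. cos (c * t) *\<^sub>R (v * c) *\<^sub>R q + sin (c * t) *\<^sub>R (- v * c) *\<^sub>R p)" for t
      by (rule frechet_derivative_at[OF D, symmetric])
    moreover have "(\<lambda>t::real. cos (c * t) *\<^sub>R p + sin (c * t) *\<^sub>R q) differentiable (at t)" for t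
      using D unfolding differentiable_def by blast
    ultimately show ?case
      unfolding higher_differentiable_on.simps by (simp only: Suc.IH) simp
  qed
  then show ?thesis by (simp add: smooth_on_def)
qed

abbreviation unit_sphere :: "'a::euclidean_space set" where
  "unit_sphere \<equiv> sphere 0 1"

lemma tangent_space_sphere:
  fixes p :: "'a::euclidean_space"
  assumes "p \<in> unit_sphere"
  shows "tangent_space unit_sphere p = {v. v \<bullet> p = 0}"
proof (intro equalityI subsetI)
  fix v assume "v \<in> tangent_space unit_sphere p"
  then obtain \<gamma> e where e: "0 < e" and \<gamma>: "\<gamma> ` {-e<..<e} \<subseteq> unit_sphere" "\<gamma> (0::real) = p"
    "(\<gamma> has_vector_derivative v) (at 0)"
    unfolding tangent_space_def by blast
  have "((\<lambda>t. \<gamma> t \<bullet> \<gamma> t) has_derivative (\<lambda>s. \<gamma> 0 \<bullet> (s *\<^sub>R v) + (s *\<^sub>R v) \<bullet> \<gamma> 0)) (at 0)"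
    using \<gamma>(3) unfolding has_vector_derivative_def by (intro has_derivative_inner)
  moreover have "((\<lambda>t. \<gamma> t \<bullet> \<gamma> t) has_derivative (\<lambda>s. 0)) (at 0)"
  proof (rule has_derivative_transform_within_open[OF has_derivative_const[of 1]])
    show "open {-e<..<e}" "0 \<in> {-e<..<e}" using e by auto
    show "1 = \<gamma> t \<bullet> \<gamma> t" if "t \<in> {-e<..<e}" for t
      using \<gamma>(1) that by (auto simp: image_subset_iff norm_eq_1)
  qed
  ultimately have "(\<lambda>s. \<gamma> 0 \<bullet> (s *\<^sub>R v) + (s *\<^sub>R v) \<bullet> \<gamma> 0) = (\<lambda>s::real. 0)"
    by (rule has_derivative_unique)
  from fun_cong[OF this, of 1] show "v \<in> {v. v \<bullet> p = 0}"
    by (simp add: \<gamma>(2) inner_commute)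
next
  fix v assume "v \<in> {v. v \<bullet> p = 0}"
  then have v: "v \<bullet> p = 0" by simp
  \<comment> \<open>The great circle through \<open>p\<close> with speed \<open>norm v\<close> is
    the witness; for \<open>v = 0\<close> it is the constant curve.\<close>
  define q where "q = (1 / norm v) *\<^sub>R v"
  define \<gamma> where "\<gamma> = (\<lambda>t. cos (norm v * t) *\<^sub>R p + sin (norm v * t) *\<^sub>R q)"
  have q: "norm v *\<^sub>R q = v" by (simp add: q_def)
  have pq: "q \<bullet> p = 0" "p \<bullet> p = 1" using v assms by (auto simp: q_def norm_eq_1)
  have g1: "smooth_on {-1<..<1} \<gamma>"
    using smooth_on_circle higher_differentiable_on_subset unfolding \<gamma>_def smooth_on_def by blast
  have g2: "\<gamma> t \<in> unit_sphere" for t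
  proof (cases "v = 0")
    case True
    then show ?thesis using assms by (simp add: \<gamma>_def)
  next
    case False
    then have "q \<bullet> q = 1" by (simp add: q_def dot_square_norm power2_eq_square)
    then have "\<gamma> t \<bullet> \<gamma> t = 1"
      using pq by (simp add: \<gamma>_def inner_add_left inner_add_right inner_commute[of p q] flip: power2_eq_square)
    then show ?thesis by (simp add: norm_eq_1)
  qed
  have "((\<lambda>t. cos (c * t) *\<^sub>R p + sin (c * t) *\<^sub>R q) has_derivative (\<lambda>s. s *\<^sub>R (c *\<^sub>R q))) (at 0)" for c :: real
    by (auto intro!: derivative_eq_intros simp: mult.commute)
  from this[of "norm v"] have g3: "(\<gamma> has_vector_derivative v) (at 0)"
    unfolding q by (simp add: \<gamma>_def has_vector_derivative_def)
  have g4: "\<gamma> 0 = p" by (simp add: \<gamma>_def)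
  show "v \<in> tangent_space unit_sphere p"
    unfolding tangent_space_def
    by (intro CollectI exI[of _ \<gamma>] exI[of _ 1] conjI g1 g3 g4 image_subsetI g2) simp
qed

lemma linear_map_on_tangentD:
  assumes f: "linear_map_on (tangent_space unit_sphere p) f" and p: "p \<in> unit_sphere"
  shows "f 0 = 0"
    and "v \<bullet> p = 0 \<Longrightarrow> w \<bullet> p = 0 \<Longrightarrow> f (v + w) = f v + f w"
    and "v \<bullet> p = 0 \<Longrightarrow> w \<bullet> p = 0 \<Longrightarrow> f (v - w) = f v - f w"
    and "v \<bullet> p = 0 \<Longrightarrow> f (c *\<^sub>R v) = c *\<^sub>R f v"
    and "v \<bullet> p = 0 \<Longrightarrow> f (- v) = - f v"
proof -
  have f': "\<And>v w. v \<bullet> p = 0 \<Longrightarrow> w \<bullet> p = 0 \<Longrightarrow> f (v + w) = f v + f w"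
    "\<And>v c. v \<bullet> p = 0 \<Longrightarrow> f (c *\<^sub>R v) = c *\<^sub>R f v"
    using f unfolding linear_map_on_def tangent_space_sphere[OF p] by auto
  then show "v \<bullet> p = 0 \<Longrightarrow> w \<bullet> p = 0 \<Longrightarrow> f (v + w) = f v + f w"
    "v \<bullet> p = 0 \<Longrightarrow> f (c *\<^sub>R v) = c *\<^sub>R f v" by auto
  show "f 0 = 0" using f'(2)[of 0 0] by simp
  have m: "v \<bullet> p = 0 \<Longrightarrow> f (- v) = - f v" for v using f'(2)[of v "- 1"] by simp
  then show "v \<bullet> p = 0 \<Longrightarrow> f (- v) = - f v" .
  show "v \<bullet> p = 0 \<Longrightarrow> w \<bullet> p = 0 \<Longrightarrow> f (v - w) = f v - f w"
    using f'(1)[of v "- w"] m[of w] by simp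
qed

lemma linear_map_on_tangent_sum:
  assumes f: "linear_map_on (tangent_space unit_sphere p) f" and p: "p \<in> unit_sphere"
    and v: "\<And>i. i \<in> I \<Longrightarrow> v i \<in> tangent_space unit_sphere p"
  shows "(\<Sum>i\<in>I. c i *\<^sub>R v i) \<in> tangent_space unit_sphere p"
    and "f (\<Sum>i\<in>I. c i *\<^sub>R v i) = (\<Sum>i\<in>I. c i *\<^sub>R f (v i))"
proof -
  have t: "(\<Sum>i\<in>J. c i *\<^sub>R v i) \<in> tangent_space unit_sphere p" if "J \<subseteq> I" for J
    using v that by (auto simp: tangent_space_sphere[OF p] inner_sum_left intro!: sum.neutral)
  then show "(\<Sum>i\<in>I. c i *\<^sub>R v i) \<in> tangent_space unit_sphere p" by simp
  have z: "f 0 = 0"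
    by (rule linear_map_on_tangentD(1)[OF f p])
  have "f (\<Sum>i\<in>J. c i *\<^sub>R v i) = (\<Sum>i\<in>J. c i *\<^sub>R f (v i))" if "J \<subseteq> I" for J
    using that
  proof (induction J rule: infinite_finite_induct)
    case (insert j J)
    have "c j *\<^sub>R v j \<in> tangent_space unit_sphere p"
      using v[of j] insert.prems by (simp add: tangent_space_sphere[OF p])
    with insert t[of J] f v[of j] show ?case by (simp add: linear_map_on_def)
  qed (auto simp: z)
  then show "f (\<Sum>i\<in>I. c i *\<^sub>R v i) = (\<Sum>i\<in>I. c i *\<^sub>R f (v i))" by simp
qed

text \<open>The orthogonal projection of the constant field \<open>v\<close>. It extends every
  tangent vector to a global smooth field, so that identities stated for vector fields can be read
  at single vectors. The sum form matches the closure rules for smooth functions.\<close>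

definition tangential :: "'a \<Rightarrow> 'a \<Rightarrow> 'a::euclidean_space" where
  "tangential v p = v + (- (v \<bullet> p)) *\<^sub>R p"

lemma vector_field_tangential: "vector_field unit_sphere (tangential v)"
  unfolding vector_field_def
proof (intro conjI ballI)
  fix p :: 'a assume p: "p \<in> unit_sphere"
  then show "tangential v p \<in> tangent_space unit_sphere p"
    by (simp add: tangent_space_sphere tangential_def inner_diff_left norm_eq_1)
next
  show "smooth_map_on unit_sphere (tangential v)"
    unfolding tangential_def
    by (intro smooth_map_onI_UNIV smooth_on_add smooth_on_const smooth_on_scaleR smooth_on_bounded_linear
        bounded_linear_minus bounded_linear_inner_right bounded_linear_ident)
qed

lemma tangential_eq: "v \<bullet> p = 0 \<Longrightarrow> tangential v p = v"
  by (simp add: tangential_def)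

subsection \<open>Stereographic coordinates\<close>

definition pd :: "'n \<Rightarrow> (real^'n \<Rightarrow> 'b::real_normed_vector) \<Rightarrow> real^'n \<Rightarrow> 'b" where
  "pd i F y = frechet_derivative F (at y) (axis i 1)"

lemma pd_eq:
  assumes "(F has_derivative F') (at y)"
  shows "pd i F y = F' (axis i 1)"
  unfolding pd_def by (simp flip: frechet_derivative_at[OF assms])

lemma pd_sum_scaleR:
  fixes a :: "'j::finite \<Rightarrow> real^'n \<Rightarrow> real"
  assumes "\<And>j. a j differentiable (at y)" "\<And>j. V j differentiable (at y)"
  shows "pd i (\<lambda>y. \<Sum>j\<in>UNIV. a j y *\<^sub>R V j y) y =
    (\<Sum>j\<in>UNIV. pd i (a j) y *\<^sub>R V j y + a j y *\<^sub>R pd i (V j) y)"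
proof -
  have "((\<lambda>y. \<Sum>j\<in>UNIV. a j y *\<^sub>R V j y) has_derivative
      (\<lambda>v. \<Sum>j\<in>UNIV. a j y *\<^sub>R frechet_derivative (V j) (at y) v +
        frechet_derivative (a j) (at y) v *\<^sub>R V j y)) (at y)"
    by (intro has_derivative_sum has_derivative_scaleR) (use assms in \<open>simp_all flip: frechet_derivative_works\<close>)
  from pd_eq[OF this] show ?thesis by (simp add: pd_def add.commute)
qed

text \<open>
  The inverse stereographic projection from \<open>N\<close> in the orthonormal coordinates \<open>b\<close> of the
  equatorial hyperplane. The translations of the chart are the restrictions of the quadratic
  vector fields \<open>T i\<close>, which are defined on the whole sphere.
\<close>

locale stereographic =
  fixes N :: "'a::euclidean_space" and b :: "'n::finite \<Rightarrow> 'a"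
  assumes NN: "N \<bullet> N = 1" and bN: "b i \<bullet> N = 0"
    and bb: "b i \<bullet> b j = (if i = j then 1 else 0)"
    and expand: "v = (v \<bullet> N) *\<^sub>R N + (\<Sum>i\<in>UNIV. (v \<bullet> b i) *\<^sub>R b i)"
begin

text \<open>The conformal factor: \<open>\<psi>\<close> pulls the ambient inner product back to
  \<open>h^2\<close> times the Euclidean one, see \<open>T_T\<close>.\<close>

definition h :: "real^'n \<Rightarrow> real" where
  "h y = 2 / (1 + y \<bullet> y)"

definition equator :: "real^'n \<Rightarrow> 'a" where
  "equator y = (\<Sum>i\<in>UNIV. y $ i *\<^sub>R b i)"

definition \<psi> :: "real^'n \<Rightarrow> 'a" where
  "\<psi> y = h y *\<^sub>R equator y + (1 - h y) *\<^sub>R N"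

definition T :: "'n \<Rightarrow> 'a \<Rightarrow> 'a" where
  "T i p = (1 - p \<bullet> N) *\<^sub>R b i + (p \<bullet> b i) *\<^sub>R (N - p)"

text \<open>The fields \<open>T i\<close> are orthogonal of length \<open>h\<close>, hence the
  division by \<open>h^2\<close>.\<close>

definition coord :: "'n \<Rightarrow> ('a \<Rightarrow> 'a) \<Rightarrow> real^'n \<Rightarrow> real" where
  "coord i X y = (X (\<psi> y) \<bullet> T i (\<psi> y)) / (h y)\<^sup>2"

lemma denominator_pos: "0 < 1 + y \<bullet> (y :: real^'n)"
  by (rule add_pos_nonneg) auto

lemma h_pos: "0 < h y"
  by (simp add: h_def denominator_pos)

lemma h_eq: "h y * (y \<bullet> y) = 2 - h y"
  using denominator_pos[of y] by (simp add: h_def field_simps)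

lemma Nb: "N \<bullet> b i = 0"
  using bN[of i] by (simp add: inner_commute)

lemma equator_inner: "equator y \<bullet> N = 0" "N \<bullet> equator y = 0" "equator y \<bullet> b i = y $ i"
  "equator y \<bullet> equator z = y \<bullet> z"
proof -
  show "equator y \<bullet> N = 0" by (simp add: equator_def inner_sum_left bN)
  then show "N \<bullet> equator y = 0" by (simp add: inner_commute)
  show *: "equator y \<bullet> b i = y $ i" for i
    by (simp add: equator_def inner_sum_left bb if_distrib cong: if_cong)
  have "equator y \<bullet> equator z = (\<Sum>i\<in>UNIV. z $ i * (equator y \<bullet> b i))"
    by (subst (2) equator_def) (simp add: inner_sum_right)
  then show "equator y \<bullet> equator z = y \<bullet> z"
    by (simp add: * inner_vec_def mult.commute)
qed

lemma \<psi>_inner: "\<psi> y \<bullet> N = 1 - h y" "N \<bullet> \<psi> y = 1 - h y" "\<psi> y \<bullet> b i = h y * y $ i"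
  "b i \<bullet> \<psi> y = h y * y $ i" "\<psi> y \<bullet> \<psi> y = 1"
proof -
  show "\<psi> y \<bullet> N = 1 - h y" by (simp add: \<psi>_def inner_add_left equator_inner NN)
  then show "N \<bullet> \<psi> y = 1 - h y" by (simp add: inner_commute)
  show "\<psi> y \<bullet> b i = h y * y $ i" by (simp add: \<psi>_def inner_add_left equator_inner Nb)
  then show "b i \<bullet> \<psi> y = h y * y $ i" by (simp add: inner_commute)
  have "\<psi> y \<bullet> \<psi> y = h y * (h y * (y \<bullet> y)) + (1 - h y) * (1 - h y)"
    by (simp add: \<psi>_def inner_add_left inner_add_right equator_inner NN)
  then show "\<psi> y \<bullet> \<psi> y = 1" unfolding h_eq by (simp add: algebra_simps)
qed

lemma \<psi>_sphere: "\<psi> y \<in> unit_sphere"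
  by (simp add: norm_eq_1 \<psi>_inner)

lemma T_\<psi>: "T i (\<psi> y) = h y *\<^sub>R b i + (h y * y $ i) *\<^sub>R (N - \<psi> y)"
  by (simp add: T_def \<psi>_inner)

lemma T_inner:
  "T i (\<psi> y) \<bullet> N = h y * y $ i * h y" "T i (\<psi> y) \<bullet> b j = (if i = j then h y else 0) - h y * y $ i * (h y * y $ j)"
  by (simp_all add: T_\<psi> inner_add_left inner_diff_left bN Nb NN bb \<psi>_inner)

lemma T_tangent: "p \<in> unit_sphere \<Longrightarrow> T i p \<bullet> p = 0"
  by (simp add: T_def inner_add_left inner_diff_left norm_eq_1 inner_commute algebra_simps)

lemma T_tangent_\<psi>: "T i (\<psi> y) \<bullet> \<psi> y = 0" "\<psi> y \<bullet> T i (\<psi> y) = 0"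
  using T_tangent[OF \<psi>_sphere] by (simp_all add: inner_commute)

lemma T_T: "T i (\<psi> y) \<bullet> T j (\<psi> y) = (if i = j then (h y)\<^sup>2 else 0)"
proof -
  have "T i (\<psi> y) \<bullet> T j (\<psi> y) = h y * (T i (\<psi> y) \<bullet> b j) + h y * y $ j * (T i (\<psi> y) \<bullet> N)"
    by (subst (2) T_\<psi>) (simp add: inner_add_right inner_diff_right T_tangent_\<psi>)
  then show ?thesis by (simp add: T_inner power2_eq_square algebra_simps)
qed

lemma tangent_\<psi>: "w \<in> tangent_space unit_sphere (\<psi> y) \<longleftrightarrow> w \<bullet> \<psi> y = 0"
  by (simp add: tangent_space_sphere[OF \<psi>_sphere])

text \<open>The difference \<open>u\<close> of the two sides is orthogonal to
  \<open>\<psi> y\<close> and to all \<open>T i\<close>. The latter ties each component of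
  \<open>u\<close> along \<open>b i\<close> to the one along \<open>N\<close>, and the former then
  makes that one vanish.\<close>

lemma tangent_expand:
  assumes "w \<bullet> \<psi> y = 0"
  shows "w = (\<Sum>i\<in>UNIV. (w \<bullet> T i (\<psi> y) / (h y)\<^sup>2) *\<^sub>R T i (\<psi> y))"
proof -
  define u where "u = w - (\<Sum>i\<in>UNIV. (w \<bullet> T i (\<psi> y) / (h y)\<^sup>2) *\<^sub>R T i (\<psi> y))"
  have u\<psi>: "u \<bullet> \<psi> y = 0"
    by (simp add: u_def inner_diff_left inner_sum_left T_tangent_\<psi> assms)
  have uT: "u \<bullet> T i (\<psi> y) = 0" for i
    using h_pos[of y] by (simp add: u_def inner_diff_left inner_sum_left T_T if_distrib cong: if_cong)
  have ub: "u \<bullet> b i = - (y $ i * (u \<bullet> N))" for i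
  proof -
    have "h y * (u \<bullet> b i + y $ i * (u \<bullet> N)) = 0"
      using uT[of i] by (simp add: T_\<psi> inner_add_right inner_diff_right u\<psi> algebra_simps)
    then show ?thesis using h_pos[of y] by simp
  qed
  have "u \<bullet> equator y = - ((y \<bullet> y) * (u \<bullet> N))"
    by (simp add: equator_def inner_sum_right ub inner_vec_def sum_distrib_right sum_negf mult.assoc)
  then have "u \<bullet> \<psi> y = - (h y * (y \<bullet> y)) * (u \<bullet> N) + (1 - h y) * (u \<bullet> N)"
    by (simp add: \<psi>_def inner_add_right)
  then have "u \<bullet> N = 0"
    unfolding h_eq u\<psi> by (simp add: algebra_simps)
  then have "u = 0" using expand[of u] by (simp add: ub)
  then show ?thesis by (simp add: u_def)
qed

lemma field_expand:
  assumes "vector_field unit_sphere X"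
  shows "X (\<psi> y) = (\<Sum>i\<in>UNIV. coord i X y *\<^sub>R T i (\<psi> y))" "X (\<psi> y) \<bullet> \<psi> y = 0"
proof -
  show "X (\<psi> y) \<bullet> \<psi> y = 0"
    using assms \<psi>_sphere unfolding vector_field_def tangent_\<psi>[symmetric] by blast
  then show "X (\<psi> y) = (\<Sum>i\<in>UNIV. coord i X y *\<^sub>R T i (\<psi> y))"
    unfolding coord_def by (rule tangent_expand)
qed

lemma coord_T: "coord i (T j) y = (if i = j then 1 else 0)"
  using h_pos[of y] by (simp add: coord_def T_T)

lemma vector_field_T: "vector_field unit_sphere (T i)"
  unfolding vector_field_def
proof (intro conjI ballI)
  show "T i p \<in> tangent_space unit_sphere p" if "p \<in> unit_sphere" for p
    using T_tangent[OF that] that by (simp add: tangent_space_sphere)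
  have "smooth_map_on unit_sphere (\<lambda>p. (1 + p \<bullet> (- N)) *\<^sub>R b i + (p \<bullet> b i) *\<^sub>R (N + (- p)))"
    by (intro smooth_map_onI_UNIV smooth_on_add smooth_on_scaleR smooth_on_const
        smooth_on_bounded_linear[OF bounded_linear_inner_left]
        smooth_on_bounded_linear[OF bounded_linear_minus[OF bounded_linear_ident]])
  moreover have "T i = (\<lambda>p. (1 + p \<bullet> (- N)) *\<^sub>R b i + (p \<bullet> b i) *\<^sub>R (N + (- p)))"
    by (simp add: T_def fun_eq_iff)
  ultimately show "smooth_map_on unit_sphere (T i)" by (simp only:)
qed

lemma smooth_field: "vector_field M X \<Longrightarrow> smooth_map_on M X"
  by (simp add: vector_field_def)

lemma h_derivative: "(h has_derivative (\<lambda>v. - ((h y)\<^sup>2 * (y \<bullet> v)))) (at y)"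
proof -
  have "((\<lambda>y :: real^'n. 2 / (1 + y \<bullet> y)) has_derivative (\<lambda>v. - ((2 / (1 + y \<bullet> y))\<^sup>2 * (y \<bullet> v)))) (at y)"
    using denominator_pos[of y]
    by (auto intro!: derivative_eq_intros simp: fun_eq_iff power2_eq_square field_simps inner_commute)
  then show ?thesis by (simp add: h_def[abs_def])
qed

lemma \<psi>_derivative: "(\<psi> has_derivative (\<lambda>v. \<Sum>i\<in>UNIV. v $ i *\<^sub>R T i (\<psi> y))) (at y)"
proof -
  have e: "(equator has_derivative equator) (at y)"
    unfolding equator_def[abs_def]
    by (auto intro!: derivative_eq_intros bounded_linear_imp_has_derivative[OF bounded_linear_vec_nth])
  have "((\<lambda>y. h y *\<^sub>R equator y + (1 - h y) *\<^sub>R N) has_derivative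
      (\<lambda>v. (h y *\<^sub>R equator v + (- ((h y)\<^sup>2 * (y \<bullet> v))) *\<^sub>R equator y) + ((h y)\<^sup>2 * (y \<bullet> v)) *\<^sub>R N)) (at y)"
    by (auto intro!: derivative_eq_intros h_derivative e)
  moreover have "(h y *\<^sub>R equator v + (- ((h y)\<^sup>2 * (y \<bullet> v))) *\<^sub>R equator y) + ((h y)\<^sup>2 * (y \<bullet> v)) *\<^sub>R N =
      (\<Sum>i\<in>UNIV. v $ i *\<^sub>R T i (\<psi> y))" for v
  proof -
    have "(\<Sum>i\<in>UNIV. v $ i *\<^sub>R T i (\<psi> y)) = h y *\<^sub>R equator v + (h y * (y \<bullet> v)) *\<^sub>R (N - \<psi> y)"
      by (simp add: T_\<psi> equator_def scaleR_right_distrib sum.distrib scaleR_sum_right scaleR_sum_left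
          inner_vec_def sum_distrib_left mult_ac)
    also have "N - \<psi> y = h y *\<^sub>R (N - equator y)"
      by (simp add: \<psi>_def algebra_simps)
    finally show ?thesis by (simp add: algebra_simps power2_eq_square)
  qed
  ultimately show ?thesis by (simp add: \<psi>_def[abs_def])
qed

lemma continuous_\<psi>: "continuous_on S \<psi>"
  by (intro continuous_at_imp_continuous_on ballI has_derivative_continuous[OF \<psi>_derivative])

lemma pullback_derivative:
  assumes "smooth_map_on unit_sphere f"
  shows "((\<lambda>y. f (\<psi> y)) has_derivative
    (\<lambda>v. frechet_derivative f (at (\<psi> y) within unit_sphere) (\<Sum>i\<in>UNIV. v $ i *\<^sub>R T i (\<psi> y)))) (at y)"
proof -
  have "(f has_derivative frechet_derivative f (at (\<psi> y) within unit_sphere)) (at (\<psi> y) within unit_sphere)"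
    using smooth_map_on_differentiable[OF assms \<psi>_sphere] by (simp add: frechet_derivative_works)
  then have "(f has_derivative frechet_derivative f (at (\<psi> y) within unit_sphere)) (at (\<psi> y) within \<psi> ` UNIV)"
    by (rule has_derivative_subset) (use \<psi>_sphere in blast)
  from diff_chain_within[OF \<psi>_derivative this] show ?thesis by (simp add: o_def)
qed

lemma pullback_differentiable:
  "smooth_map_on unit_sphere f \<Longrightarrow> (\<lambda>y. f (\<psi> y)) differentiable (at y)"
  using pullback_derivative unfolding differentiable_def by blast

text \<open>The derivative within the sphere is a choice of an ambient linear map, but its value on
  \<open>T i\<close> is forced by the unique derivative of the function pulled back to the
  chart.\<close>

lemma pd_pullback:
  assumes "smooth_map_on unit_sphere f"
  shows "pd i (\<lambda>y. f (\<psi> y)) y = deriv_along unit_sphere (T i) f (\<psi> y)"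
proof -
  have "(\<Sum>j\<in>UNIV. (axis i 1 :: real^'n) $ j *\<^sub>R T j (\<psi> y)) = T i (\<psi> y)"
    by (simp add: axis_def if_distrib if_distribR cong: if_cong)
  then show ?thesis by (simp add: pd_eq[OF pullback_derivative[OF assms]] deriv_along_def)
qed

lemma deriv_along_coord:
  assumes f: "smooth_map_on unit_sphere f" and X: "vector_field unit_sphere X"
  shows "deriv_along unit_sphere X f (\<psi> y) = (\<Sum>i\<in>UNIV. coord i X y *\<^sub>R pd i (\<lambda>y. f (\<psi> y)) y)"
proof -
  have "(f has_derivative frechet_derivative f (at (\<psi> y) within unit_sphere)) (at (\<psi> y) within unit_sphere)"
    using smooth_map_on_differentiable[OF f \<psi>_sphere] by (simp add: frechet_derivative_works)
  then interpret bounded_linear "frechet_derivative f (at (\<psi> y) within unit_sphere)"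
    by (rule has_derivative_bounded_linear)
  show ?thesis
    unfolding pd_pullback[OF f] unfolding deriv_along_def field_expand(1)[OF X] by (simp add: sum scaleR)
qed

lemma pullback_has_derivative:
  fixes f :: "'a \<Rightarrow> real"
  assumes "smooth_map_on unit_sphere f"
  shows "((\<lambda>y. f (\<psi> y)) has_derivative (\<lambda>v. \<Sum>k\<in>UNIV. v $ k * pd k (\<lambda>y. f (\<psi> y)) y)) (at y)"
proof -
  have "(f has_derivative frechet_derivative f (at (\<psi> y) within unit_sphere)) (at (\<psi> y) within unit_sphere)"
    using smooth_map_on_differentiable[OF assms \<psi>_sphere] by (simp add: frechet_derivative_works)
  then interpret bounded_linear "frechet_derivative f (at (\<psi> y) within unit_sphere)"
    by (rule has_derivative_bounded_linear)
  show ?thesis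
    using pullback_derivative[OF assms, of y] by (simp add: pd_pullback[OF assms] deriv_along_def sum scaleR)
qed

text \<open>The chosen derivatives within the sphere need not fit together continuously, so a local
  smooth extension \<open>F\<close> is differentiated instead. Expanding \<open>T i\<close> over
  \<open>Basis\<close> reduces the claim to derivatives of \<open>F\<close> in fixed
  directions.\<close>

lemma continuous_pd_pullback:
  fixes f :: "'a \<Rightarrow> real"
  assumes f: "smooth_map_on unit_sphere f"
  shows "continuous_on UNIV (pd i (\<lambda>y. f (\<psi> y)))"
proof (rule continuous_at_imp_continuous_on, rule ballI)
  fix y0
  obtain U F where U: "open U" "\<psi> y0 \<in> U" "smooth_on U F" and F: "\<And>x. x \<in> U \<inter> unit_sphere \<Longrightarrow> F x = f x"
    using bspec[OF f[unfolded smooth_map_on_def] \<psi>_sphere[of y0]] by blast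
  have "higher_differentiable_on U F (Suc 0)"
    using U(3) unfolding smooth_on_def by blast
  then have dF: "\<And>x. x \<in> U \<Longrightarrow> F differentiable (at x)"
    and cF: "\<And>v. continuous_on U (\<lambda>x. frechet_derivative F (at x) v)" by auto
  define V where "V = \<psi> -` U"
  have V: "open V" "y0 \<in> V"
    using U continuous_\<psi>[of UNIV] by (auto simp: V_def continuous_on_open_vimage[OF open_UNIV])
  have eq: "pd i (\<lambda>y. f (\<psi> y)) y = (\<Sum>c\<in>Basis. (T i (\<psi> y) \<bullet> c) * frechet_derivative F (at (\<psi> y)) c)"
    if y: "y \<in> V" for y
  proof -
    have F': "(F has_derivative frechet_derivative F (at (\<psi> y))) (at (\<psi> y))"
      using dF y by (simp add: V_def flip: frechet_derivative_works)
    then interpret bounded_linear "frechet_derivative F (at (\<psi> y))"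
      by (rule has_derivative_bounded_linear)
    have "((\<lambda>y. F (\<psi> y)) has_derivative
        (\<lambda>v. frechet_derivative F (at (\<psi> y)) (\<Sum>i\<in>UNIV. v $ i *\<^sub>R T i (\<psi> y)))) (at y)"
      using diff_chain_at[OF \<psi>_derivative F'] by (simp add: o_def)
    then have "((\<lambda>y. f (\<psi> y)) has_derivative
        (\<lambda>v. frechet_derivative F (at (\<psi> y)) (\<Sum>i\<in>UNIV. v $ i *\<^sub>R T i (\<psi> y)))) (at y)"
      by (rule has_derivative_transform_within_open[OF _ V(1) y]) (use F \<psi>_sphere in \<open>simp only: V_def vimage_eq Int_iff simp_thms\<close>)
    from pd_eq[OF this, of i] have "pd i (\<lambda>y. f (\<psi> y)) y = frechet_derivative F (at (\<psi> y)) (T i (\<psi> y))"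
      by (simp add: axis_def if_distrib if_distribR cong: if_cong)
    also have "\<dots> = frechet_derivative F (at (\<psi> y)) (\<Sum>c\<in>Basis. (T i (\<psi> y) \<bullet> c) *\<^sub>R c)"
      by (simp only: euclidean_representation)
    finally show ?thesis by (simp add: sum scaleR)
  qed
  have "continuous_on V (\<lambda>y. \<Sum>c\<in>Basis. (T i (\<psi> y) \<bullet> c) * frechet_derivative F (at (\<psi> y)) c)"
    unfolding T_def
    by (intro continuous_intros continuous_\<psi> continuous_on_compose2[OF cF]) (auto simp: V_def)
  then have "continuous_on V (pd i (\<lambda>y. f (\<psi> y)))"
    by (simp add: eq cong: continuous_on_cong)
  then show "isCont (pd i (\<lambda>y. f (\<psi> y))) y0"
    using V by (simp add: continuous_on_eq_continuous_at)
qed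

text \<open>Symmetry of the second derivatives of \<open>\<psi>\<close>, as \<open>T j\<close> at
  \<open>\<psi> y\<close> is its partial derivative in direction \<open>j\<close>.\<close>

lemma pd_T: "pd i (\<lambda>y. T j (\<psi> y)) y = pd j (\<lambda>y. T i (\<psi> y)) y"
proof -
  have T': "(T j has_derivative (\<lambda>u. - (u \<bullet> N) *\<^sub>R b j + ((p \<bullet> b j) *\<^sub>R (- u) + (u \<bullet> b j) *\<^sub>R (N - p)))) (at p)" for j p
    unfolding T_def[abs_def] by (auto intro!: derivative_eq_intros)
  have F: "pd i (\<lambda>y. T j (\<psi> y)) y = - (T i (\<psi> y) \<bullet> N) *\<^sub>R b j +
      ((\<psi> y \<bullet> b j) *\<^sub>R (- T i (\<psi> y)) + (T i (\<psi> y) \<bullet> b j) *\<^sub>R (N - \<psi> y))" for i j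
    using pd_eq[OF diff_chain_at[OF \<psi>_derivative T'], of i j y]
    by (simp add: o_def axis_def if_distrib if_distribR cong: if_cong)
  show ?thesis
    unfolding F T_inner \<psi>_inner unfolding T_\<psi> by (simp add: algebra_simps)
qed

lemma coord_differentiable:
  assumes "vector_field unit_sphere X"
  shows "coord i X differentiable (at y)"
proof -
  have X: "(\<lambda>y. X (\<psi> y)) differentiable (at y)" "(\<lambda>y. T i (\<psi> y)) differentiable (at y)"
    using pullback_differentiable smooth_field assms vector_field_T by blast+
  have "h differentiable (at y)" using h_derivative differentiable_def by blast
  then show ?thesis
    unfolding coord_def[abs_def] power2_eq_square using h_pos[of y] X
    by (intro differentiable_divide differentiable_inner differentiable_mult) auto
qed

text \<open>The terms in which the frame \<open>T\<close> itself is differentiated are symmetric in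
  \<open>X\<close> and \<open>Y\<close> by \<open>pd_T\<close>, and cancel.\<close>

lemma lie_bracket_coord:
  assumes X: "vector_field unit_sphere X" and Y: "vector_field unit_sphere Y"
  shows "lie_bracket unit_sphere X Y (\<psi> y) = (\<Sum>j\<in>UNIV.
    (\<Sum>i\<in>UNIV. coord i X y * pd i (coord j Y) y - coord i Y y * pd i (coord j X) y) *\<^sub>R T j (\<psi> y))"
proof -
  have D: "deriv_along unit_sphere X Y (\<psi> y) =
      (\<Sum>j\<in>UNIV. (\<Sum>i\<in>UNIV. coord i X y * pd i (coord j Y) y) *\<^sub>R T j (\<psi> y)) +
      (\<Sum>i\<in>UNIV. \<Sum>j\<in>UNIV. (coord i X y * coord j Y y) *\<^sub>R pd i (\<lambda>y. T j (\<psi> y)) y)"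
    if X: "vector_field unit_sphere X" and Y: "vector_field unit_sphere Y" for X Y
  proof -
    have "deriv_along unit_sphere X Y (\<psi> y) = (\<Sum>i\<in>UNIV. coord i X y *\<^sub>R pd i (\<lambda>y. \<Sum>j\<in>UNIV. coord j Y y *\<^sub>R T j (\<psi> y)) y)"
      using deriv_along_coord[OF smooth_field[OF Y] X] by (simp add: field_expand(1)[OF Y, symmetric])
    also have "\<dots> = (\<Sum>i\<in>UNIV. \<Sum>j\<in>UNIV. (coord i X y * pd i (coord j Y) y) *\<^sub>R T j (\<psi> y)) +
        (\<Sum>i\<in>UNIV. \<Sum>j\<in>UNIV. (coord i X y * coord j Y y) *\<^sub>R pd i (\<lambda>y. T j (\<psi> y)) y)"
      by (subst pd_sum_scaleR)
        (auto intro!: coord_differentiable Y pullback_differentiable smooth_field vector_field_T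
          simp: scaleR_sum_right scaleR_right_distrib sum.distrib)
    also have "(\<Sum>i\<in>UNIV. \<Sum>j\<in>UNIV. (coord i X y * pd i (coord j Y) y) *\<^sub>R T j (\<psi> y)) =
        (\<Sum>j\<in>UNIV. (\<Sum>i\<in>UNIV. coord i X y * pd i (coord j Y) y) *\<^sub>R T j (\<psi> y))"
      unfolding scaleR_sum_left by (rule sum.swap)
    finally show ?thesis .
  qed
  have "(\<Sum>i\<in>UNIV. \<Sum>j\<in>UNIV. (coord i Y y * coord j X y) *\<^sub>R pd i (\<lambda>y. T j (\<psi> y)) y) =
      (\<Sum>i\<in>UNIV. \<Sum>j\<in>UNIV. (coord i X y * coord j Y y) *\<^sub>R pd i (\<lambda>y. T j (\<psi> y)) y)"
    by (subst sum.swap) (simp add: mult.commute pd_T)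
  then show ?thesis
    unfolding lie_bracket_def D[OF X Y] D[OF Y X]
    by (simp add: sum_subtractf scaleR_diff_left)
qed

lemma lie_bracket_T: "lie_bracket unit_sphere (T i) (T j) (\<psi> y) = 0"
proof -
  have "pd l (coord k (T j)) y = 0" for l k j
  proof -
    have "coord k (T j) = (\<lambda>y. if k = j then 1 else 0)"
      by (rule ext) (rule coord_T)
    then show ?thesis by (simp only:) (rule pd_eq[OF has_derivative_const])
  qed
  then show ?thesis by (simp add: lie_bracket_coord[OF vector_field_T vector_field_T])
qed

lemma lie_bracket_tangent:
  assumes "vector_field unit_sphere X" "vector_field unit_sphere Y"
  shows "lie_bracket unit_sphere X Y (\<psi> y) \<bullet> \<psi> y = 0"
  by (simp add: lie_bracket_coord[OF assms] inner_sum_left T_tangent_\<psi>)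

lemma one_form_sum:
  assumes "one_form unit_sphere \<eta>"
  shows "\<eta> (\<psi> y) (\<Sum>i\<in>UNIV. c i *\<^sub>R T i (\<psi> y)) = (\<Sum>i\<in>UNIV. c i * \<eta> (\<psi> y) (T i (\<psi> y)))"
proof -
  have "linear_map_on (tangent_space unit_sphere (\<psi> y)) (\<eta> (\<psi> y))"
    using assms \<psi>_sphere unfolding one_form_def by blast
  from linear_map_on_tangent_sum(2)[OF this \<psi>_sphere, where I = UNIV and c = c and v = "\<lambda>i. T i (\<psi> y)"]
  show ?thesis by (simp add: tangent_\<psi> T_tangent_\<psi>)
qed

text \<open>Derivatives of the coordinates of \<open>X\<close> and \<open>Y\<close> cancel against
  the bracket. The value depends only on the coordinates at \<open>y\<close>, so
  \<open>d\<eta>\<close> can be evaluated on the images of the \<open>T i\<close> under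
  \<open>\<phi>\<close> and on \<open>\<xi>\<close>.\<close>

lemma ext_deriv1_coord:
  assumes \<eta>: "one_form unit_sphere \<eta>" and X: "vector_field unit_sphere X" and Y: "vector_field unit_sphere Y"
  defines "c \<equiv> \<lambda>i y. \<eta> (\<psi> y) (T i (\<psi> y))"
  shows "ext_deriv1 unit_sphere \<eta> X Y (\<psi> y) =
    (\<Sum>i\<in>UNIV. \<Sum>j\<in>UNIV. coord i X y * coord j Y y * (pd i (c j) y - pd j (c i) y))"
proof -
  have sm: "smooth_map_on unit_sphere (form1_apply \<eta> X)" if "vector_field unit_sphere X" for X
    using \<eta> that by (simp add: one_form_def)
  have dc: "c j differentiable (at y)" for j
    using pullback_differentiable[OF sm[OF vector_field_T]] by (simp add: c_def form1_apply_def)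
  have D: "deriv_along unit_sphere X (form1_apply \<eta> Y) (\<psi> y) =
      (\<Sum>i\<in>UNIV. \<Sum>j\<in>UNIV. coord i X y * pd i (coord j Y) y * c j y) +
      (\<Sum>i\<in>UNIV. \<Sum>j\<in>UNIV. coord i X y * coord j Y y * pd i (c j) y)"
    if X: "vector_field unit_sphere X" and Y: "vector_field unit_sphere Y" for X Y
  proof -
    have e: "(\<lambda>y. form1_apply \<eta> Y (\<psi> y)) = (\<lambda>y. \<Sum>j\<in>UNIV. coord j Y y *\<^sub>R c j y)"
      by (rule ext) (simp add: form1_apply_def field_expand(1)[OF Y] one_form_sum[OF \<eta>] c_def)
    have "deriv_along unit_sphere X (form1_apply \<eta> Y) (\<psi> y) =
        (\<Sum>i\<in>UNIV. coord i X y *\<^sub>R pd i (\<lambda>y. \<Sum>j\<in>UNIV. coord j Y y *\<^sub>R c j y) y)"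
      unfolding deriv_along_coord[OF sm[OF Y] X] e ..
    also have "\<dots> = (\<Sum>i\<in>UNIV. coord i X y * (\<Sum>j\<in>UNIV. pd i (coord j Y) y * c j y + coord j Y y * pd i (c j) y))"
      by (subst pd_sum_scaleR) (auto intro!: coord_differentiable Y dc)
    finally show ?thesis
      by (simp add: sum_distrib_left sum.distrib distrib_left mult.assoc)
  qed
  have "form1_apply \<eta> (lie_bracket unit_sphere X Y) (\<psi> y) =
      (\<Sum>j\<in>UNIV. (\<Sum>i\<in>UNIV. coord i X y * pd i (coord j Y) y - coord i Y y * pd i (coord j X) y) * c j y)"
    by (simp add: form1_apply_def lie_bracket_coord[OF X Y] one_form_sum[OF \<eta>] c_def)
  also have "\<dots> = (\<Sum>i\<in>UNIV. \<Sum>j\<in>UNIV. coord i X y * pd i (coord j Y) y * c j y) -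
      (\<Sum>i\<in>UNIV. \<Sum>j\<in>UNIV. coord i Y y * pd i (coord j X) y * c j y)"
    unfolding sum_distrib_right left_diff_distrib sum_subtractf
    by (rule arg_cong2[of _ _ _ _ "(-)"]) (rule sum.swap)+
  finally have L: "form1_apply \<eta> (lie_bracket unit_sphere X Y) (\<psi> y) = \<dots>" .
  have S: "(\<Sum>i\<in>UNIV. \<Sum>j\<in>UNIV. coord i Y y * coord j X y * pd i (c j) y) =
      (\<Sum>i\<in>UNIV. \<Sum>j\<in>UNIV. coord i X y * coord j Y y * pd j (c i) y)"
    by (subst sum.swap) (simp add: mult.commute)
  show ?thesis
    unfolding ext_deriv1_def D[OF X Y] D[OF Y X] L S
    by (simp add: sum_subtractf right_diff_distrib)
qed

end

subsection \<open>Almost contact metric structures on the sphere\<close>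

locale acm_sphere =
  fixes \<phi> :: "'a::euclidean_space \<Rightarrow> 'a \<Rightarrow> 'a" and \<xi> \<eta> g
  assumes acm: "almost_contact_metric_structure unit_sphere \<phi> \<xi> \<eta> g"
begin

lemma one_form_\<eta>: "one_form unit_sphere \<eta>"
  and vector_field_\<xi>: "vector_field unit_sphere \<xi>"
  and vector_field_\<phi>: "vector_field unit_sphere X \<Longrightarrow> vector_field unit_sphere (endo_apply \<phi> X)"
  and metric: "riemannian_metric unit_sphere g"
  and tensor: "tensor_field_1_1 unit_sphere \<phi>"
  using acm by (simp_all add: almost_contact_metric_structure_def tensor_field_1_1_def)

context
  fixes p :: 'a
  assumes p: "p \<in> unit_sphere"
begin

lemma linear_\<phi>: "linear_map_on (tangent_space unit_sphere p) (\<phi> p)"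
  and linear_\<eta>: "linear_map_on (tangent_space unit_sphere p) (\<eta> p)"
  and linear_g: "v \<bullet> p = 0 \<Longrightarrow> linear_map_on (tangent_space unit_sphere p) (g p v)"
  and g_sym: "v \<bullet> p = 0 \<Longrightarrow> w \<bullet> p = 0 \<Longrightarrow> g p v w = g p w v"
  and g_pos: "v \<bullet> p = 0 \<Longrightarrow> v \<noteq> 0 \<Longrightarrow> 0 < g p v v"
  using bspec[OF tensor[unfolded tensor_field_1_1_def, THEN conjunct1] p]
    bspec[OF one_form_\<eta>[unfolded one_form_def, THEN conjunct1] p]
    bspec[OF metric[unfolded riemannian_metric_def, THEN conjunct1] p]
  by (simp_all add: tangent_space_sphere[OF p])

lemma \<phi>_tangent: "v \<bullet> p = 0 \<Longrightarrow> \<phi> p v \<bullet> p = 0"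
  using bspec[OF tensor[unfolded tensor_field_1_1_def, THEN conjunct1] p]
  by (auto simp: tangent_space_sphere[OF p] image_subset_iff)

lemma \<xi>_tangent: "\<xi> p \<bullet> p = 0"
  using vector_field_\<xi> p tangent_space_sphere[OF p] unfolding vector_field_def by blast

lemma \<phi>_\<phi>: "v \<bullet> p = 0 \<Longrightarrow> \<phi> p (\<phi> p v) = - v + \<eta> p v *\<^sub>R \<xi> p"
  and \<eta>_\<xi>: "\<eta> p (\<xi> p) = 1"
  using acm p tangent_space_sphere[OF p] unfolding almost_contact_metric_structure_def by blast+

lemma g_\<phi>_\<phi>:
  assumes "v \<bullet> p = 0" "w \<bullet> p = 0"
  shows "g p (\<phi> p v) (\<phi> p w) = g p v w - \<eta> p v * \<eta> p w"
proof -
  have "form2_apply g (endo_apply \<phi> (tangential v)) (endo_apply \<phi> (tangential w)) p =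
      form2_apply g (tangential v) (tangential w) p - form1_apply \<eta> (tangential v) p * form1_apply \<eta> (tangential w) p"
    using acm p vector_field_tangential unfolding almost_contact_metric_structure_def by blast
  then show ?thesis
    by (simp add: form2_apply_def form1_apply_def endo_apply_def tangential_eq assms)
qed

text \<open>For \<open>u = \<phi> \<xi>\<close> one has \<open>\<phi> u = 0\<close>, so
  \<open>u = \<eta>(u) \<xi>\<close>. Applying \<open>\<phi>\<close> again gives
  \<open>\<eta>(u) u = 0\<close>, and either factor being zero forces \<open>u = 0\<close>.\<close>

lemma \<phi>_\<xi>: "\<phi> p (\<xi> p) = 0"
proof -
  note L = linear_map_on_tangentD[OF linear_\<phi> p]
  define u where "u = \<phi> p (\<xi> p)"
  have u: "u \<bullet> p = 0" by (simp add: u_def \<phi>_tangent \<xi>_tangent)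
  have u0: "\<phi> p u = 0" by (simp add: u_def \<phi>_\<phi> \<xi>_tangent \<eta>_\<xi>)
  then have u1: "u = \<eta> p u *\<^sub>R \<xi> p" using \<phi>_\<phi>[OF u] L(1) by simp
  then have "\<phi> p u = \<eta> p u *\<^sub>R u" using L(4)[OF \<xi>_tangent, of "\<eta> p u"] by (simp add: u_def)
  then show ?thesis using u0 u1 by (auto simp: u_def)
qed

lemma \<xi>_nonzero: "\<xi> p \<noteq> 0"
  using \<eta>_\<xi> linear_map_on_tangentD(1)[OF linear_\<eta> p] by auto

text \<open>Evaluate the cube of \<open>\<phi>\<close> in two ways: as \<open>\<phi>\<close> of the
  square it is \<open>- \<phi> v\<close>, since \<open>\<phi>\<close> annihilates
  \<open>\<xi>\<close>; as the square at \<open>\<phi> v\<close> it has the extra term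
  \<open>\<eta>(\<phi> v) \<xi>\<close>.\<close>

lemma \<eta>_\<phi>: "v \<bullet> p = 0 \<Longrightarrow> \<eta> p (\<phi> p v) = 0"
proof -
  assume v: "v \<bullet> p = 0"
  note L = linear_map_on_tangentD[OF linear_\<phi> p]
  have "\<phi> p (\<phi> p (\<phi> p v)) = - \<phi> p v + \<eta> p (\<phi> p v) *\<^sub>R \<xi> p"
    by (rule \<phi>_\<phi>[OF \<phi>_tangent[OF v]])
  moreover have "\<phi> p (\<phi> p (\<phi> p v)) = - \<phi> p v"
    unfolding \<phi>_\<phi>[OF v] using L(2)[of "- v" "\<eta> p v *\<^sub>R \<xi> p"] L(4)[OF \<xi>_tangent] L(5)[OF v] v \<xi>_tangent
    by (simp add: \<phi>_\<xi>)
  ultimately show ?thesis using \<xi>_nonzero by simp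
qed

lemma g_\<xi>: "w \<bullet> p = 0 \<Longrightarrow> g p (\<xi> p) w = \<eta> p w"
proof -
  assume w: "w \<bullet> p = 0"
  have "g p 0 (\<phi> p w) = g p (\<phi> p w) 0"
    by (rule g_sym) (simp_all add: \<phi>_tangent w)
  then have "g p 0 (\<phi> p w) = 0"
    using linear_map_on_tangentD(1)[OF linear_g[OF \<phi>_tangent[OF w]] p] by simp
  then show ?thesis using g_\<phi>_\<phi>[OF \<xi>_tangent w] by (simp add: \<phi>_\<xi> \<eta>_\<xi>)
qed

lemma g_right:
  assumes "v \<bullet> p = 0" "w \<bullet> p = 0" "u \<bullet> p = 0"
  shows "g p v (w + u) = g p v w + g p v u" "g p v (w - u) = g p v w - g p v u"
    "g p v (c *\<^sub>R w) = c * g p v w" "g p v (- w) = - g p v w" "g p v 0 = 0"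
    "g p (w + u) v = g p w v + g p u v" "g p (w - u) v = g p w v - g p u v"
    "g p (c *\<^sub>R w) v = c * g p w v" "g p 0 v = 0"
  using linear_map_on_tangentD[OF linear_g[OF assms(1)] p] assms g_sym
  by (simp_all add: inner_add_left inner_diff_left)

lemma g_\<phi>_skew:
  assumes v: "v \<bullet> p = 0" and w: "w \<bullet> p = 0"
  shows "g p v (\<phi> p w) = - g p w (\<phi> p v)" "g p (\<phi> p v) (\<phi> p w) = - g p v (\<phi> p (\<phi> p w))"
proof -
  note t = v w \<xi>_tangent \<phi>_tangent[OF v] \<phi>_tangent[OF w]
  have *: "g p (\<phi> p v) (\<phi> p w) = - g p v (\<phi> p (\<phi> p w))" if "v \<bullet> p = 0" "w \<bullet> p = 0" for v w
    using that \<xi>_tangent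
    by (simp add: g_\<phi>_\<phi> \<phi>_\<phi> g_right g_sym[of _ "\<xi> p"] g_\<xi> mult.commute)
  show "g p (\<phi> p v) (\<phi> p w) = - g p v (\<phi> p (\<phi> p w))" by (rule *[OF v w])
  have "g p v (\<phi> p w) = g p (\<phi> p v) (\<phi> p (\<phi> p w))"
    using t by (simp add: g_\<phi>_\<phi> \<eta>_\<phi>)
  also have "\<dots> = - g p (\<phi> p v) w"
    using t by (simp add: \<phi>_\<phi> g_right g_sym[of _ "\<xi> p"] g_\<xi> \<eta>_\<phi>)
  finally show "g p v (\<phi> p w) = - g p w (\<phi> p v)"
    using g_sym t by simp
qed

lemma g_nonneg: "v \<bullet> p = 0 \<Longrightarrow> 0 \<le> g p v v"
  using g_pos[of v] g_right(5)[of v 0 0] by (cases "v = 0") auto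

lemma g_mixed_le:
  assumes v: "v \<bullet> p = 0" and w: "w \<bullet> p = 0"
  shows "\<bar>g p v w\<bar> \<le> (g p v v + g p w w) / 2"
proof -
  have "0 \<le> g p (v + w) (v + w)" "0 \<le> g p (v - w) (v - w)"
    using v w by (simp_all add: g_nonneg inner_add_left inner_diff_left)
  then show ?thesis
    using v w g_sym[OF v w] by (simp add: g_right inner_add_left inner_diff_left abs_le_iff)
qed

end

text \<open>
  On the compact unit tangent bundle \<open>g\<close> is comparable to the ambient inner product; its
  continuity is read off from its values on the global fields \<open>tangential a\<close>.
\<close>

lemma metric_bounds:
  obtains c C where "0 < c" "\<And>p v. p \<in> unit_sphere \<Longrightarrow> v \<bullet> p = 0 \<Longrightarrow> c * (v \<bullet> v) \<le> g p v v"
    "\<And>p v. p \<in> unit_sphere \<Longrightarrow> v \<bullet> p = 0 \<Longrightarrow> g p v v \<le> C * (v \<bullet> v)"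
proof -
  define G where "G = (\<lambda>a b. form2_apply g (tangential a) (tangential b))"
  define H where "H = (\<lambda>x. \<Sum>a\<in>Basis. \<Sum>b\<in>Basis. (snd x \<bullet> a) * ((snd x \<bullet> b) * G a b (fst x)))"
  have GH: "g p v v = H (p, v)" if p: "p \<in> unit_sphere" and v: "v \<bullet> p = 0" for p v
  proof -
    have t: "tangential a p \<in> tangent_space unit_sphere p" for a
      using vector_field_tangential p unfolding vector_field_def by blast
    then have t': "tangential a p \<bullet> p = 0" for a by (simp add: tangent_space_sphere[OF p])
    have "(\<Sum>a\<in>Basis. (v \<bullet> a) *\<^sub>R tangential a p) = (\<Sum>a\<in>Basis. (v \<bullet> a) *\<^sub>R a) - (\<Sum>a\<in>Basis. (v \<bullet> a) * (p \<bullet> a)) *\<^sub>R p"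
      by (simp add: tangential_def scaleR_diff_right sum_subtractf scaleR_sum_left inner_commute)
    then have e: "(\<Sum>a\<in>Basis. (v \<bullet> a) *\<^sub>R tangential a p) = v"
      using v by (simp add: euclidean_representation flip: euclidean_inner)
    have l: "g p u v = (\<Sum>b\<in>Basis. (v \<bullet> b) * g p u (tangential b p))" if "u \<bullet> p = 0" for u
      using linear_map_on_tangent_sum(2)[OF linear_g[OF p that] p t, of "\<lambda>b. v \<bullet> b" "\<lambda>b. b" Basis] by (simp add: e)
    have "g p v v = (\<Sum>a\<in>Basis. (v \<bullet> a) * g p (tangential a p) v)"
      unfolding l[OF v] using g_sym[OF p v t'] by simp
    then show ?thesis
      by (simp add: H_def G_def form2_apply_def l[OF t'] sum_distrib_left)
  qed
  have cG: "continuous_on unit_sphere (G a b)" for a b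
  proof -
    have "smooth_map_on unit_sphere (G a b)"
      using metric vector_field_tangential unfolding riemannian_metric_def G_def by blast
    then show ?thesis
      using smooth_map_on_differentiable differentiable_imp_continuous_on unfolding differentiable_on_def by blast
  qed
  define K where "K = (unit_sphere \<times> unit_sphere) \<inter> {x :: 'a \<times> 'a. snd x \<bullet> fst x = 0}"
  have K: "compact K"
    unfolding K_def
    by (intro compact_Int_closed compact_Times compact_sphere closed_Collect_eq continuous_intros)
  have cH: "continuous_on K H"
    unfolding H_def
    by (intro continuous_intros continuous_on_compose2[OF cG]) (auto simp: K_def)
  have scale: "g p v v = (v \<bullet> v) * H (p, v /\<^sub>R norm v)" "(p, v /\<^sub>R norm v) \<in> K"
    if p: "p \<in> unit_sphere" and v: "v \<bullet> p = 0" "v \<noteq> 0" for p v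
  proof -
    define u where "u = v /\<^sub>R norm v"
    have u: "u \<bullet> p = 0" "norm u = 1" "v = norm v *\<^sub>R u" using v by (simp_all add: u_def)
    have "g p v v = norm v * (norm v * g p u u)"
      by (subst (1 2) u(3)) (use u(1) in \<open>simp add: g_right[OF p]\<close>)
    also have "\<dots> = (v \<bullet> v) * H (p, u)"
      using GH[OF p u(1)] by (simp add: dot_square_norm power2_eq_square)
    finally show "g p v v = (v \<bullet> v) * H (p, v /\<^sub>R norm v)" by (simp add: u_def)
    show "(p, v /\<^sub>R norm v) \<in> K" using p u by (simp add: K_def u_def)
  qed
  have z: "g p 0 0 = 0" if "p \<in> unit_sphere" for p
    using g_right(5)[OF that, of 0 0 0] by simp
  show thesis
  \<comment> \<open>If there are no unit tangent vectors, as on the two-point sphere, all tangent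
    vectors vanish and any positive constants serve.\<close>
  proof (cases "K = {}")
    case True
    with scale(2) z show ?thesis by (intro that[of 1 1]) (metis empty_iff inner_zero_left mult_zero_right order_refl zero_less_one)+
  next
    case False
    obtain x where x: "x \<in> K" "\<And>y. y \<in> K \<Longrightarrow> H x \<le> H y"
      using continuous_attains_inf[OF K False cH] by blast
    obtain x' where x': "\<And>y. y \<in> K \<Longrightarrow> H y \<le> H x'"
      using continuous_attains_sup[OF K False cH] by blast
    have x1: "fst x \<in> unit_sphere" "snd x \<bullet> fst x = 0" "norm (snd x) = 1" using x(1) by (auto simp: K_def)
    show ?thesis
    proof (rule that[of "H x" "H x'"])
      show "0 < H x"
      proof -
        have "snd x \<noteq> 0" using x1(3) by auto
        then show ?thesis using g_pos[OF x1(1,2)] GH[OF x1(1,2)] by simp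
      qed
      fix p v assume p: "p \<in> (unit_sphere :: 'a set)" and v: "v \<bullet> p = 0"
      show "H x * (v \<bullet> v) \<le> g p v v"
        using scale[OF p v] x(2) z[OF p] by (cases "v = 0") (simp_all add: mult.commute mult_left_mono)
      show "g p v v \<le> H x' * (v \<bullet> v)"
        using scale[OF p v] x' z[OF p] by (cases "v = 0") (simp_all add: mult.commute mult_left_mono)
    qed
  qed
qed

end

section \<open>Components of the structure in the chart and their decay at the pole\<close>

locale acm_chart = stereographic N b + acm_sphere \<phi> \<xi> \<eta> g
  for N :: "'a::euclidean_space" and b :: "'n::finite \<Rightarrow> 'a"
    and \<phi> :: "'a \<Rightarrow> 'a \<Rightarrow> 'a" and \<xi> :: "'a \<Rightarrow> 'a" and \<eta> :: "'a \<Rightarrow> 'a \<Rightarrow> real" and g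
begin

definition A :: "'n \<Rightarrow> 'n \<Rightarrow> real^'n \<Rightarrow> real" where
  "A i j y = g (\<psi> y) (T i (\<psi> y)) (\<phi> (\<psi> y) (T j (\<psi> y)))"

definition e :: "'n \<Rightarrow> real^'n \<Rightarrow> real" where
  "e i y = \<eta> (\<psi> y) (T i (\<psi> y))"

definition F :: "'n \<Rightarrow> 'n \<Rightarrow> real^'n \<Rightarrow> real" where
  "F i j = coord i (endo_apply \<phi> (T j))"

lemmas \<phi>T = vector_field_\<phi>[OF vector_field_T]

lemma \<phi>T_eq: "\<phi> (\<psi> y) (T j (\<psi> y)) = (\<Sum>i\<in>UNIV. F i j y *\<^sub>R T i (\<psi> y))"
  using field_expand(1)[OF \<phi>T] by (simp add: endo_apply_def F_def)

lemma \<xi>_eq: "\<xi> (\<psi> y) = (\<Sum>i\<in>UNIV. coord i \<xi> y *\<^sub>R T i (\<psi> y))"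
  by (rule field_expand(1)[OF vector_field_\<xi>])

lemma g_sum:
  assumes "v \<bullet> \<psi> y = 0" "\<And>i. w i \<bullet> \<psi> y = 0"
  shows "g (\<psi> y) v (\<Sum>i\<in>UNIV. c i *\<^sub>R w i) = (\<Sum>i\<in>UNIV. c i * g (\<psi> y) v (w (i::'n)))"
    "g (\<psi> y) (\<Sum>i\<in>UNIV. c i *\<^sub>R w i) v = (\<Sum>i\<in>UNIV. c i * g (\<psi> y) (w (i::'n)) v)"
proof -
  have w: "w i \<in> tangent_space unit_sphere (\<psi> y)" for i
    using assms by (simp add: tangent_\<psi>)
  show *: "g (\<psi> y) v (\<Sum>i\<in>UNIV. c i *\<^sub>R w i) = (\<Sum>i\<in>UNIV. c i * g (\<psi> y) v (w i))"
    using linear_map_on_tangent_sum(2)[OF linear_g[OF \<psi>_sphere assms(1)] \<psi>_sphere w, where c = c and I = UNIV] by simp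
  have "(\<Sum>i\<in>UNIV. c i *\<^sub>R w i) \<bullet> \<psi> y = 0" by (simp add: inner_sum_left assms)
  then show "g (\<psi> y) (\<Sum>i\<in>UNIV. c i *\<^sub>R w i) v = (\<Sum>i\<in>UNIV. c i * g (\<psi> y) (w i) v)"
    using * assms g_sym[OF \<psi>_sphere] by simp
qed

lemma \<phi>_sum:
  assumes "\<And>i. w i \<bullet> \<psi> y = 0"
  shows "\<phi> (\<psi> y) (\<Sum>i\<in>UNIV. c i *\<^sub>R w i) = (\<Sum>i\<in>UNIV. c i *\<^sub>R \<phi> (\<psi> y) (w (i::'n)))"
  using linear_map_on_tangent_sum(2)[OF linear_\<phi>[OF \<psi>_sphere] \<psi>_sphere, where c = c and v = w and I = UNIV] assms
  by (simp add: tangent_\<psi>)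

lemma smooth_A: "smooth_map_on unit_sphere (form2_apply g (T i) (endo_apply \<phi> (T j)))"
  using metric vector_field_T \<phi>T unfolding riemannian_metric_def by blast

lemma smooth_e: "smooth_map_on unit_sphere (form1_apply \<eta> (T i))"
  using one_form_\<eta> vector_field_T unfolding one_form_def by blast

lemma A_eq: "A i j = (\<lambda>y. form2_apply g (T i) (endo_apply \<phi> (T j)) (\<psi> y))"
  by (simp add: A_def[abs_def] form2_apply_def endo_apply_def)

lemma e_eq: "e i = (\<lambda>y. form1_apply \<eta> (T i) (\<psi> y))"
  by (simp add: e_def[abs_def] form1_apply_def)

lemma A_derivative: "(A i j has_derivative (\<lambda>v. \<Sum>k\<in>UNIV. v $ k * pd k (A i j) y)) (at y)"
  unfolding A_eq by (rule pullback_has_derivative[OF smooth_A])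

lemma A_continuous: "continuous_on UNIV (pd k (A i j))"
  unfolding A_eq by (rule continuous_pd_pullback[OF smooth_A])

lemma e_derivative: "(e i has_derivative (\<lambda>v. \<Sum>k\<in>UNIV. v $ k * pd k (e i) y)) (at y)"
  unfolding e_eq by (rule pullback_has_derivative[OF smooth_e])

lemma e_continuous: "continuous_on UNIV (pd k (e i))"
  unfolding e_eq by (rule continuous_pd_pullback[OF smooth_e])

lemma A_skew: "A j i y = - A i j y"
  unfolding A_def by (rule g_\<phi>_skew(1)[OF \<psi>_sphere]) (simp_all add: T_tangent_\<psi>)

lemma A_\<xi>: "(\<Sum>j\<in>UNIV. A i j y * coord j \<xi> y) = 0"
proof -
  have "(\<Sum>j\<in>UNIV. A i j y * coord j \<xi> y) =
      g (\<psi> y) (T i (\<psi> y)) (\<Sum>j\<in>UNIV. coord j \<xi> y *\<^sub>R \<phi> (\<psi> y) (T j (\<psi> y)))"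
    by (subst g_sum) (simp_all add: T_tangent_\<psi> \<phi>_tangent[OF \<psi>_sphere] A_def mult.commute)
  also have "(\<Sum>j\<in>UNIV. coord j \<xi> y *\<^sub>R \<phi> (\<psi> y) (T j (\<psi> y))) = \<phi> (\<psi> y) (\<xi> (\<psi> y))"
    unfolding \<xi>_eq by (rule \<phi>_sum[symmetric]) (simp add: T_tangent_\<psi>)
  finally show ?thesis
    by (simp add: \<phi>_\<xi>[OF \<psi>_sphere] g_right(5)[OF \<psi>_sphere, of _ _ 0 0] T_tangent_\<psi>)
qed

lemma e_\<xi>: "(\<Sum>i\<in>UNIV. e i y * coord i \<xi> y) = 1"
  using \<eta>_\<xi>[OF \<psi>_sphere, of y] unfolding \<xi>_eq one_form_sum[OF one_form_\<eta>]
  by (simp add: e_def mult.commute)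

lemma coord_\<phi>\<phi>: "\<phi> (\<psi> y) (\<phi> (\<psi> y) (T k (\<psi> y))) = - T k (\<psi> y) + e k y *\<^sub>R \<xi> (\<psi> y)"
  unfolding e_def by (rule \<phi>_\<phi>[OF \<psi>_sphere T_tangent_\<psi>(1)])

lemma F_F: "(\<Sum>j\<in>UNIV. F i j y * F j k y) = coord i \<xi> y * e k y - (if i = k then 1 else 0)"
proof -
  have "(\<Sum>j\<in>UNIV. F i j y * F j k y) =
      (\<Sum>j\<in>UNIV. F j k y *\<^sub>R \<phi> (\<psi> y) (T j (\<psi> y))) \<bullet> T i (\<psi> y) / (h y)\<^sup>2"
    by (simp add: F_def coord_def endo_apply_def inner_sum_left sum_divide_distrib mult.commute)
  also have "(\<Sum>j\<in>UNIV. F j k y *\<^sub>R \<phi> (\<psi> y) (T j (\<psi> y))) = - T k (\<psi> y) + e k y *\<^sub>R \<xi> (\<psi> y)"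
    unfolding coord_\<phi>\<phi>[symmetric] by (subst (2) \<phi>T_eq) (rule \<phi>_sum[symmetric], simp add: T_tangent_\<psi>)
  also have "\<dots> \<bullet> T i (\<psi> y) / (h y)\<^sup>2 = - coord i (T k) y + e k y * coord i \<xi> y"
    by (simp add: coord_def inner_add_left inner_diff_left diff_divide_distrib)
  finally show ?thesis by (simp add: coord_T mult.commute)
qed

lemma e_F: "(\<Sum>i\<in>UNIV. e i y * F i j y) = 0"
  using \<eta>_\<phi>[OF \<psi>_sphere T_tangent_\<psi>(1), of y j] unfolding \<phi>T_eq one_form_sum[OF one_form_\<eta>]
  by (simp add: e_def mult.commute)

lemma A_F: "(\<Sum>j\<in>UNIV. F j i y * A j k y) = - (\<Sum>j\<in>UNIV. A i j y * F j k y)"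
proof -
  have "(\<Sum>j\<in>UNIV. F j i y * A j k y) = g (\<psi> y) (\<phi> (\<psi> y) (T i (\<psi> y))) (\<phi> (\<psi> y) (T k (\<psi> y)))"
    unfolding \<phi>T_eq[where j = i]
    by (subst g_sum(2)) (simp_all add: T_tangent_\<psi> \<phi>_tangent[OF \<psi>_sphere] A_def)
  also have "\<dots> = - g (\<psi> y) (T i (\<psi> y)) (\<phi> (\<psi> y) (\<phi> (\<psi> y) (T k (\<psi> y))))"
    by (rule g_\<phi>_skew(2)[OF \<psi>_sphere]) (simp_all add: T_tangent_\<psi>)
  also have "\<phi> (\<psi> y) (\<phi> (\<psi> y) (T k (\<psi> y))) = (\<Sum>j\<in>UNIV. F j k y *\<^sub>R \<phi> (\<psi> y) (T j (\<psi> y)))"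
    unfolding \<phi>T_eq[where j = k] by (rule \<phi>_sum) (simp add: T_tangent_\<psi>)
  also have "g (\<psi> y) (T i (\<psi> y)) \<dots> = (\<Sum>j\<in>UNIV. A i j y * F j k y)"
    by (subst g_sum(1)) (simp_all add: T_tangent_\<psi> \<phi>_tangent[OF \<psi>_sphere] A_def mult.commute)
  finally show ?thesis .
qed

lemma T_sum_norm: "(\<Sum>i\<in>UNIV. v $ i *\<^sub>R T i (\<psi> y)) \<bullet> (\<Sum>i\<in>UNIV. v $ i *\<^sub>R T i (\<psi> y)) = (h y)\<^sup>2 * (v \<bullet> v)"
  by (simp add: inner_sum_left inner_sum_right T_T if_distrib inner_vec_def sum_distrib_left mult_ac cong: if_cong)

lemma h_norm: "h y = 2 / (1 + (norm y)\<^sup>2)"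
  by (simp add: h_def power2_norm_eq_inner)

text \<open>The \<open>T i\<close> have length \<open>h\<close>, so the global comparison of
  \<open>g\<close> with the ambient inner product becomes decay in the chart. The vectors
  \<open>\<phi> T j\<close> and the values of \<open>\<eta>\<close> are controlled by
  \<open>g(\<phi> v, \<phi> v) + \<eta>(v)^2 = g(v, v)\<close>.\<close>

lemma bounds:
  obtains C where "\<And>i j y. \<bar>A i j y\<bar> \<le> C / (1 + (norm y)\<^sup>2)\<^sup>2" "\<And>i y. \<bar>e i y\<bar> \<le> C / (1 + (norm y)\<^sup>2)"
    "\<And>w y. norm w \<le> C * (1 + (norm y)\<^sup>2)\<^sup>2 *
      norm ((\<chi> i. \<Sum>j\<in>UNIV. (A i j y + e i y * e j y) * w $ j) :: real^'n)"
proof -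
  obtain c C where c: "0 < c" and lower: "\<And>p v. p \<in> unit_sphere \<Longrightarrow> v \<bullet> p = 0 \<Longrightarrow> c * (v \<bullet> v) \<le> g p v v"
    and upper: "\<And>p v. p \<in> unit_sphere \<Longrightarrow> v \<bullet> p = 0 \<Longrightarrow> g p v v \<le> C * (v \<bullet> v)"
    using metric_bounds by blast
  have \<eta>2: "(\<eta> (\<psi> y) v)\<^sup>2 \<le> g (\<psi> y) v v" if "v \<bullet> \<psi> y = 0" for y v
    using g_\<phi>_\<phi>[OF \<psi>_sphere that that] g_nonneg[OF \<psi>_sphere \<phi>_tangent[OF \<psi>_sphere that]]
    by (simp add: power2_eq_square)
  have gT: "g (\<psi> y) (T i (\<psi> y)) (T i (\<psi> y)) \<le> C * (h y)\<^sup>2" for i y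
    using upper[OF \<psi>_sphere T_tangent_\<psi>(1), of y i] by (simp add: T_T)
  have C: "0 \<le> C"
  proof -
    have "0 \<le> C * (h 0)\<^sup>2"
      using gT[of 0 undefined] g_nonneg[OF \<psi>_sphere T_tangent_\<psi>(1), of 0 undefined] by linarith
    then show ?thesis using h_pos[of 0] by (simp add: zero_le_mult_iff)
  qed
  have A_bound: "\<bar>A i j y\<bar> \<le> C * (h y)\<^sup>2" for i j y
  proof -
    have t: "T j (\<psi> y) \<bullet> \<psi> y = 0" "\<phi> (\<psi> y) (T j (\<psi> y)) \<bullet> \<psi> y = 0" for j
      by (simp_all add: T_tangent_\<psi> \<phi>_tangent[OF \<psi>_sphere])
    have g2: "g (\<psi> y) (\<phi> (\<psi> y) (T j (\<psi> y))) (\<phi> (\<psi> y) (T j (\<psi> y))) \<le> C * (h y)\<^sup>2"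
      using g_\<phi>_\<phi>[OF \<psi>_sphere t(1) t(1), of j j] gT[of y j] zero_le_square[of "\<eta> (\<psi> y) (T j (\<psi> y))"] by linarith
    have le: "\<bar>x\<bar> \<le> K" if "\<bar>x\<bar> \<le> (q + r) / 2" "r \<le> K" "q \<le> K" for x q r K :: real
      by (rule order_trans[OF that(1)]) (use that(2,3) in simp)
    show ?thesis
      unfolding A_def by (rule le[OF g_mixed_le[OF \<psi>_sphere t(1) t(2)] g2 gT])
  qed
  have e_bound: "\<bar>e i y\<bar> \<le> sqrt C * h y" for i y
  proof -
    have "(e i y)\<^sup>2 \<le> C * (h y)\<^sup>2"
      using \<eta>2[OF T_tangent_\<psi>(1), of y i] gT[of y i] by (simp add: e_def)
    then have "sqrt ((e i y)\<^sup>2) \<le> sqrt (C * (h y)\<^sup>2)" by (rule real_sqrt_le_mono)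
    then show ?thesis using h_pos[of y] by (simp add: real_sqrt_mult)
  qed
  have coercive: "c * (h y)\<^sup>2 * norm w \<le> norm ((\<chi> i. \<Sum>j\<in>UNIV. (A i j y + e i y * e j y) * w $ j) :: real^'n)" for w y
  proof -
    define p where "p = \<psi> y"
    define z :: "real^'n" where "z = (\<chi> i. \<Sum>j\<in>UNIV. (A i j y + e i y * e j y) * w $ j)"
    define u where "u = (\<Sum>i\<in>UNIV. w $ i *\<^sub>R T i p)"
    \<comment> \<open>\<open>J = \<phi> + \<eta> \<otimes> \<xi>\<close> is an isometry of
      \<open>g\<close>, and the matrix \<open>A + e \<otimes> e\<close> represents the form
      \<open>g(x, J y)\<close>. Pairing its value at \<open>w\<close> with the coordinates
      \<open>v\<close> of \<open>J u\<close> therefore gives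
      \<open>g(J u, J u) = g(u, u)\<close>.\<close>
    define Ju where "Ju = \<phi> p u + \<eta> p u *\<^sub>R \<xi> p"
    have p: "p \<in> unit_sphere" by (simp only: p_def \<psi>_sphere)
    have Tp: "T i p \<bullet> p = 0" for i by (simp add: p_def T_tangent_\<psi>)
    have up: "u \<bullet> p = 0" by (simp add: u_def inner_sum_left Tp)
    note t = up \<phi>_tangent[OF p up] \<xi>_tangent[OF p]
    have Jp: "Ju \<bullet> p = 0" by (simp add: Ju_def inner_add_left t)
    define v :: "real^'n" where "v = (\<chi> i. Ju \<bullet> T i p / (h y)\<^sup>2)"
    have Jv: "Ju = (\<Sum>i\<in>UNIV. v $ i *\<^sub>R T i p)"
      using tangent_expand[of Ju y] Jp by (simp add: v_def p_def)
    define q where "q = g p u u"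
    have JJ: "g p Ju Ju = q"
      using t g_sym[OF p t(2,3)] unfolding Ju_def q_def
      by (simp add: g_right[OF p] inner_add_left g_\<phi>_\<phi>[OF p] g_\<xi>[OF p] \<eta>_\<phi>[OF p] \<eta>_\<xi>[OF p])
    have zi: "g p (T i p) Ju = z $ i" for i
    proof -
      have "g p (T i p) Ju = g p (T i p) (\<phi> p u) + \<eta> p u * \<eta> p (T i p)"
        using t Tp unfolding Ju_def by (simp add: g_right[OF p] g_sym[OF p Tp t(3)] g_\<xi>[OF p])
      also have "\<phi> p u = (\<Sum>j\<in>UNIV. w $ j *\<^sub>R \<phi> p (T j p))"
        unfolding u_def p_def by (rule \<phi>_sum) (simp add: T_tangent_\<psi>)
      also have "g p (T i p) \<dots> = (\<Sum>j\<in>UNIV. w $ j * A i j y)"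
        unfolding p_def A_def by (rule g_sum) (simp_all add: T_tangent_\<psi> \<phi>_tangent[OF \<psi>_sphere])
      also have "\<eta> p u = (\<Sum>j\<in>UNIV. w $ j * e j y)"
        unfolding p_def u_def e_def by (rule one_form_sum[OF one_form_\<eta>])
      finally show ?thesis
        by (simp add: z_def e_def p_def sum_distrib_left sum.distrib algebra_simps)
    qed
    have "q = g p (\<Sum>i\<in>UNIV. v $ i *\<^sub>R T i p) Ju"
      unfolding Jv[symmetric] JJ ..
    also have "\<dots> = (\<Sum>i\<in>UNIV. v $ i * g p (T i p) Ju)"
      unfolding p_def by (rule g_sum(2)) (simp_all add: Jp[unfolded p_def] T_tangent_\<psi>)
    finally have "q = v \<bullet> z" by (simp add: zi inner_vec_def)
    then have q1: "q \<le> norm v * norm z" using norm_cauchy_schwarz by metis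
    have q2: "c * (h y * norm w)\<^sup>2 \<le> q"
      using lower[OF p up] T_sum_norm[of w y] by (simp add: q_def u_def p_def power_mult_distrib power2_norm_eq_inner)
    have q3: "c * (h y * norm v)\<^sup>2 \<le> q"
      using lower[OF p Jp] T_sum_norm[of v y] JJ Jv by (simp add: p_def power_mult_distrib power2_norm_eq_inner)
    \<comment> \<open>\<open>q\<close> dominates \<open>c h^2 |v|^2\<close> and is at most
      \<open>|v| |z|\<close>; dividing by \<open>|v|\<close> bounds \<open>v\<close>, and this bound
      turns the same comparison for \<open>w\<close> into the claim.\<close>
    have v: "c * (h y)\<^sup>2 * norm v \<le> norm z"
    proof (cases "norm v = 0")
      case False
      have "c * (h y)\<^sup>2 * norm v * norm v \<le> norm z * norm v"
        using q1 q3 by (simp add: power2_eq_square mult_ac)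
      then show ?thesis using False by (simp add: mult_le_cancel_right)
    qed simp
    have "(c * (h y)\<^sup>2 * norm w)\<^sup>2 = c * (h y)\<^sup>2 * (c * (h y * norm w)\<^sup>2)"
      by (simp add: power2_eq_square mult_ac)
    also have "\<dots> \<le> c * (h y)\<^sup>2 * (norm v * norm z)"
      using q1 q2 c by (intro mult_left_mono) auto
    also have "\<dots> \<le> (norm z)\<^sup>2"
      using mult_right_mono[OF v norm_ge_zero[of z]] by (simp add: power2_eq_square mult_ac)
    finally show ?thesis unfolding z_def[symmetric] by (rule power2_le_imp_le) simp
  qed
  \<comment> \<open>\<open>h = 2 / (1 + |y|^2)\<close> enters as \<open>h^2\<close>,
    \<open>h\<close> and \<open>1 / h^2\<close>, whence the factors 4, 2 and 1/4.\<close>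
  define D where "D = max (4 * C) (max (2 * sqrt C) (1 / (4 * c)))"
  show thesis
  proof (rule that[of D])
    fix i j y
    have "\<bar>A i j y\<bar> \<le> (4 * C) / (1 + (norm y)\<^sup>2)\<^sup>2"
      using A_bound[of i j y] by (simp add: h_norm power_divide mult.commute)
    also have "\<dots> \<le> D / (1 + (norm y)\<^sup>2)\<^sup>2"
      by (rule divide_right_mono) (simp_all add: D_def)
    finally show "\<bar>A i j y\<bar> \<le> D / (1 + (norm y)\<^sup>2)\<^sup>2" .
  next
    fix i y
    have "\<bar>e i y\<bar> \<le> (2 * sqrt C) / (1 + (norm y)\<^sup>2)"
      using e_bound[of i y] by (simp add: h_norm mult.commute)
    also have "\<dots> \<le> D / (1 + (norm y)\<^sup>2)"
      by (rule divide_right_mono) (simp_all add: D_def)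
    finally show "\<bar>e i y\<bar> \<le> D / (1 + (norm y)\<^sup>2)" .
  next
    fix w y :: "real^'n"
    define z :: "real^'n" where "z = (\<chi> i. \<Sum>j\<in>UNIV. (A i j y + e i y * e j y) * w $ j)"
    define s where "s = 1 + (norm y)\<^sup>2"
    have s: "0 < s" unfolding s_def by (rule add_pos_nonneg) auto
    have "c * (2 / s)\<^sup>2 * norm w \<le> norm z"
      using coercive[of y w] by (simp add: z_def s_def h_norm)
    then have "norm w \<le> 1 / (4 * c) * s\<^sup>2 * norm z"
      using s c by (simp add: field_simps power2_eq_square)
    also have "\<dots> \<le> D * s\<^sup>2 * norm z"
      by (intro mult_right_mono) (simp_all add: D_def)
    finally show "norm w \<le> D * (1 + (norm y)\<^sup>2)\<^sup>2 *
        norm ((\<chi> i. \<Sum>j\<in>UNIV. (A i j y + e i y * e j y) * w $ j) :: real^'n)"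
      by (simp add: z_def s_def)
  qed
qed

end

section \<open>Anti-quasi-Sasakian structures in the chart\<close>

locale aqS_chart = stereographic N b
  for N :: "'a::euclidean_space" and b :: "'n::finite \<Rightarrow> 'a" +
  fixes \<phi> :: "'a \<Rightarrow> 'a \<Rightarrow> 'a" and \<xi> \<eta> g
  assumes aqS: "anti_quasi_Sasakian unit_sphere \<phi> \<xi> \<eta> g"
begin

lemma N_tensor_eq:
  assumes "vector_field unit_sphere X" "vector_field unit_sphere Y" "p \<in> unit_sphere"
  shows "N_tensor unit_sphere \<phi> \<xi> \<eta> X Y p = (2 * ext_deriv1 unit_sphere \<eta> X Y p) *\<^sub>R \<xi> p"
  using aqS assms by (simp add: anti_quasi_Sasakian_def)

lemma ext_deriv2_\<Phi>:
  assumes "vector_field unit_sphere X" "vector_field unit_sphere Y" "vector_field unit_sphere Z" "p \<in> unit_sphere"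
  shows "ext_deriv2 unit_sphere (fundamental_form g \<phi>) X Y Z p = 0"
  using aqS assms by (simp add: anti_quasi_Sasakian_def)

sublocale acm_chart N b \<phi> \<xi> \<eta> g
  by unfold_locales (use aqS in \<open>simp add: anti_quasi_Sasakian_def\<close>)

text \<open>The fields \<open>T i\<close> commute on the chart, so only the three derivative terms
  of \<open>d\<Phi>\<close> survive.\<close>

lemma A_closed: "pd k (A i j) y + pd i (A j k) y + pd j (A k i) y = 0"
proof -
  have z: "form2_apply (fundamental_form g \<phi>) (lie_bracket unit_sphere (T i) (T j)) (T k) (\<psi> y) = 0" for i j k
    using g_right(9)[OF \<psi>_sphere, of "\<phi> (\<psi> y) (T k (\<psi> y))" y 0 0] \<phi>_tangent[OF \<psi>_sphere T_tangent_\<psi>(1)]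
    by (simp add: form2_apply_def fundamental_form_def lie_bracket_T)
  have d: "deriv_along unit_sphere (T k) (form2_apply (fundamental_form g \<phi>) (T i) (T j)) (\<psi> y) = pd k (A i j) y" for i j k
    using pd_pullback[OF smooth_A, of k i j y]
    by (simp add: A_eq form2_apply_def fundamental_form_def endo_apply_def)
  have "ext_deriv2 unit_sphere (fundamental_form g \<phi>) (T i) (T j) (T k) (\<psi> y) = 0"
    by (rule ext_deriv2_\<Phi>[OF vector_field_T vector_field_T vector_field_T \<psi>_sphere])
  then show ?thesis by (simp add: ext_deriv2_def z d)
qed

text \<open>
  The \<open>\<xi>\<close>-component of the condition on \<open>N_\<phi>\<close> says \<open>\<eta> [\<phi>X, \<phi>Y] = d\<eta>(X, Y)\<close>, and its left-hand
  side is \<open>- d\<eta>(\<phi>X, \<phi>Y)\<close>.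
\<close>

lemma d\<eta>_anti_invariant:
  assumes X: "vector_field unit_sphere X" and Y: "vector_field unit_sphere Y"
  shows "ext_deriv1 unit_sphere \<eta> (endo_apply \<phi> X) (endo_apply \<phi> Y) (\<psi> y) = - ext_deriv1 unit_sphere \<eta> X Y (\<psi> y)"
proof -
  define p where "p = \<psi> y"
  have p: "p \<in> unit_sphere" by (simp only: p_def \<psi>_sphere)
  note f = X Y vector_field_\<phi>[OF X] vector_field_\<phi>[OF Y]
  note L\<eta> = linear_map_on_tangentD[OF linear_\<eta>[OF p] p]
  have t: "lie_bracket unit_sphere X' Y' p \<bullet> p = 0" if "vector_field unit_sphere X'" "vector_field unit_sphere Y'" for X' Y'
    unfolding p_def by (rule lie_bracket_tangent[OF that])
  have "nijenhuis_torsion unit_sphere \<phi> X Y p + ext_deriv1 unit_sphere \<eta> X Y p *\<^sub>R \<xi> p =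
      ext_deriv1 unit_sphere \<eta> X Y p *\<^sub>R \<xi> p + ext_deriv1 unit_sphere \<eta> X Y p *\<^sub>R \<xi> p"
    using N_tensor_eq[OF X Y p] unfolding N_tensor_def mult_2 scaleR_left_distrib .
  then have "nijenhuis_torsion unit_sphere \<phi> X Y p = ext_deriv1 unit_sphere \<eta> X Y p *\<^sub>R \<xi> p"
    by (rule add_right_imp_eq)
  then have 1: "\<eta> p (nijenhuis_torsion unit_sphere \<phi> X Y p) = ext_deriv1 unit_sphere \<eta> X Y p"
    using L\<eta>(4)[OF \<xi>_tangent[OF p]] by (simp add: \<eta>_\<xi>[OF p])
  have 2: "\<eta> p (nijenhuis_torsion unit_sphere \<phi> X Y p) =
      \<eta> p (lie_bracket unit_sphere (endo_apply \<phi> X) (endo_apply \<phi> Y) p)"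
  proof -
    define u where "u = lie_bracket unit_sphere (endo_apply \<phi> X) (endo_apply \<phi> Y) p"
    define v1 where "v1 = \<phi> p (lie_bracket unit_sphere X Y p)"
    define v2 where "v2 = lie_bracket unit_sphere X (endo_apply \<phi> Y) p"
    define v3 where "v3 = lie_bracket unit_sphere (endo_apply \<phi> X) Y p"
    have uv: "u \<bullet> p = 0" "v1 \<bullet> p = 0" "v2 \<bullet> p = 0" "v3 \<bullet> p = 0"
      unfolding u_def v1_def v2_def v3_def by (intro \<phi>_tangent[OF p] t f)+
    note uv = uv uv[THEN \<phi>_tangent[OF p]] uv[THEN \<eta>_\<phi>[OF p]]
    have "nijenhuis_torsion unit_sphere \<phi> X Y p = u + \<phi> p v1 - \<phi> p v2 - \<phi> p v3"
      by (simp add: nijenhuis_torsion_def u_def v1_def v2_def v3_def endo_apply_def)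
    also have "\<eta> p \<dots> = \<eta> p u"
      by (simp add: uv L\<eta>(2,3) inner_add_left inner_diff_left)
    finally show ?thesis by (simp only: u_def)
  qed
  have d0: "deriv_along unit_sphere X' (form1_apply \<eta> (endo_apply \<phi> Y')) p = 0"
    if X': "vector_field unit_sphere X'" and Y': "vector_field unit_sphere Y'" for X' Y'
  proof -
    have s: "smooth_map_on unit_sphere (form1_apply \<eta> (endo_apply \<phi> Y'))"
      using one_form_\<eta> vector_field_\<phi>[OF Y'] unfolding one_form_def by blast
    have "(\<lambda>y. form1_apply \<eta> (endo_apply \<phi> Y') (\<psi> y)) = (\<lambda>y. 0)"
      by (simp add: form1_apply_def endo_apply_def \<eta>_\<phi>[OF \<psi>_sphere field_expand(2)[OF Y']])
    then show ?thesis
      unfolding p_def deriv_along_coord[OF s X'] by (simp add: pd_eq[OF has_derivative_const])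
  qed
  have "ext_deriv1 unit_sphere \<eta> (endo_apply \<phi> X) (endo_apply \<phi> Y) p =
      - form1_apply \<eta> (lie_bracket unit_sphere (endo_apply \<phi> X) (endo_apply \<phi> Y)) p"
    unfolding ext_deriv1_def d0[OF f(3) Y] d0[OF f(4) X] by simp
  then show ?thesis
    unfolding p_def[symmetric] using 1 2 by (simp only: form1_apply_def)
qed

lemma ext_deriv1_e:
  assumes "vector_field unit_sphere X" "vector_field unit_sphere Y"
  shows "ext_deriv1 unit_sphere \<eta> X Y (\<psi> y) =
    (\<Sum>i\<in>UNIV. \<Sum>j\<in>UNIV. coord i X y * coord j Y y * (pd i (e j) y - pd j (e i) y))"
  using ext_deriv1_coord[OF one_form_\<eta> assms] by (simp add: e_def[abs_def])

lemma ext_deriv1_T: "ext_deriv1 unit_sphere \<eta> (T i) (T j) (\<psi> y) = pd i (e j) y - pd j (e i) y"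
proof -
  have "form1_apply \<eta> (lie_bracket unit_sphere (T i) (T j)) (\<psi> y) = 0"
    by (simp add: form1_apply_def lie_bracket_T linear_map_on_tangentD(1)[OF linear_\<eta>[OF \<psi>_sphere] \<psi>_sphere])
  then show ?thesis
    unfolding ext_deriv1_def e_eq pd_pullback[OF smooth_e] by simp
qed

lemma de_F: "(\<Sum>b\<in>UNIV. (\<Sum>a\<in>UNIV. F a i y * (pd b (e a) y - pd a (e b) y)) * F b j y) =
    - (pd j (e i) y - pd i (e j) y)"
proof -
  have "(\<Sum>b\<in>UNIV. (\<Sum>a\<in>UNIV. F a i y * (pd b (e a) y - pd a (e b) y)) * F b j y) =
      - (\<Sum>a\<in>UNIV. \<Sum>b\<in>UNIV. F a i y * F b j y * (pd a (e b) y - pd b (e a) y))"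
    unfolding sum_distrib_right sum_negf[symmetric]
    by (subst sum.swap) (intro sum.cong refl, simp add: algebra_simps)
  also have "\<dots> = - ext_deriv1 unit_sphere \<eta> (endo_apply \<phi> (T i)) (endo_apply \<phi> (T j)) (\<psi> y)"
    by (simp add: ext_deriv1_e[OF \<phi>T \<phi>T] F_def)
  finally show ?thesis
    by (simp add: d\<eta>_anti_invariant[OF vector_field_T vector_field_T] ext_deriv1_T)
qed

text \<open>Anti-invariance with \<open>\<phi> \<xi> = 0\<close> gives
  \<open>d\<eta>(X, \<xi>) = - d\<eta>(\<phi> X, \<phi> \<xi>) = 0\<close>.\<close>

lemma de_\<xi>: "(\<Sum>i\<in>UNIV. coord i \<xi> y * (pd i (e a) y - pd a (e i) y)) = 0"
proof -
  have "coord j (endo_apply \<phi> \<xi>) y = 0" for j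
    by (simp add: coord_def endo_apply_def \<phi>_\<xi>[OF \<psi>_sphere])
  then have "ext_deriv1 unit_sphere \<eta> (endo_apply \<phi> (T a)) (endo_apply \<phi> \<xi>) (\<psi> y) = 0"
    by (simp add: ext_deriv1_e[OF \<phi>T vector_field_\<phi>[OF vector_field_\<xi>]])
  then have "ext_deriv1 unit_sphere \<eta> (T a) \<xi> (\<psi> y) = 0"
    using d\<eta>_anti_invariant[OF vector_field_T vector_field_\<xi>, of a y] by simp
  then have "(\<Sum>j\<in>UNIV. \<Sum>i\<in>UNIV. coord i (T a) y * coord j \<xi> y * (pd i (e j) y - pd j (e i) y)) = 0"
    by (subst sum.swap) (simp add: ext_deriv1_e[OF vector_field_T vector_field_\<xi>])
  then have "(\<Sum>j\<in>UNIV. coord j \<xi> y * (pd a (e j) y - pd j (e a) y)) = 0"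
    by (simp add: coord_T if_distrib if_distribR cong: if_cong)
  then show ?thesis
    by (simp add: right_diff_distrib sum_subtractf)
qed

lemma chart_dimension_less: "CARD('n) < 3"
proof (rule ccontr)
  assume "\<not> CARD('n) < 3"
  then have card: "3 \<le> CARD('n)" by simp
  obtain C where "\<And>i j y. \<bar>A i j y\<bar> \<le> C / (1 + (norm y)\<^sup>2)\<^sup>2" "\<And>i y. \<bar>e i y\<bar> \<le> C / (1 + (norm y)\<^sup>2)"
    "\<And>w y. norm w \<le> C * (1 + (norm y)\<^sup>2)\<^sup>2 *
      norm ((\<chi> i. \<Sum>j\<in>UNIV. (A i j y + e i y * e j y) * w $ j) :: real^'n)"
    by (rule bounds) (rule that)
  from no_decaying_structure[where A = A and \<eta> = e and \<xi> = "\<lambda>i. coord i \<xi>" and F = F and C = C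
      and A' = "\<lambda>i j k. pd k (A i j)" and \<eta>' = "\<lambda>i k. pd k (e i)",
      OF card A_derivative A_continuous e_derivative e_continuous A_skew A_closed A_\<xi> e_\<xi> de_\<xi> F_F e_F A_F de_F this]
  show False .
qed

end

text \<open>
  A type with \<open>DIM('a) - 1\<close> elements, to index the coordinates of the chart; the first branch
  only ensures nonemptiness.
\<close>

typedef (overloaded) 'a equator_basis =
  "if DIM('a::euclidean_space) = 1 then Basis else Basis - {SOME b :: 'a. b \<in> Basis}"
proof (cases "DIM('a) = 1")
  case False
  have "\<not> Basis \<subseteq> {SOME b :: 'a. b \<in> Basis}"
  proof
    assume "Basis \<subseteq> {SOME b :: 'a. b \<in> Basis}"
    then have "DIM('a) \<le> 1" using card_mono[of "{SOME b :: 'a. b \<in> Basis}" Basis] by simp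
    with False DIM_positive[where 'a='a] show False by simp
  qed
  with False show ?thesis by auto
qed (use nonempty_Basis in \<open>simp add: ex_in_conv\<close>)

instance equator_basis :: (euclidean_space) finite
proof
  have "range (Rep_equator_basis :: 'a equator_basis \<Rightarrow> 'a) \<subseteq> Basis"
  proof (rule image_subsetI)
    show "Rep_equator_basis x \<in> Basis" for x :: "'a equator_basis"
      using Rep_equator_basis[of x] by (auto split: if_splits)
  qed
  then have "finite (range (Rep_equator_basis :: 'a equator_basis \<Rightarrow> 'a))"
    using finite_Basis finite_subset by blast
  then show "finite (UNIV :: 'a equator_basis set)"
    by (rule finite_imageD) (simp add: inj_on_def Rep_equator_basis_inject)
qed

theorem corollary3p6:
  fixes n :: nat
  assumes "n \<ge> 1"
    and "DIM('a::euclidean_space) = 2 * n + 2"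
  shows "\<not> (\<exists>\<phi> \<xi> \<eta> g. anti_quasi_Sasakian (sphere (0::'a) 1) \<phi> \<xi> \<eta> g)"
proof
  assume "\<exists>\<phi> \<xi> \<eta> g. anti_quasi_Sasakian (sphere (0::'a) 1) \<phi> \<xi> \<eta> g"
  then obtain \<phi> \<xi> \<eta> g where aqS: "anti_quasi_Sasakian (sphere (0::'a) 1) \<phi> \<xi> \<eta> g" by blast
  \<comment> \<open>This is the vector omitted in \<open>equator_basis\<close>: as the dimension is
    \<open>2 * n + 2\<close>, the second branch of that type definition is in force.\<close>
  define N :: 'a where "N = (SOME b. b \<in> Basis)"
  have N: "N \<in> Basis" unfolding N_def using nonempty_Basis some_in_eq by blast
  let ?b = "Rep_equator_basis :: 'a equator_basis \<Rightarrow> 'a"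
  have b: "bij_betw ?b UNIV (Basis - {N})"
    using type_definition.Rep_range[OF type_definition_equator_basis[where 'a='a]] assms(2)
      Rep_equator_basis_inject[where 'a='a]
    by (simp add: bij_betw_def inj_def N_def)
  then have bB: "?b i \<in> Basis" "?b i \<noteq> N" for i by (auto simp: bij_betw_def)
  interpret aqS_chart N ?b \<phi> \<xi> \<eta> g
  proof
    show "N \<bullet> N = 1" using N by simp
    show "?b i \<bullet> N = 0" for i using N bB by (simp add: inner_Basis)
    show "?b i \<bullet> ?b j = (if i = j then 1 else 0)" for i j
      using bB by (simp add: inner_Basis Rep_equator_basis_inject)
    show "v = (v \<bullet> N) *\<^sub>R N + (\<Sum>i\<in>UNIV. (v \<bullet> ?b i) *\<^sub>R ?b i)" for v :: 'a
    proof -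
      have "v = (\<Sum>c\<in>Basis. (v \<bullet> c) *\<^sub>R c)" by (simp add: euclidean_representation)
      also have "\<dots> = (v \<bullet> N) *\<^sub>R N + (\<Sum>c\<in>Basis - {N}. (v \<bullet> c) *\<^sub>R c)"
        by (rule sum.remove[OF finite_Basis N])
      also have "(\<Sum>c\<in>Basis - {N}. (v \<bullet> c) *\<^sub>R c) = (\<Sum>i\<in>UNIV. (v \<bullet> ?b i) *\<^sub>R ?b i)"
        by (rule sum.reindex_bij_betw[OF b, symmetric])
      finally show ?thesis .
    qed
  qed (rule aqS)
  have "CARD('a equator_basis) = DIM('a) - 1"
    using bij_betw_same_card[OF b] N by (simp add: card_Diff_singleton)
  with chart_dimension_less assms show False by simp
qed

end
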